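(* Let $I=[-R_1,R_1]$, $J=[-R_2,R_2]$, and let $\lambda_n$ be the eigenvalues of $T_{I,J}$. Then, as $R_1,R_2\to\infty$, $$\sum_n\lambda_n^2\sim\frac{\pi}{2}R_1^2+\frac{\pi}{2}R_2^2+2\Big((R_1^2+R_2^2)\arctan(R_1/R_2)-R_1R_2-R_1^2\arctan(R_1)+2R_1^2\arctan(R_2/R_1)\Big).$$
   Context: The Fourier transform is $\hat f(t)=\int_{\mathbb{R}} f(x)e^{-2\pi i t x}\,dx$. The Fourier symmetric Sobolev space $\mathcal{H}$ is the Hilbert space of functions $f$ on $\mathbb{R}$ with $$\|f\|_{\mathcal{H}}^2=\int_{\mathbb{R}}|f(x)|^2(1+x^2)\,dx+\int_{\mathbb{R}}|\hat f(\xi)|^2(1+\xi^2)\,d\xi<\infty,$$ with inner product $\langle f,g\rangle_{\mathcal{H}}=\int_{\mathbb{R}} f\overline{g}(1+x^2)\,dx+\int_{\mathbb{R}}\hat f\,\overline{\hat g}(1+\xi^2)\,d\xi$. It is a reproducing kernel Hilbert space; $K_t\in\mathcal{H}$ denotes its reproducing kernel at $t\in\mathbb{R}$, i.e. $f(t)=\langle f,K_t\rangle_{\mathcal{H}}$ for all $f\in\mathcal{H}$. For measurable $I,J\subset\mathbb{R}$, the operator $T_{I,J}:\mathcal{H}\to\mathcal{H}$ is defined by $$T_{I,J}f(t)=\int_I f(x)\overline{K_t(x)}(1+x^2)\,dx+\int_J\hat f(x)\overline{\widehat{K_t}(x)}(1+x^2)\,dx.$$ Eigenvalues are counted with multiplicity.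 $f\sim g$ means that the quotient $f/g$ tends to $1$ in the indicated limit. *)

theory Defs
  imports
    "HOL-Analysis.Analysis"
    "HOL-Library.Function_Algebras"
    "HOL-Library.Landau_Symbols"
begin

text \<open>A function with finite norm and its Fourier transform are both integrable, so the
  Fourier transform is given by the integral itself, on all of \<open>\<real>\<close>.\<close>

definition fourier :: "(real \<Rightarrow> complex) \<Rightarrow> real \<Rightarrow> complex" where
  "fourier f t = (LINT x|lborel. f x * exp (- 2 * of_real pi * \<i> * of_real t * of_real x))"

text \<open>Each almost-everywhere class of finite norm contains exactly one continuous function,
  the one for which the point evaluations of the reproducing kernel space are meant. The
  elements of the space are these continuous representatives.\<close>

definition fourier_sobolev :: "(real \<Rightarrow> complex) set" where
  "fourier_sobolev = {f. continuous_on UNIV f \<and>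
     integrable lborel (\<lambda>x. (cmod (f x))\<^sup>2 * (1 + x\<^sup>2)) \<and>
     integrable lborel (\<lambda>\<xi>. (cmod (fourier f \<xi>))\<^sup>2 * (1 + \<xi>\<^sup>2))}"

definition fs_inner :: "(real \<Rightarrow> complex) \<Rightarrow> (real \<Rightarrow> complex) \<Rightarrow> complex" where
  "fs_inner f g =
     (LINT x|lborel. f x * cnj (g x) * of_real (1 + x\<^sup>2)) +
     (LINT \<xi>|lborel. fourier f \<xi> * cnj (fourier g \<xi>) * of_real (1 + \<xi>\<^sup>2))"

definition fs_kernel :: "real \<Rightarrow> real \<Rightarrow> complex" where
  "fs_kernel t = (THE k. k \<in> fourier_sobolev \<and> (\<forall>f\<in>fourier_sobolev. f t = fs_inner f k))"

definition fs_localization ::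
    "real set \<Rightarrow> real set \<Rightarrow> (real \<Rightarrow> complex) \<Rightarrow> real \<Rightarrow> complex" where
  "fs_localization I J f t =
     (LINT x:I|lborel. f x * cnj (fs_kernel t x) * of_real (1 + x\<^sup>2)) +
     (LINT x:J|lborel. fourier f x * cnj (fourier (fs_kernel t) x) * of_real (1 + x\<^sup>2))"

global_interpretation cfun: vector_space "\<lambda>(c::complex) (f::real \<Rightarrow> complex) x. c * f x"
  by unfold_locales (auto simp: fun_eq_iff algebra_simps)

definition fs_eigenspace ::
    "((real \<Rightarrow> complex) \<Rightarrow> real \<Rightarrow> complex) \<Rightarrow> complex \<Rightarrow> (real \<Rightarrow> complex) set" where
  "fs_eigenspace T \<mu> = {f \<in> fourier_sobolev. T f = (\<lambda>t. \<mu> * f t)}"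

definition fs_eigenvalues :: "((real \<Rightarrow> complex) \<Rightarrow> real \<Rightarrow> complex) \<Rightarrow> complex set" where
  "fs_eigenvalues T = {\<mu>. \<exists>f\<in>fs_eigenspace T \<mu>. f \<noteq> (\<lambda>t. 0)}"

text \<open>The library dimension of an infinite-dimensional space may be \<open>0\<close>. The multiplicity
  below is therefore meaningful only for eigenvalues with a finite-dimensional eigenspace.\<close>

definition fs_multiplicity :: "((real \<Rightarrow> complex) \<Rightarrow> real \<Rightarrow> complex) \<Rightarrow> complex \<Rightarrow> nat" where
  "fs_multiplicity T \<mu> = cfun.dim (fs_eigenspace T \<mu>)"

definition fs_finite_multiplicity ::
    "((real \<Rightarrow> complex) \<Rightarrow> real \<Rightarrow> complex) \<Rightarrow> complex \<Rightarrow> bool" where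
  "fs_finite_multiplicity T \<mu> \<longleftrightarrow> (\<exists>B. finite B \<and> fs_eigenspace T \<mu> = cfun.span B)"

end

theory Submission
  imports Defs
    "HOL-Probability.Sinc_Integral"
    "HOL-Complex_Analysis.Great_Picard"
    "HOL-Real_Asymp.Real_Asymp"
begin

text \<open>The operator \<open>T\<close> is positive and compact, and its quadratic form \<open>E\<close> is the part of
  the squared norm that lives on \<open>I\<close> and \<open>J\<close>. For an orthonormal family of eigenvectors \<open>e\<close>, evaluating
  \<open>E (K\<^sub>t) = E (K\<^sub>t - proj K\<^sub>t) + \<Sum>\<^sub>e \<lambda>\<^sub>e \<bar>e(t)\<bar>\<^sup>2\<close> and its Fourier counterpart, and integrating over \<open>I\<close>
  and \<open>J\<close>, shows that the sum of the squared eigenvalues is the trace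
  \<open>\<integral>\<^sub>I E (K\<^sub>t) (1 + t^2) dt + \<integral>\<^sub>J E (L\<^sub>\<xi>) (1 + \<xi>^2) d\<xi>\<close>, where \<open>L\<^sub>\<xi>\<close> represents evaluation of the Fourier
  transform at \<open>\<xi>\<close>. The squared norm is the form of \<open>2 + x^2 - (2 pi)\<^sup>-^2 d^2/dx^2\<close>, so \<open>K\<^sub>t\<close> is its Green function.
  Freezing \<open>x^2\<close> at \<open>t^2\<close> turns \<open>K\<^sub>t\<close> into \<open>pi/w exp (- 2 pi w \<bar>x - t\<bar>)\<close> with \<open>w^2 = 2 + t^2\<close>, whose Fourier
  transform is \<open>exp (- 2 pi i t \<xi>) / (w^2 + \<xi>^2)\<close>; this changes \<open>E (K\<^sub>t) (1 + t^2)\<close> by a bounded amount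
  only. The remaining integrals are explicit up to \<open>O(R\<^sub>1 + R\<^sub>2)\<close>, and the trace has order
  \<open>R\<^sub>1^2 + R\<^sub>2^2\<close>.\<close>

text \<open>The kernel is never computed, and no complete eigenbasis is constructed. For each
  \<open>\<epsilon> > 0\<close> a maximal finite orthonormal family of eigenvectors with eigenvalues
  at least \<open>\<epsilon>\<close> suffices: on its orthogonal complement the form is at most
  \<open>\<epsilon>\<close> times the squared norm, and kernel vectors have squared norm at most
  \<open>pi\<close>, so the remainder in the trace identity is \<open>\<epsilon>\<close> times a
  constant of the windows. Squares of eigenvalues arise because integrating the squared modulus of
  an eigenvector over \<open>I\<close> and of its transform over \<open>J\<close> reassembles
  \<open>E e\<close>, a second copy of the eigenvalue. As \<open>R1\<close> and \<open>R2\<close>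
  grow independently, the pointwise estimates have to be uniform in both. The lower bound for the
  mass of a peak inside its window fails near the endpoints; it is asked only at distance at least 1
  from them, and the two boundary strips of unit width cost no more than the integrated pointwise
  errors. The main term is at least \<open>R1^2 + R2^2\<close> whatever the ratio of the radii, so
  the relative error is of order \<open>1 / R1 + 1 / R2\<close>.\<close>

section \<open>The Fourier transform of integrable functions\<close>

lemma borel_measurable_cis [measurable]: "cis \<in> borel_measurable borel"
  by (intro borel_measurable_continuous_onI continuous_intros)

lemma isCont_cis: "isCont cis x"
  using continuous_on_cis[OF continuous_on_id, of UNIV] by (simp add: continuous_on_eq_continuous_at)

lemma exp_minus_2pi_i: "exp (- 2 * of_real pi * \<i> * of_real t * of_real x) = cis (- 2 * pi * t * x)"
  by (simp add: cis_conv_exp mult_ac)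

lemma fourier_eq_cis: "fourier f t = (LINT x|lborel. f x * cis (- 2 * pi * t * x))"
  unfolding fourier_def exp_minus_2pi_i ..

lemma integrable_mult_cis:
  fixes f :: "real \<Rightarrow> complex"
  assumes "integrable lborel f"
  shows "integrable lborel (\<lambda>x. f x * cis (a * x))"
  by (rule Bochner_Integration.integrable_bound[OF assms]) (use assms in \<open>auto simp: norm_mult\<close>)

lemma continuous_on_fourier:
  assumes f: "integrable lborel f"
  shows "continuous_on UNIV (fourier f)"
proof -
  have "isCont (fourier f) t" for t
    unfolding continuous_at_sequentially
  proof safe
    fix s :: "nat \<Rightarrow> real" assume s: "s \<longlonglongrightarrow> t"
    show "(fourier f \<circ> s) \<longlonglongrightarrow> fourier f t"
      unfolding comp_def fourier_eq_cis
    proof (rule integral_dominated_convergence[where w = "\<lambda>x. norm (f x)"])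
      show "AE x in lborel. (\<lambda>n. f x * cis (- 2 * pi * s n * x)) \<longlonglongrightarrow> f x * cis (- 2 * pi * t * x)"
      proof (rule AE_I2)
        fix x
        have "(\<lambda>n. - 2 * pi * s n * x) \<longlonglongrightarrow> - 2 * pi * t * x"
          by (intro tendsto_intros s)
        then have "(\<lambda>n. cis (- 2 * pi * s n * x)) \<longlonglongrightarrow> cis (- 2 * pi * t * x)"
          by (rule isCont_tendsto_compose[OF isCont_cis])
        then show "(\<lambda>n. f x * cis (- 2 * pi * s n * x)) \<longlonglongrightarrow> f x * cis (- 2 * pi * t * x)"
          by (rule tendsto_mult[OF tendsto_const])
      qed
    qed (use f in \<open>auto simp: norm_mult\<close>)
  qed
  then show ?thesis by (simp add: continuous_at_imp_continuous_on)
qed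

lemma norm_fourier_le:
  "cmod (fourier f t) \<le> (LINT x|lborel. cmod (f x))"
  unfolding fourier_eq_cis
  by (rule order_trans[OF integral_norm_bound]) (simp add: norm_mult)

lemma fourier_multiplication_formula:
  assumes f: "integrable lborel f" and g: "integrable lborel g"
  shows "(LINT x|lborel. fourier f x * g x) = (LINT x|lborel. f x * fourier g x)"
proof -
  interpret pair_sigma_finite "lborel :: real measure" "lborel :: real measure" ..
  let ?h = "\<lambda>(x, y). f y * cis (- 2 * pi * x * y) * g x"
  have [measurable]: "f \<in> borel_measurable borel" "g \<in> borel_measurable borel"
    using f g by auto
  have h: "integrable (lborel \<Otimes>\<^sub>M lborel) ?h"
  proof (rule lborel_pair.Fubini_integrable)
    show "?h \<in> borel_measurable (lborel \<Otimes>\<^sub>M lborel)"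
      by measurable
    show "integrable lborel (\<lambda>x. LINT y|lborel. norm (?h (x, y)))"
      using g by (simp add: norm_mult)
    show "AE x in lborel. integrable lborel (\<lambda>y. ?h (x, y))"
      using integrable_mult_left[OF integrable_mult_cis[OF f, of "- 2 * pi * x" for x]]
      by (intro AE_I2) auto
  qed
  have "(LINT x|lborel. fourier f x * g x) = (LINT x|lborel. LINT y|lborel. ?h (x, y))"
    unfolding fourier_eq_cis integral_mult_left_zero[symmetric] by simp
  also have "\<dots> = (LINT y|lborel. LINT x|lborel. ?h (x, y))"
    using lborel_pair.Fubini_integral[of "\<lambda>x y. ?h (x, y)"] h by (simp add: case_prod_unfold)
  also have "\<dots> = (LINT y|lborel. f y * fourier g y)"
    unfolding fourier_eq_cis
    by (intro Bochner_Integration.integral_cong) (simp_all add: mult_ac flip: integral_mult_right_zero)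
  finally show ?thesis .
qed

text \<open>The fundamental theorem of calculus for complex integrands asks for integrability
  beforehand. It is taken from the real exponential with rate \<open>Re z\<close>, which is the
  modulus of the integrand and is covered by the nonnegative version.\<close>

lemma exp_minus_half_line:
  fixes z :: complex
  assumes z: "Re z > 0"
  shows "set_integrable lborel {0<..} (\<lambda>x. exp (- z * of_real x))"
    and "(LINT x:{0<..}|lborel. exp (- z * of_real x)) = 1 / z"
proof -
  have tend: "((\<lambda>x. exp (- c * x)) \<longlongrightarrow> 0) at_top" if "c > 0" for c :: real
    using that by real_asymp
  define c where "c = Re z"
  have c: "c > 0" using z by (simp add: c_def)
  have ein: "einterval 0 \<infinity> = {0<..}"
    by (auto simp: einterval_def zero_ereal_def)
  have real_int: "set_integrable lborel (einterval 0 \<infinity>) (\<lambda>x. exp (- c * x))"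
  proof (rule interval_integral_FTC_nonneg(1)[where F = "\<lambda>x. - exp (- c * x) / c" and A = "-1/c" and B = 0])
    show "(((\<lambda>x. - exp (- c * x) / c) \<circ> real_of_ereal) \<longlongrightarrow> - 1 / c) (at_right 0)"
      unfolding zero_ereal_def ereal_tendsto_simps using c by (auto intro!: tendsto_eq_intros)
    show "(((\<lambda>x. - exp (- c * x) / c) \<circ> real_of_ereal) \<longlongrightarrow> 0) (at_left \<infinity>)"
      unfolding ereal_tendsto_simps using tendsto_divide[OF tendsto_minus[OF tend[OF c]] tendsto_const[of c]] c by simp
  qed (use c in \<open>auto intro!: derivative_eq_intros\<close>)
  show int: "set_integrable lborel {0<..} (\<lambda>x. exp (- z * of_real x))"
    by (rule set_integrable_bound[OF real_int[unfolded ein]])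
      (auto simp: set_borel_measurable_def c_def)
  have "(LBINT x=0..\<infinity>. exp (- z * of_real x)) = 0 - (- 1 / z)"
  proof (rule interval_integral_FTC_integrable[where F = "\<lambda>x. - exp (- z * of_real x) / z"])
    show "((\<lambda>x. - exp (- z * of_real x) / z) has_vector_derivative exp (- z * of_real x)) (at x)" for x
    proof -
      have "((\<lambda>x. - exp (- z * x) / z) has_field_derivative exp (- z * of_real x)) (at (of_real x))"
        using z by (auto intro!: derivative_eq_intros)
      then show ?thesis
        by (rule has_vector_derivative_real_field)
    qed
    show "set_integrable lborel (einterval 0 \<infinity>) (\<lambda>x. exp (- z * of_real x))"
      unfolding ein by (rule int)
    show "(((\<lambda>x. - exp (- z * of_real x) / z) \<circ> real_of_ereal) \<longlongrightarrow> - 1 / z) (at_right 0)"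
      unfolding zero_ereal_def ereal_tendsto_simps using z by (auto intro!: tendsto_eq_intros)
    have "((\<lambda>x. - exp (- z * of_real x) / z) \<longlongrightarrow> 0) at_top"
    proof (rule tendsto_norm_zero_cancel)
      have "((\<lambda>x. exp (- c * x) / norm z) \<longlongrightarrow> 0 / norm z) at_top"
        using z by (intro tendsto_intros tend c) auto
      then show "((\<lambda>x. norm (- exp (- z * of_real x) / z)) \<longlongrightarrow> 0) at_top"
        by (simp add: norm_divide c_def)
    qed
    then show "(((\<lambda>x. - exp (- z * of_real x) / z) \<circ> real_of_ereal) \<longlongrightarrow> 0) (at_left \<infinity>)"
      unfolding ereal_tendsto_simps .
  qed (auto intro!: continuous_intros)
  then show "(LINT x:{0<..}|lborel. exp (- z * of_real x)) = 1 / z"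
    by (simp add: interval_lebesgue_integral_def ein)
qed

text \<open>For \<open>z = Complex c (- a)\<close> the two half lines contribute
  \<open>1 / z\<close> and \<open>1 / cnj z\<close>; together they miss only the origin, a null
  set.\<close>

lemma has_bochner_integral_exp_abs_cis:
  assumes c: "c > 0"
  shows "has_bochner_integral lborel (\<lambda>x. of_real (exp (- c * \<bar>x\<bar>)) * cis (a * x))
           (of_real (2 * c / (c^2 + a^2)))"
proof -
  let ?f = "\<lambda>x. of_real (exp (- c * \<bar>x\<bar>)) * cis (a * x) :: complex"
  let ?g = "\<lambda>z x. indicator {0<..} x *\<^sub>R exp (- z * complex_of_real x)"
  have g: "has_bochner_integral lborel (?g z) (1 / z)" if "Re z > 0" for z
    using exp_minus_half_line[OF that]
    unfolding set_integrable_def set_lebesgue_integral_def has_bochner_integral_iff by simp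
  let ?z = "Complex c (- a)"
  have "has_bochner_integral lborel (\<lambda>x. ?g (cnj ?z) (0 + (- 1) * x)) (1 / cnj ?z)"
    using lborel_has_bochner_integral_real_affine_iff[of "- 1" "?g (cnj ?z)" "1 / cnj ?z" 0] g[of "cnj ?z"] c
    by simp
  then have sum: "has_bochner_integral lborel (\<lambda>x. ?g ?z x + ?g (cnj ?z) (- x)) (1 / ?z + 1 / cnj ?z)"
    using g[of ?z] c by (intro has_bochner_integral_add) (simp_all del: complex_cnj)
  have eq: "?g ?z x + ?g (cnj ?z) (- x) = ?f x" if "x \<noteq> 0" for x
    using that
    by (cases "x > 0")
      (auto simp: cis_conv_exp exp_of_real[symmetric] mult_exp_exp complex_eq_iff Re_exp Im_exp
        simp del: exp_of_real)
  have val: "1 / ?z + 1 / cnj ?z = of_real (2 * c / (c^2 + a^2))"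
    using c by (auto simp: complex_eq_iff Re_divide Im_divide power2_eq_square)
  have "AE x in lborel. x \<noteq> (0::real)" by (rule AE_lborel_singleton)
  then have "AE x in lborel. ?g ?z x + ?g (cnj ?z) (- x) = ?f x"
    by eventually_elim (rule eq)
  then show ?thesis
    using sum unfolding val
    by (subst has_bochner_integral_cong_AE[symmetric]) auto
qed

section \<open>The Poisson kernel and Fourier inversion\<close>

lemma integrable_inverse_one_plus_square: "integrable lborel (\<lambda>x::real. 1 / (1 + x^2))"
  and integral_inverse_one_plus_square: "(LINT x|lborel. 1 / (1 + x^2)) = pi"
proof -
  have "einterval (- \<infinity>) \<infinity> = UNIV" by (auto simp: einterval_def)
  then show "integrable lborel (\<lambda>x::real. 1 / (1 + x^2))" "(LINT x|lborel. 1 / (1 + x^2)) = pi"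
    using integrable_inverse_1_plus_square LBINT_inverse_1_plus_square
    by (simp_all add: set_integrable_def interval_lebesgue_integral_def set_lebesgue_integral_def inverse_eq_divide)
qed

lemma fourier_exp_abs:
  assumes c: "c > 0"
  shows "integrable lborel (\<lambda>x. of_real (exp (- c * \<bar>x\<bar>)) * cis (a * x))"
    and "fourier (\<lambda>x. of_real (exp (- c * \<bar>x\<bar>)) * cis (a * x)) t
           = of_real (2 * c / (c^2 + (a - 2 * pi * t)^2))"
proof -
  show "integrable lborel (\<lambda>x. of_real (exp (- c * \<bar>x\<bar>)) * cis (a * x))"
    using has_bochner_integral_exp_abs_cis[OF c] by (rule integrable.intros)
  have "cis (a * x) * cis (- 2 * pi * t * x) = cis ((a - 2 * pi * t) * x)" for x
    by (simp add: cis_mult algebra_simps)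
  then show "fourier (\<lambda>x. of_real (exp (- c * \<bar>x\<bar>)) * cis (a * x)) t
           = of_real (2 * c / (c^2 + (a - 2 * pi * t)^2))"
    unfolding fourier_eq_cis mult.assoc
    using has_bochner_integral_integral_eq[OF has_bochner_integral_exp_abs_cis[OF c, of "a - 2 * pi * t"]]
    by (simp add: mult.assoc)
qed

text \<open>By \<open>fourier_exp_abs\<close> the integrand is the Fourier transform of
  \<open>exp (- c * \<bar>x\<bar>)\<close> modulated by \<open>cis (2 * pi * t * x)\<close>, so it
  is the averaging kernel that this damping factor produces. An affine substitution reduces it to
  \<open>1 / (1 + x^2)\<close>.\<close>

lemma has_bochner_integral_poisson_kernel:
  assumes c: "c > 0"
  shows "has_bochner_integral lborel (\<lambda>y. 2 * c / (c^2 + (2 * pi * t - 2 * pi * y)^2)) 1"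
proof -
  have "has_bochner_integral lborel (\<lambda>x::real. 1 / (1 + x^2)) pi"
    using integrable_inverse_one_plus_square integral_inverse_one_plus_square
    by (simp add: has_bochner_integral_iff)
  then have "has_bochner_integral lborel (\<lambda>y. 1 / (1 + (- 2 * pi * t / c + 2 * pi / c * y)^2)) (pi /\<^sub>R \<bar>2 * pi / c\<bar>)"
    using c by (subst (asm) lborel_has_bochner_integral_real_affine_iff[where c = "2 * pi / c" and t = "- 2 * pi * t / c"])
      auto
  then have "has_bochner_integral lborel (\<lambda>y. 2 / c * (1 / (1 + (- 2 * pi * t / c + 2 * pi / c * y)^2)))
      (2 / c * (pi /\<^sub>R \<bar>2 * pi / c\<bar>))"
    by (intro has_bochner_integral_mult_right) auto
  moreover have "2 / c * (1 / (1 + (- 2 * pi * t / c + 2 * pi / c * y)^2))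
      = 2 * c / (c^2 + (2 * pi * t - 2 * pi * y)^2)" for y
  proof -
    have "c^2 + (2 * pi * t - 2 * pi * y)^2 = c^2 * (1 + (- 2 * pi * t / c + 2 * pi / c * y)^2)"
      using c by (simp add: field_simps power2_eq_square)
    then show ?thesis using c by (simp add: power2_eq_square)
  qed
  moreover have "2 / c * (pi /\<^sub>R \<bar>2 * pi / c\<bar>) = 1"
    using c by (simp add: field_simps)
  ultimately show ?thesis by simp
qed

text \<open>Near \<open>t\<close>, continuity of \<open>f\<close> is tested against a kernel of
  total mass one. Away from \<open>t\<close> the kernel is at most \<open>c\<close> times a fixed
  function that is bounded, which serves against \<open>f\<close>, and integrable, which serves
  against the constant \<open>f t\<close>.\<close>

lemma poisson_kernel_approximate_identity:
  fixes f :: "real \<Rightarrow> complex"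
  assumes f: "integrable lborel f" and cont: "isCont f t"
  shows "((\<lambda>c. LINT y|lborel. f y * of_real (2 * c / (c^2 + (2 * pi * t - 2 * pi * y)^2))) \<longlongrightarrow> f t) (at_right 0)"
proof (rule tendstoI)
  fix e :: real assume e: "e > 0"
  define P where "P = (\<lambda>c y. 2 * c / (c^2 + (2 * pi * t - 2 * pi * y)^2))"
  define N where "N = (LINT y|lborel. cmod (f y))"
  have f_meas [measurable]: "f \<in> borel_measurable borel" using f by auto
  obtain \<delta> where \<delta>: "\<delta> > 0" "\<And>y. \<bar>y - t\<bar> < \<delta> \<Longrightarrow> cmod (f y - f t) < e / 2"
    using cont e unfolding continuous_at_eps_delta dist_norm by (metis half_gt_zero real_norm_def)
  \<comment> \<open>With \<open>s = (y - t)^2\<close> at least \<open>\<delta>^2\<close>, the kernel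
    is at most \<open>c / (2 * pi^2 * s)\<close>, and \<open>1 / s\<close> is at most
    \<open>(1 + \<delta>^2) / \<delta>^2 / (1 + s)\<close>. \<open>M\<close> collects these
    constants; \<open>1 / (1 + s)\<close>, unlike \<open>1 / s\<close>, is integrable over the whole
    line.\<close>
  define M where "M = 1 / (2 * pi^2 * \<delta>^2) * (1 + \<delta>^2)"
  have M: "M > 0" using \<delta> by (simp add: M_def add_pos_pos)
  define C where "C = M * N + cmod (f t) * M * pi"
  have N0: "N \<ge> 0" by (simp add: N_def)
  have C0: "C \<ge> 0" using M N0 by (simp add: C_def)
  have bound: "norm ((LINT y|lborel. f y * of_real (P c y)) - f t) \<le> e / 2 + c * C" if c: "c > 0" for c
  proof -
    have P: "has_bochner_integral lborel (P c) 1"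
      using has_bochner_integral_poisson_kernel[OF c, of t] by (simp add: P_def)
    have P0: "P c y \<ge> 0" for y using c by (simp add: P_def)
    have Pfar: "P c y \<le> c * M / (1 + (y - t)^2)" if "\<bar>y - t\<bar> \<ge> \<delta>" for y
    proof -
      define s where "s = (y - t)^2"
      have s: "s \<ge> \<delta>^2" unfolding s_def using that \<delta> by (metis abs_le_square_iff abs_of_pos)
      have s0: "s > 0" using s \<delta> by (smt (verit) zero_less_power)
      have "P c y = 2 * c / (c^2 + 4 * pi^2 * s)"
        by (simp add: P_def s_def power2_eq_square algebra_simps)
      also have "\<dots> \<le> 2 * c / (4 * pi^2 * s)"
        using c s0 by (intro divide_left_mono) (auto intro!: mult_pos_pos add_nonneg_pos)
      also have "\<dots> = c / (2 * pi^2) * (1 / s)" by simp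
      also have "\<dots> \<le> c / (2 * pi^2) * ((1 + \<delta>^2) / \<delta>^2 / (1 + s))"
      proof (intro mult_left_mono)
        show "1 / s \<le> (1 + \<delta>^2) / \<delta>^2 / (1 + s)"
        unfolding divide_divide_eq_left
        using s s0 \<delta> by (intro mult_imp_le_div_pos) (auto simp: pos_divide_le_eq algebra_simps intro!: add_pos_pos mult_pos_pos)
      qed (use c in auto)
      also have "c / (2 * pi^2) * ((1 + \<delta>^2) / \<delta>^2 / (1 + s)) = c * M / (1 + s)"
        by (simp add: M_def)
      finally show ?thesis by (simp add: s_def)
    qed
    have far: "c * M / (1 + (y - t)^2) \<le> c * M" for y
      using divide_left_mono[of 1 "1 + (y - t)^2" "c * M"] c M by (simp add: add_pos_nonneg)
    have Pbd: "P c y \<le> 2 / c" for y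
    proof -
      have "P c y \<le> 2 * c / c^2" unfolding P_def using c by (intro divide_left_mono) (auto intro!: mult_pos_pos add_pos_nonneg)
      then show ?thesis using c by (simp add: power2_eq_square split: if_splits)
    qed
    have Pm [measurable]: "P c \<in> borel_measurable borel" unfolding P_def by measurable
    have fP: "integrable lborel (\<lambda>y. f y * of_real (P c y))"
    proof (rule Bochner_Integration.integrable_bound)
      show "integrable lborel (\<lambda>y. f y * of_real (2 / c))" by (intro integrable_mult_left f)
      show "AE y in lborel. norm (f y * of_real (P c y)) \<le> norm (f y * of_real (2 / c))"
        using P0 c mult_left_mono[OF Pbd norm_ge_zero] by (auto simp: norm_mult norm_divide intro!: AE_I2)
    qed simp
    have "has_bochner_integral lborel (\<lambda>y. f t * of_real (P c y)) (f t * of_real 1)"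
      unfolding P_def
      by (intro has_bochner_integral_mult_right has_bochner_integral_of_real has_bochner_integral_poisson_kernel c)
    then have tP: "has_bochner_integral lborel (\<lambda>y. f t * of_real (P c y)) (f t)"
      by simp
    have inv: "has_bochner_integral lborel (\<lambda>y. 1 / (1 + (y - t)^2)) pi"
      using lborel_has_bochner_integral_real_affine_iff[of 1 "\<lambda>x::real. 1 / (1 + x^2)" pi "- t"]
        integrable_inverse_one_plus_square integral_inverse_one_plus_square
      by (simp add: has_bochner_integral_iff)
    have fN: "has_bochner_integral lborel (\<lambda>y. cmod (f y)) N"
      using f by (simp add: has_bochner_integral_iff N_def)
    have total: "has_bochner_integral lborel
        (\<lambda>y. e / 2 * P c y + (c * M * cmod (f y) + cmod (f t) * (c * M) * (1 / (1 + (y - t)^2))))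
        (e / 2 * 1 + (c * M * N + cmod (f t) * (c * M) * pi))"
      by (intro has_bochner_integral_add has_bochner_integral_mult_right P inv fN)
    have "(LINT y|lborel. f y * of_real (P c y)) - f t = (LINT y|lborel. f y * of_real (P c y) - f t * of_real (P c y))"
      using fP tP by (simp add: has_bochner_integral_iff)
    also have "norm \<dots> \<le> (LINT y|lborel. norm (f y * of_real (P c y) - f t * of_real (P c y)))"
      by (rule integral_norm_bound)
    also have "\<dots> \<le> (LINT y|lborel. e / 2 * P c y + (c * M * cmod (f y) + cmod (f t) * (c * M) * (1 / (1 + (y - t)^2))))"
    proof (rule integral_mono)
      show "integrable lborel (\<lambda>y. norm (f y * of_real (P c y) - f t * of_real (P c y)))"
        using fP tP by (auto simp: has_bochner_integral_iff)
      show "integrable lborel (\<lambda>y. e / 2 * P c y + (c * M * cmod (f y) + cmod (f t) * (c * M) * (1 / (1 + (y - t)^2))))"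
        using total by (rule integrable.intros)
      fix y
      have eq: "norm (f y * of_real (P c y) - f t * of_real (P c y)) = cmod (f y - f t) * P c y"
        using P0 by (simp flip: left_diff_distrib add: norm_mult)
      show "norm (f y * of_real (P c y) - f t * of_real (P c y))
          \<le> e / 2 * P c y + (c * M * cmod (f y) + cmod (f t) * (c * M) * (1 / (1 + (y - t)^2)))"
      proof (cases "\<bar>y - t\<bar> < \<delta>")
        case True
        have "cmod (f y - f t) * P c y \<le> e / 2 * P c y"
          using \<delta>(2)[OF True] P0 by (intro mult_right_mono) auto
        moreover have "0 \<le> c * M * cmod (f y) + cmod (f t) * (c * M) * (1 / (1 + (y - t)^2))"
          using c M by (intro add_nonneg_nonneg mult_nonneg_nonneg) auto
        ultimately show ?thesis unfolding eq by linarith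
      next
        case False
        then have Pf: "P c y \<le> c * M / (1 + (y - t)^2)" by (intro Pfar) auto
        have "cmod (f y - f t) * P c y \<le> (cmod (f y) + cmod (f t)) * P c y"
          using P0 by (intro mult_right_mono norm_triangle_ineq4)
        also have "\<dots> = cmod (f y) * P c y + cmod (f t) * P c y" by (rule distrib_right)
        also have "\<dots> \<le> cmod (f y) * (c * M) + cmod (f t) * (c * M / (1 + (y - t)^2))"
          using Pf far[of y] by (intro add_mono mult_left_mono) auto
        finally have "cmod (f y - f t) * P c y \<le> c * M * cmod (f y) + cmod (f t) * (c * M) * (1 / (1 + (y - t)^2))"
          by (simp add: mult_ac)
        moreover have "0 \<le> e / 2 * P c y" using e P0 by simp
        ultimately show ?thesis unfolding eq by linarith
      qed
    qed
    also have "\<dots> = e / 2 * 1 + (c * M * N + cmod (f t) * (c * M) * pi)"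
      using total by (rule has_bochner_integral_integral_eq)
    also have "\<dots> = e / 2 + c * C" by (simp add: C_def algebra_simps)
    finally show ?thesis .
  qed
  have "eventually (\<lambda>c. c \<in> {0<..<e / (2 * (C + 1))}) (at_right 0)"
    using e C0 by (intro eventually_at_right_real) auto
  then show "\<forall>\<^sub>F c in at_right 0. dist (LINT y|lborel. f y * of_real (2 * c / (c^2 + (2 * pi * t - 2 * pi * y)^2))) (f t) < e"
  proof eventually_elim
    case (elim c)
    then have "c * (2 * (C + 1)) < e" "c > 0" using C0 by (simp_all add: pos_less_divide_eq)
    then have "c * C < e / 2" by (simp add: algebra_simps)
    with bound[OF \<open>c > 0\<close>] show ?case unfolding P_def dist_norm by linarith
  qed
qed

text \<open>Abel summation. With the damping factor \<open>exp (- c * \<bar>\<xi>\<bar>)\<close> the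
  multiplication formula applies and turns the inverse transform into a Poisson average of
  \<open>f\<close>. As \<open>c\<close> tends to 0, the average tends to \<open>f t\<close> and the
  damping disappears by dominated convergence.\<close>

theorem fourier_inversion:
  assumes f: "integrable lborel f" and ff: "integrable lborel (fourier f)" and cont: "isCont f t"
  shows "(LINT \<xi>|lborel. fourier f \<xi> * cis (2 * pi * t * \<xi>)) = f t"
proof -
  define c where "c = (\<lambda>n. inverse (real (Suc n)))"
  have c0: "c n > 0" for n by (simp add: c_def)
  have c_lim: "c \<longlonglongrightarrow> 0" unfolding c_def by (rule LIMSEQ_inverse_real_of_nat)
  have "filterlim c (at_right 0) sequentially"
    using c_lim c0 by (auto simp: filterlim_at less_imp_neq[symmetric])
  then have lim1: "(\<lambda>n. LINT y|lborel. f y * of_real (2 * c n / ((c n)^2 + (2 * pi * t - 2 * pi * y)^2))) \<longlonglongrightarrow> f t"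
    by (rule filterlim_compose[OF poisson_kernel_approximate_identity[OF f cont]])
  have eq: "(LINT y|lborel. f y * of_real (2 * c n / ((c n)^2 + (2 * pi * t - 2 * pi * y)^2)))
     = (LINT \<xi>|lborel. fourier f \<xi> * (of_real (exp (- c n * \<bar>\<xi>\<bar>)) * cis (2 * pi * t * \<xi>)))" for n
    using fourier_multiplication_formula[OF f fourier_exp_abs(1)[OF c0[of n], of "2 * pi * t"]]
      fourier_exp_abs(2)[OF c0[of n], of "2 * pi * t"]
    by simp
  have "(\<lambda>n. LINT \<xi>|lborel. fourier f \<xi> * (of_real (exp (- c n * \<bar>\<xi>\<bar>)) * cis (2 * pi * t * \<xi>)))
      \<longlonglongrightarrow> (LINT \<xi>|lborel. fourier f \<xi> * cis (2 * pi * t * \<xi>))"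
  proof (rule integral_dominated_convergence[where w = "\<lambda>\<xi>. norm (fourier f \<xi>)"])
    show "AE \<xi> in lborel. (\<lambda>n. fourier f \<xi> * (of_real (exp (- c n * \<bar>\<xi>\<bar>)) * cis (2 * pi * t * \<xi>)))
        \<longlonglongrightarrow> fourier f \<xi> * cis (2 * pi * t * \<xi>)"
    proof (rule AE_I2)
      fix \<xi>
      have "(\<lambda>n. fourier f \<xi> * (of_real (exp (- c n * \<bar>\<xi>\<bar>)) * cis (2 * pi * t * \<xi>)))
        \<longlonglongrightarrow> fourier f \<xi> * (of_real (exp (- 0 * \<bar>\<xi>\<bar>)) * cis (2 * pi * t * \<xi>))"
        by (intro tendsto_intros c_lim)
      then show "(\<lambda>n. fourier f \<xi> * (of_real (exp (- c n * \<bar>\<xi>\<bar>)) * cis (2 * pi * t * \<xi>)))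
        \<longlonglongrightarrow> fourier f \<xi> * cis (2 * pi * t * \<xi>)"
        by simp
    qed
    show "AE x in lborel. norm (fourier f x * (of_real (exp (- c n * \<bar>x\<bar>)) * cis (2 * pi * t * x)))
        \<le> norm (fourier f x)" for n
      using c0[of n] by (auto intro!: AE_I2 mult_left_le simp: norm_mult)
  qed (use ff in auto)
  with lim1 show ?thesis unfolding eq by (rule LIMSEQ_unique[rotated])
qed

lemma fourier_fourier:
  assumes "integrable lborel f" "integrable lborel (fourier f)" "isCont f t"
  shows "fourier (fourier f) (- t) = f t"
  using fourier_inversion[OF assms] by (simp add: fourier_eq_cis[of "fourier f"])

lemma fourier_cnj: "fourier (\<lambda>x. cnj (f x)) t = cnj (fourier f (- t))"
  unfolding fourier_eq_cis
  by (subst Bochner_Integration.integral_cnj[symmetric]) (simp add: cis_cnj)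

text \<open>This is the multiplication formula with second function
  \<open>cnj (fourier g \<xi>)\<close>, whose transform is \<open>cnj (g x)\<close> by inversion.
  Only \<open>g\<close> is inverted, hence the asymmetric hypotheses.\<close>

theorem fourier_parseval:
  assumes f: "integrable lborel f" and g: "integrable lborel g" "integrable lborel (fourier g)"
    and cont: "continuous_on UNIV g"
  shows "(LINT x|lborel. f x * cnj (g x)) = (LINT \<xi>|lborel. fourier f \<xi> * cnj (fourier g \<xi>))"
proof -
  have "fourier (\<lambda>\<xi>. cnj (fourier g \<xi>)) x = cnj (g x)" for x
    using fourier_fourier[OF g, of x] cont
    by (simp add: fourier_cnj continuous_on_eq_continuous_at)
  with fourier_multiplication_formula[OF f complex_integrable_cnj[THEN iffD2, OF g(2)]]
  show ?thesis by simp
qed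

section \<open>Weighted square integrability\<close>

text \<open>All Cauchy-Schwarz inequalities below, for integrals and for semidefinite forms, are
  read off from a quadratic in \<open>s\<close> that stays nonnegative; so is the stationarity of a
  minimiser in \<open>riesz_representation\<close>.\<close>

lemma discriminant_le:
  fixes A B C :: real
  assumes "\<And>s. 0 \<le> A - 2 * s * B + s^2 * C" and C: "C \<ge> 0"
  shows "B^2 \<le> A * C"
proof (cases "C = 0")
  case True
  have "B = 0"
  proof (rule ccontr)
    assume "B \<noteq> 0"
    \<comment> \<open>At this \<open>s\<close> the expression is \<open>A - (A + 1)\<close>, which
      is negative.\<close>
    then show False using assms(1)[of "(A + 1) / (2 * B)"] True by simp
  qed
  then show ?thesis using True by simp
next
  case False
  then have "C > 0" using C by simp
  then show ?thesis
    using assms(1)[of "B / C"] by (simp add: field_simps power2_eq_square)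
qed

lemma integral_cauchy_schwarz:
  fixes a b :: "'a \<Rightarrow> real"
  assumes [measurable]: "a \<in> borel_measurable M" "b \<in> borel_measurable M"
    and a: "integrable M (\<lambda>x. (a x)^2)" and b: "integrable M (\<lambda>x. (b x)^2)"
  shows "integrable M (\<lambda>x. a x * b x)"
    and "(LINT x|M. \<bar>a x * b x\<bar>)^2 \<le> (LINT x|M. (a x)^2) * (LINT x|M. (b x)^2)"
proof -
  have le: "\<bar>a x * b x\<bar> \<le> (a x)^2 + (b x)^2" for x
  proof -
    have "2 * \<bar>a x * b x\<bar> \<le> (a x)^2 + (b x)^2"
      using sum_squares_bound[of "\<bar>a x\<bar>" "\<bar>b x\<bar>"] by (simp add: abs_mult mult.assoc)
    then show ?thesis by linarith
  qed
  show ab: "integrable M (\<lambda>x. a x * b x)"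
    by (rule Bochner_Integration.integrable_bound[OF Bochner_Integration.integrable_add[OF a b]])
      (use le in \<open>auto intro!: AE_I2\<close>)
  show "(LINT x|M. \<bar>a x * b x\<bar>)^2 \<le> (LINT x|M. (a x)^2) * (LINT x|M. (b x)^2)"
  proof (rule discriminant_le)
    fix s :: real
    have "(LINT x|M. (a x)^2) - 2 * s * (LINT x|M. \<bar>a x * b x\<bar>) + s^2 * (LINT x|M. (b x)^2)
        = (LINT x|M. (a x)^2 - 2 * s * \<bar>a x * b x\<bar> + s^2 * (b x)^2)"
      using a b ab by simp
    also have "\<dots> = (LINT x|M. (\<bar>a x\<bar> - s * \<bar>b x\<bar>)^2)"
      by (intro Bochner_Integration.integral_cong) (auto simp: power2_diff power_mult_distrib abs_mult)
    finally show "0 \<le> (LINT x|M. (a x)^2) - 2 * s * (LINT x|M. \<bar>a x * b x\<bar>) + s^2 * (LINT x|M. (b x)^2)"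
      by simp
  qed simp
qed

text \<open>Serves the completeness proof: bounds on weighted norms survive pointwise
  limits.\<close>

lemma integrable_fatou:
  fixes g :: "nat \<Rightarrow> 'a \<Rightarrow> real"
  assumes g: "\<And>n. integrable M (g n)" "\<And>n x. g n x \<ge> 0" "\<And>n. (LINT x|M. g n x) \<le> B"
    and lim: "\<And>x. (\<lambda>n. g n x) \<longlonglongrightarrow> h x"
  shows "integrable M h" and "(LINT x|M. h x) \<le> B"
proof -
  have [measurable]: "g n \<in> borel_measurable M" for n using g(1) by auto
  have [measurable]: "h \<in> borel_measurable M"
    by (rule borel_measurable_LIMSEQ_real[OF lim]) auto
  have h0: "h x \<ge> 0" for x
    by (rule LIMSEQ_le_const[OF lim]) (use g(2) in auto)
  have B0: "B \<ge> 0" by (rule order_trans[OF Bochner_Integration.integral_nonneg g(3)[of 0]]) (rule g(2))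
  have "(\<integral>\<^sup>+x. ennreal (h x) \<partial>M) = (\<integral>\<^sup>+x. liminf (\<lambda>n. ennreal (g n x)) \<partial>M)"
  proof (intro nn_integral_cong)
    fix x
    have "(\<lambda>n. ennreal (g n x)) \<longlonglongrightarrow> ennreal (h x)" by (intro tendsto_ennrealI lim)
    then show "ennreal (h x) = liminf (\<lambda>n. ennreal (g n x))"
      by (simp add: lim_imp_Liminf)
  qed
  also have "\<dots> \<le> liminf (\<lambda>n. \<integral>\<^sup>+x. ennreal (g n x) \<partial>M)"
    by (rule nn_integral_liminf) auto
  also have "\<dots> \<le> liminf (\<lambda>n::nat. ennreal B)"
    using g by (intro Liminf_mono always_eventually allI) (simp add: nn_integral_eq_integral ennreal_leI)
  also have "\<dots> = ennreal B" by (simp add: Liminf_const)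
  finally have le: "(\<integral>\<^sup>+x. ennreal (h x) \<partial>M) \<le> ennreal B" .
  show "integrable M h"
    using le h0 by (intro integrableI_nonneg) (auto intro: le_less_trans)
  then show "(LINT x|M. h x) \<le> B"
    using le h0 B0 by (simp add: nn_integral_eq_integral ennreal_le_iff)
qed

text \<open>Cauchy-Schwarz against \<open>1 / sqrt (1 + x^2)\<close>, whose square has integral
  \<open>pi\<close>. This is the origin of the factor \<open>pi\<close> in every bound for point
  evaluations.\<close>

lemma weighted_square_integrable:
  fixes f :: "real \<Rightarrow> complex"
  assumes [measurable]: "f \<in> borel_measurable borel"
    and f: "integrable lborel (\<lambda>x. (cmod (f x))^2 * (1 + x^2))"
  shows "integrable lborel f"
    and "(LINT x|lborel. cmod (f x))^2 \<le> pi * (LINT x|lborel. (cmod (f x))^2 * (1 + x^2))"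
    and "integrable lborel (\<lambda>x. (cmod (f x))^2)"
proof -
  define a where "a = (\<lambda>x. cmod (f x) * sqrt (1 + x^2))"
  define b where "b = (\<lambda>x. 1 / sqrt (1 + x^2 :: real))"
  have [measurable]: "a \<in> borel_measurable lborel" "b \<in> borel_measurable lborel"
    by (simp_all add: a_def b_def)
  have pos: "1 + x^2 > (0::real)" for x by (simp add: add_pos_nonneg)
  have a2: "(a x)^2 = (cmod (f x))^2 * (1 + x^2)" and b2: "(b x)^2 = 1 / (1 + x^2)"
    and ab: "a x * b x = cmod (f x)" for x
    using pos[of x] by (simp_all add: a_def b_def power_mult_distrib power_divide)
  note cs = integral_cauchy_schwarz[of a lborel b, unfolded a2 b2 ab, simplified, OF f integrable_inverse_one_plus_square]
  show "integrable lborel f" using cs(1) by (simp add: integrable_norm_iff)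
  show "(LINT x|lborel. cmod (f x))^2 \<le> pi * (LINT x|lborel. (cmod (f x))^2 * (1 + x^2))"
    using cs(2) by (simp add: integral_inverse_one_plus_square mult.commute)
  show "integrable lborel (\<lambda>x. (cmod (f x))^2)"
    by (rule Bochner_Integration.integrable_bound[OF f])
      (auto intro!: AE_I2 simp: abs_mult mult_le_cancel_left1 power2_eq_square)
qed

lemma fourier_sobolevD:
  assumes "f \<in> fourier_sobolev"
  shows "continuous_on UNIV f" "f \<in> borel_measurable borel"
    "integrable lborel (\<lambda>x. (cmod (f x))^2 * (1 + x^2))"
    "integrable lborel (\<lambda>\<xi>. (cmod (fourier f \<xi>))^2 * (1 + \<xi>^2))"
    "integrable lborel f" "integrable lborel (fourier f)"
    "continuous_on UNIV (fourier f)" "fourier f \<in> borel_measurable borel"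
    "integrable lborel (\<lambda>x. (cmod (f x))^2)"
proof -
  show c: "continuous_on UNIV f" and w: "integrable lborel (\<lambda>x. (cmod (f x))^2 * (1 + x^2))"
    and w': "integrable lborel (\<lambda>\<xi>. (cmod (fourier f \<xi>))^2 * (1 + \<xi>^2))"
    using assms by (auto simp: fourier_sobolev_def)
  show m: "f \<in> borel_measurable borel" using c by (rule borel_measurable_continuous_onI)
  show i: "integrable lborel f" "integrable lborel (\<lambda>x. (cmod (f x))^2)"
    using weighted_square_integrable[OF m w] by auto
  show c': "continuous_on UNIV (fourier f)" using i(1) by (rule continuous_on_fourier)
  show m': "fourier f \<in> borel_measurable borel" using c' by (rule borel_measurable_continuous_onI)
  show "integrable lborel (fourier f)"
    using weighted_square_integrable[OF m' w'] by auto
qed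

section \<open>Linear structure, Fourier invariance and point evaluations of the space\<close>

lemma fourier_add:
  assumes "integrable lborel f" "integrable lborel g"
  shows "fourier (\<lambda>x. f x + g x) t = fourier f t + fourier g t"
  unfolding fourier_eq_cis using assms[THEN integrable_mult_cis, of "- 2 * pi * t"]
  by (simp add: distrib_right)

lemma fourier_cmult: "fourier (\<lambda>x. c * f x) t = c * fourier f t"
  unfolding fourier_eq_cis by (simp add: mult.assoc)

lemma weighted_square_integrable_add:
  fixes f g :: "real \<Rightarrow> complex"
  assumes [measurable]: "f \<in> borel_measurable borel" "g \<in> borel_measurable borel"
    and f: "integrable lborel (\<lambda>x. (cmod (f x))^2 * (1 + x^2))"
    and g: "integrable lborel (\<lambda>x. (cmod (g x))^2 * (1 + x^2))"
  shows "integrable lborel (\<lambda>x. (cmod (f x + g x))^2 * (1 + x^2))"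
proof (rule Bochner_Integration.integrable_bound)
  show "integrable lborel (\<lambda>x. 2 * ((cmod (f x))^2 * (1 + x^2)) + 2 * ((cmod (g x))^2 * (1 + x^2)))"
    using f g by auto
  have "(cmod (f x + g x))^2 \<le> 2 * (cmod (f x))^2 + 2 * (cmod (g x))^2" for x
  proof -
    have "(cmod (f x + g x))^2 \<le> (cmod (f x) + cmod (g x))^2"
      by (intro power_mono norm_triangle_ineq) auto
    also have "\<dots> \<le> 2 * (cmod (f x))^2 + 2 * (cmod (g x))^2"
      using sum_squares_bound[of "cmod (f x)" "cmod (g x)"] by (simp add: power2_sum)
    finally show ?thesis .
  qed
  then have "(cmod (f x + g x))^2 * (1 + x^2) \<le> (2 * (cmod (f x))^2 + 2 * (cmod (g x))^2) * (1 + x^2)" for x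
    by (intro mult_right_mono) auto
  then show "AE x in lborel. norm ((cmod (f x + g x))^2 * (1 + x^2))
      \<le> norm (2 * ((cmod (f x))^2 * (1 + x^2)) + 2 * ((cmod (g x))^2 * (1 + x^2)))"
    by (auto intro!: AE_I2 simp: abs_mult algebra_simps)
qed simp

lemma fourier_sobolev_add:
  assumes f: "f \<in> fourier_sobolev" and g: "g \<in> fourier_sobolev"
  shows "(\<lambda>x. f x + g x) \<in> fourier_sobolev"
proof -
  note D = fourier_sobolevD[OF f] fourier_sobolevD[OF g]
  show ?thesis
    unfolding fourier_sobolev_def mem_Collect_eq fourier_add[OF D(5) D(14)]
    using D by (intro conjI continuous_on_add weighted_square_integrable_add) auto
qed

lemma fourier_sobolev_cmult:
  assumes f: "f \<in> fourier_sobolev"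
  shows "(\<lambda>x. c * f x) \<in> fourier_sobolev"
  using fourier_sobolevD[OF f]
  by (auto simp: fourier_sobolev_def fourier_cmult norm_mult power_mult_distrib mult.assoc
    intro!: continuous_intros)

lemma fourier_sobolev_zero: "(\<lambda>x. 0) \<in> fourier_sobolev"
  by (simp add: fourier_sobolev_def fourier_def)

lemma fourier_sobolev_fourier_fourier:
  assumes f: "f \<in> fourier_sobolev"
  shows "fourier (fourier f) = (\<lambda>x. f (- x))"
  using fourier_fourier[of f "- x" for x] fourier_sobolevD[OF f]
  by (auto simp: continuous_on_eq_continuous_at fun_eq_iff)

text \<open>Transforming twice is reflection, and the weight is even, so the two conditions on
  \<open>f\<close> merely change places.\<close>

lemma fourier_sobolev_fourier:
  assumes f: "f \<in> fourier_sobolev"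
  shows "fourier f \<in> fourier_sobolev"
proof -
  note D = fourier_sobolevD[OF f]
  have "integrable lborel (\<lambda>x. (cmod (f (0 + (- 1) * x)))^2 * (1 + (0 + (- 1) * x)^2))"
    by (rule lborel_integrable_real_affine[OF D(3)]) auto
  then show ?thesis
    using D by (simp add: fourier_sobolev_def fourier_sobolev_fourier_fourier[OF f])
qed

text \<open>By inversion the supremum of \<open>f\<close> is at most the integral of the modulus of
  its transform, which the weighted norm controls.\<close>

lemma norm_fourier_sobolev_le:
  assumes f: "f \<in> fourier_sobolev"
  shows "(cmod (f t))^2 \<le> pi * (LINT \<xi>|lborel. (cmod (fourier f \<xi>))^2 * (1 + \<xi>^2))"
proof -
  note D = fourier_sobolevD[OF f]
  have "cmod (f t) \<le> (LINT \<xi>|lborel. cmod (fourier f \<xi>))"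
    using norm_fourier_le[of "fourier f" "- t"] by (simp add: fourier_sobolev_fourier_fourier[OF f])
  then have "(cmod (f t))^2 \<le> (LINT \<xi>|lborel. cmod (fourier f \<xi>))^2"
    by (intro power_mono) auto
  also note weighted_square_integrable(2)[OF D(8) D(4)]
  finally show ?thesis .
qed

lemma norm_cis_diff_square: "(cmod (cis a - cis b))^2 = 2 - 2 * cos (a - b)"
proof -
  have "(cmod (cis a - cis b))^2 = (cos a - cos b)^2 + (sin a - sin b)^2"
    by (simp add: cmod_power2)
  also have "\<dots> = ((cos a)^2 + (sin a)^2) + ((cos b)^2 + (sin b)^2) - 2 * (cos a * cos b + sin a * sin b)"
    by (simp add: power2_eq_square algebra_simps)
  finally show ?thesis by (simp add: cos_diff)
qed

text \<open>One modulus of continuity serves the whole unit ball. Inversion and Cauchy-Schwarz leave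
  the integral of \<open>(cmod (cis (2 * pi * x * \<xi>) - cis (2 * pi * y * \<xi>)))^2 / (1 +
  \<xi>^2)\<close>, a function \<open>m\<close> of \<open>x - y\<close> alone. It equals
  \<open>2 * pi\<close> minus twice the real part of the transform of an integrable function, hence
  is continuous.\<close>

lemma fourier_sobolev_equicontinuous:
  obtains m :: "real \<Rightarrow> real" where "isCont m 0" "m 0 = 0"
    "\<And>f x y. f \<in> fourier_sobolev \<Longrightarrow>
      (cmod (f x - f y))^2 \<le> m (x - y) * (LINT \<xi>|lborel. (cmod (fourier f \<xi>))^2 * (1 + \<xi>^2))"
proof -
  let ?w = "\<lambda>x::real. complex_of_real (1 / (1 + x^2))"
  have w: "integrable lborel ?w"
    using integrable_inverse_one_plus_square by (rule integrable_of_real)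
  define m where "m = (\<lambda>h. LINT \<xi>|lborel. (2 - 2 * cos (2 * pi * h * \<xi>)) / (1 + \<xi>^2))"
  have cos_int: "integrable lborel (\<lambda>\<xi>. cos (2 * pi * h * \<xi>) * (1 / (1 + \<xi>^2)))" for h
    by (rule Bochner_Integration.integrable_bound[OF integrable_inverse_one_plus_square])
      (auto simp: abs_mult divide_right_mono intro!: AE_I2)
  have m_int: "integrable lborel (\<lambda>\<xi>. (2 - 2 * cos (2 * pi * h * \<xi>)) / (1 + \<xi>^2))" for h
  proof -
    have "(2 - 2 * cos (2 * pi * h * \<xi>)) / (1 + \<xi>^2)
        = 2 * (1 / (1 + \<xi>^2)) - 2 * (cos (2 * pi * h * \<xi>) * (1 / (1 + \<xi>^2)))" for \<xi> :: real
      by (simp add: diff_divide_distrib)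
    then show ?thesis
      using integrable_inverse_one_plus_square cos_int[of h]
      by (simp only: Bochner_Integration.integrable_diff integrable_mult_right)
  qed
  have "m h = 2 * pi - 2 * Re (fourier ?w h)" for h
  proof -
    have "Re (fourier ?w h) = (LINT \<xi>|lborel. Re (?w \<xi> * cis (- 2 * pi * h * \<xi>)))"
      unfolding fourier_eq_cis by (rule integral_Re[OF integrable_mult_cis[OF w], symmetric])
    also have "\<dots> = (LINT \<xi>|lborel. cos (2 * pi * h * \<xi>) * (1 / (1 + \<xi>^2)))"
      by (intro Bochner_Integration.integral_cong) (simp_all only: times_complex.sel Re_complex_of_real Im_complex_of_real cis.sel, simp)
    finally have R: "Re (fourier ?w h) = (LINT \<xi>|lborel. cos (2 * pi * h * \<xi>) * (1 / (1 + \<xi>^2)))"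
      .
    have "m h = (LINT \<xi>|lborel. 2 * (1 / (1 + \<xi>^2)) - 2 * (cos (2 * pi * h * \<xi>) * (1 / (1 + \<xi>^2))))"
      by (simp add: m_def diff_divide_distrib)
    also have "\<dots> = 2 * pi - 2 * Re (fourier ?w h)"
      unfolding R using integrable_inverse_one_plus_square cos_int[of h]
      by (simp add: integral_inverse_one_plus_square del: times_divide_eq_right)
    finally show ?thesis .
  qed
  moreover have "isCont (\<lambda>h. 2 * pi - 2 * Re (fourier ?w h)) 0"
    using continuous_on_fourier[OF w] by (intro continuous_intros) (simp add: continuous_on_eq_continuous_at)
  ultimately have cont: "isCont m 0" by presburger
  have le: "(cmod (f x - f y))^2 \<le> m (x - y) * (LINT \<xi>|lborel. (cmod (fourier f \<xi>))^2 * (1 + \<xi>^2))"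
    if f: "f \<in> fourier_sobolev" for f x y
  proof -
    note D = fourier_sobolevD[OF f]
    define a where "a = (\<lambda>\<xi>. cmod (fourier f \<xi>) * sqrt (1 + \<xi>^2))"
    define b where "b = (\<lambda>\<xi>. cmod (cis (2 * pi * x * \<xi>) - cis (2 * pi * y * \<xi>)) / sqrt (1 + \<xi>^2))"
    have [measurable]: "a \<in> borel_measurable lborel" "b \<in> borel_measurable lborel"
      using D(8) by (simp_all add: a_def b_def)
    have pos: "1 + \<xi>^2 > (0::real)" for \<xi> by (simp add: add_pos_nonneg)
    have a2: "(a \<xi>)^2 = (cmod (fourier f \<xi>))^2 * (1 + \<xi>^2)" for \<xi>
      using pos[of \<xi>] by (simp add: a_def power_mult_distrib)
    have b2: "(b \<xi>)^2 = (2 - 2 * cos (2 * pi * (x - y) * \<xi>)) / (1 + \<xi>^2)" for \<xi>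
      using pos[of \<xi>] by (simp add: b_def power_divide norm_cis_diff_square algebra_simps)
    have ab: "a \<xi> * b \<xi> = cmod (fourier f \<xi> * cis (2 * pi * x * \<xi>) - fourier f \<xi> * cis (2 * pi * y * \<xi>))" for \<xi>
      using pos[of \<xi>] by (simp add: a_def b_def flip: right_diff_distrib add: norm_mult)
    have fx: "f z = (LINT \<xi>|lborel. fourier f \<xi> * cis (2 * pi * z * \<xi>))" for z
      using fourier_inversion[OF D(5,6)] D(1) by (simp add: continuous_on_eq_continuous_at)
    have "f x - f y = (LINT \<xi>|lborel. fourier f \<xi> * cis (2 * pi * x * \<xi>) - fourier f \<xi> * cis (2 * pi * y * \<xi>))"
      unfolding fx[of x] fx[of y]
      using integrable_mult_cis[OF D(6)] by (simp add: Bochner_Integration.integral_diff)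
    also have "cmod \<dots> \<le> (LINT \<xi>|lborel. a \<xi> * b \<xi>)"
      unfolding ab by (rule integral_norm_bound)
    finally have "(cmod (f x - f y))^2 \<le> (LINT \<xi>|lborel. a \<xi> * b \<xi>)^2"
      by (intro power_mono) auto
    also have "\<dots> = (LINT \<xi>|lborel. \<bar>a \<xi> * b \<xi>\<bar>)^2"
      unfolding ab by simp
    also have "\<dots> \<le> (LINT x|lborel. (a x)^2) * (LINT x|lborel. (b x)^2)"
      by (rule integral_cauchy_schwarz(2)) (use D(4) m_int[of "x - y"] in \<open>auto simp: a2 b2\<close>)
    finally show ?thesis unfolding a2 b2 m_def by (simp add: mult.commute)
  qed
  have "m 0 = 0" by (simp add: m_def)
  from that[OF cont this le] show thesis .
qed

section \<open>Two facts on real Hilbert spaces\<close>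

text \<open>Variational proof: the representer minimises \<open>(norm h)^2 / 2 - \<phi> h\<close>.
  The parallelogram law makes minimising sequences Cauchy, and stationarity at the minimum is the
  representation formula.\<close>

lemma riesz_representation:
  fixes \<phi> :: "'a::{real_inner, complete_space} \<Rightarrow> real"
  assumes "bounded_linear \<phi>"
  obtains h where "\<And>g. inner h g = \<phi> g"
proof -
  interpret bounded_linear \<phi> by fact
  obtain K where K: "\<And>x. norm (\<phi> x) \<le> norm x * K" using bounded by blast
  define J where "J = (\<lambda>h. (norm h)^2 / 2 - \<phi> h)"
  have lower: "J h \<ge> - (K^2) / 2" for h
    using K[of h] zero_le_power2[of "norm h - K"] by (simp add: J_def power2_diff field_simps abs_le_iff)
  define m where "m = (INF h. J h)"
  have bdd: "bdd_below (range J)" using lower by (intro bdd_belowI2) auto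
  have m_le: "m \<le> J h" for h unfolding m_def by (rule cINF_lower[OF bdd]) simp
  have "\<exists>h. J h < m + inverse (real (Suc n))" for n
    using cINF_less_iff[OF _ bdd, of "m + inverse (real (Suc n))"] by (simp add: m_def)
  then obtain X where X: "\<And>n. J (X n) < m + inverse (real (Suc n))" by metis
  \<comment> \<open>The parallelogram law for the functional; the linear part cancels because it is
    affine along the segment from \<open>a\<close> to \<open>b\<close>.\<close>
  have par: "(norm (a - b))^2 \<le> 4 * (J a - m) + 4 * (J b - m)" for a b
  proof -
    have "(norm (a - b))^2 = 4 * J a + 4 * J b - 8 * J ((1/2) *\<^sub>R (a + b))"
      by (simp add: J_def add scaleR power2_norm_eq_inner inner_add_left inner_add_right
          inner_diff_left inner_diff_right inner_commute[of b a] field_simps)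
    with m_le[of "(1/2) *\<^sub>R (a + b)"] show ?thesis by simp
  qed
  have "Cauchy X"
  proof (rule metric_CauchyI)
    fix e :: real assume e: "e > 0"
    obtain N where N: "inverse (real (Suc N)) < e^2 / 8"
      using reals_Archimedean[of "e^2 / 8"] e by auto
    have "dist (X i) (X j) < e" if "i \<ge> N" "j \<ge> N" for i j
    proof -
      have *: "J (X k) - m < e^2 / 8" if "k \<ge> N" for k
      proof -
        have "inverse (real (Suc k)) \<le> inverse (real (Suc N))" using that by (intro le_imp_inverse_le) auto
        with X[of k] N show ?thesis by linarith
      qed
      have "4 * (J (X i) - m) + 4 * (J (X j) - m) < 4 * (e^2 / 8) + 4 * (e^2 / 8)"
        by (intro add_strict_mono mult_strict_left_mono * that) auto
      with par[of "X i" "X j"] have "(norm (X i - X j))^2 < e^2" by simp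
      then show ?thesis using e by (simp add: dist_norm power2_less_imp_less)
    qed
    then show "\<exists>M. \<forall>i\<ge>M. \<forall>j\<ge>M. dist (X i) (X j) < e" by blast
  qed
  then obtain h where h: "X \<longlonglongrightarrow> h" using Cauchy_convergent convergent_def by blast
  have "(\<lambda>n. J (X n)) \<longlonglongrightarrow> J h"
    unfolding J_def by (intro tendsto_intros tendsto h) auto
  moreover have "(\<lambda>n. m + inverse (real (Suc n))) \<longlonglongrightarrow> m + 0"
    by (intro tendsto_intros LIMSEQ_inverse_real_of_nat)
  ultimately have "J h \<le> m + 0"
    by (rule LIMSEQ_le) (use X less_imp_le in blast)
  then have min: "J h \<le> J g" for g using m_le[of g] by simp
  have "inner h g = \<phi> g" for g
  proof -
    \<comment> \<open>The variation of \<open>J\<close> at \<open>h\<close> in direction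
      \<open>g\<close> has constant term 0, so its linear coefficient must vanish.\<close>
    have "((\<phi> g - inner h g) / 2)^2 \<le> 0 * ((norm g)^2 / 2)"
    proof (rule discriminant_le)
      fix s :: real
      have "J (h + s *\<^sub>R g) - J h = 0 - 2 * s * ((\<phi> g - inner h g) / 2) + s^2 * ((norm g)^2 / 2)"
        by (simp add: J_def add scaleR power2_norm_eq_inner inner_add_left inner_add_right
            inner_commute[of g h] power2_eq_square[of s] field_simps)
      with min[of "h + s *\<^sub>R g"] show "0 \<le> 0 - 2 * s * ((\<phi> g - inner h g) / 2) + s^2 * ((norm g)^2 / 2)"
        by simp
    qed simp
    then show ?thesis by simp
  qed
  then show thesis by (rule that)
qed

text \<open>Unit vectors of \<open>V\<close> on which the form nearly attains its supremum
  \<open>m\<close> are approximate eigenvectors, and compactness turns them into an exact one. The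
  closed invariant subspace allows application to the complement of eigenvectors already found;
  \<open>\<epsilon> > 0\<close> ensures that \<open>m\<close> can be divided by.\<close>

lemma compact_positive_operator_eigenvector:
  fixes T :: "'a::{real_inner, complete_space} \<Rightarrow> 'a"
  assumes T: "bounded_linear T"
    and sym: "\<And>x y. inner (T x) y = inner x (T y)"
    and pos: "\<And>x. inner (T x) x \<ge> 0"
    and compact: "\<And>X :: nat \<Rightarrow> 'a. (\<And>n. norm (X n) \<le> 1) \<Longrightarrow> \<exists>r :: nat \<Rightarrow> nat. strict_mono r \<and> Cauchy (\<lambda>n. T (X (r n)))"
    and V: "subspace V" "closed V" "T ` V \<subseteq> V"
    and x: "x \<in> V" "inner (T x) x > \<epsilon> * (norm x)^2" and \<epsilon>: "\<epsilon> > 0"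
  obtains m v where "m > \<epsilon>" "v \<in> V" "v \<noteq> 0" "T v = m *\<^sub>R v"
proof -
  interpret bounded_linear T by fact
  define B where "B = (\<lambda>x. inner (T x) x)"
  define U where "U = {u \<in> V. norm u = 1}"
  obtain K where K: "\<And>x. norm (T x) \<le> norm x * K" using bounded by blast
  have "B u \<le> K" if "u \<in> U" for u
  proof -
    have "B u \<le> norm (T u) * norm u" unfolding B_def by (rule norm_cauchy_schwarz)
    with K[of u] that show ?thesis by (simp add: U_def)
  qed
  then have bdd: "bdd_above (B ` U)" by (rule bdd_aboveI2)
  define m where "m = (SUP u\<in>U. B u)"
  have hom: "B (c *\<^sub>R y) = c^2 * B y" for c y by (simp add: B_def scaleR power2_eq_square)
  have U_sgn: "sgn y \<in> U" if "y \<in> V" "y \<noteq> 0" for y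
    using that V(1) by (simp add: U_def norm_sgn sgn_div_norm subspace_scale)
  have B_sgn: "B y = (norm y)^2 * B (sgn y)" for y
    using hom[of "norm y" "sgn y"] by (simp add: sgn_div_norm) (cases "y = 0"; simp add: B_def)
  have B_le: "B y \<le> m * (norm y)^2" if "y \<in> V" for y
  proof (cases "y = 0")
    case False
    then have "B (sgn y) \<le> m" unfolding m_def using that by (intro cSUP_upper bdd U_sgn)
    then show ?thesis unfolding B_sgn[of y] by (simp add: mult.commute mult_right_mono)
  qed (simp add: B_def)
  have "x \<noteq> 0" using x(2) by (auto simp: zero)
  have m: "m > \<epsilon>"
  proof -
    have "\<epsilon> * (norm x)^2 < m * (norm x)^2" using x(2) B_le[OF x(1)] by (simp add: B_def)
    then show ?thesis using \<open>x \<noteq> 0\<close> by simp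
  qed
  have U_ne: "U \<noteq> {}" using U_sgn[OF x(1) \<open>x \<noteq> 0\<close>] by blast
  have "\<exists>u\<in>U. B u > m - inverse (real (Suc n))" for n
    using less_cSUP_iff[OF U_ne bdd, of "m - inverse (real (Suc n))"] by (simp add: m_def)
  then obtain X where X: "\<And>n. X n \<in> U" "\<And>n. B (X n) > m - inverse (real (Suc n))" by metis
  \<comment> \<open>Cauchy-Schwarz for the semidefinite form of \<open>T\<close>, applied to
    \<open>y\<close> and \<open>T y\<close>: their mixed value is \<open>(norm (T y))^2\<close>, and
    the form at \<open>T y\<close> is bounded by \<open>m\<close> because \<open>V\<close> is
    invariant.\<close>
  have T_norm: "(norm (T y))^2 \<le> m * B y" if y: "y \<in> V" for y
  proof (cases "T y = 0")
    case False
    have Ty: "T y \<in> V" using y V(3) by blast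
    have "((norm (T y))^2)^2 \<le> B y * B (T y)"
    proof (rule discriminant_le)
      fix s :: real
      have "B (y - s *\<^sub>R T y) = B y - 2 * s * (norm (T y))^2 + s^2 * B (T y)"
        using sym[of "T y" y] 
        by (simp add: B_def diff scaleR inner_diff_left inner_diff_right power2_norm_eq_inner
            power2_eq_square[of s] algebra_simps)
      with pos[of "y - s *\<^sub>R T y"] show "0 \<le> B y - 2 * s * (norm (T y))^2 + s^2 * B (T y)"
        by (simp add: B_def)
    qed (simp add: B_def pos)
    also have "\<dots> \<le> B y * (m * (norm (T y))^2)"
      by (intro mult_left_mono B_le Ty) (simp add: B_def pos)
    finally have "(norm (T y))^2 * (norm (T y))^2 \<le> (m * B y) * (norm (T y))^2"
      by (simp add: power2_eq_square mult_ac)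
    then show ?thesis by (rule mult_right_le_imp_le) (use False in simp)
  qed (use m \<epsilon> pos in \<open>simp add: B_def\<close>)
  have close: "(norm (T (X n) - m *\<^sub>R X n))^2 \<le> m * inverse (real (Suc n))" for n
  proof -
    have XV: "X n \<in> V" "norm (X n) = 1" using X(1) by (auto simp: U_def)
    have "(norm (T (X n) - m *\<^sub>R X n))^2 = (norm (T (X n)))^2 - 2 * m * B (X n) + m^2 * (norm (X n))^2"
      by (simp add: B_def power2_norm_eq_inner inner_diff_left inner_diff_right
          inner_commute[of "X n" "T (X n)"] power2_eq_square[of m] algebra_simps)
    also have "\<dots> \<le> m * (m - B (X n))"
      using T_norm[OF XV(1)] XV(2) by (simp add: power2_eq_square[of m] algebra_simps)
    also have "\<dots> \<le> m * inverse (real (Suc n))"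
      using X(2)[of n] m \<epsilon> by (intro mult_left_mono) auto
    finally show ?thesis .
  qed
  have "(\<lambda>n. (norm (T (X n) - m *\<^sub>R X n))^2) \<longlonglongrightarrow> 0"
  proof (rule tendsto_sandwich[OF _ _ tendsto_const])
    have "(\<lambda>n. m * inverse (real (Suc n))) \<longlonglongrightarrow> m * 0"
      by (intro tendsto_intros LIMSEQ_inverse_real_of_nat)
    then show "(\<lambda>n. m * inverse (real (Suc n))) \<longlonglongrightarrow> 0" by simp
  qed (use close in auto)
  then have "(\<lambda>n. sqrt ((norm (T (X n) - m *\<^sub>R X n))^2)) \<longlonglongrightarrow> sqrt 0"
    by (rule tendsto_real_sqrt)
  then have d: "(\<lambda>n. T (X n) - m *\<^sub>R X n) \<longlonglongrightarrow> 0"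
    by (simp add: tendsto_norm_zero_iff)
  have "norm (X n) \<le> 1" for n using X(1)[of n] by (simp add: U_def)
  from compact[of X, OF this] obtain r where r: "strict_mono r" "Cauchy (\<lambda>n. T (X (r n)))" by blast
  obtain g where g: "(\<lambda>n. T (X (r n))) \<longlonglongrightarrow> g"
    using r(2) Cauchy_convergent convergent_def by blast
  define v where "v = g /\<^sub>R m"
  have "(\<lambda>n. T (X (r n)) - m *\<^sub>R X (r n)) \<longlonglongrightarrow> 0"
    using LIMSEQ_subseq_LIMSEQ[OF d r(1)] by (simp add: o_def)
  \<comment> \<open>Only \<open>T (X (r n))\<close> is known to converge; \<open>X (r n)\<close> is
    recovered from it and the vanishing difference on dividing by \<open>m\<close>.\<close>
  then have "(\<lambda>n. (T (X (r n)) - (T (X (r n)) - m *\<^sub>R X (r n))) /\<^sub>R m) \<longlonglongrightarrow> (g - 0) /\<^sub>R m"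
    by (intro tendsto_intros g)
  then have Xv: "(\<lambda>n. X (r n)) \<longlonglongrightarrow> v" using m \<epsilon> by (simp add: v_def)
  have "v \<in> V" by (rule closed_sequentially[OF V(2) _ Xv]) (use X(1) in \<open>auto simp: U_def\<close>)
  moreover have "v \<noteq> 0"
  proof -
    have "(\<lambda>n. norm (X (r n))) \<longlonglongrightarrow> norm v" by (intro tendsto_intros Xv)
    moreover have "norm (X (r n)) = 1" for n using X(1) by (simp add: U_def)
    ultimately have "norm v = 1" using LIMSEQ_const_iff[of "1::real" "norm v"] by simp
    then show ?thesis by auto
  qed
  moreover have "T v = m *\<^sub>R v"
  proof -
    have "T v = g" by (rule LIMSEQ_unique[OF tendsto[OF Xv] g])
    then show ?thesis using m \<epsilon> by (simp add: v_def)
  qed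
  ultimately show thesis using that m by blast
qed

section \<open>The Fourier symmetric Sobolev space as a Hilbert space\<close>

lemma borel_measurable_cnj [measurable]: "cnj \<in> borel_measurable borel"
  by (intro borel_measurable_continuous_onI continuous_intros)

definition weighted_L2 :: "(real \<Rightarrow> complex) set" where
  "weighted_L2 = {f. f \<in> borel_measurable borel \<and> integrable lborel (\<lambda>x. (cmod (f x))^2 * (1 + x^2))}"

definition weighted_inner :: "real set \<Rightarrow> (real \<Rightarrow> complex) \<Rightarrow> (real \<Rightarrow> complex) \<Rightarrow> complex" where
  "weighted_inner I f g = (LINT x:I|lborel. f x * cnj (g x) * of_real (1 + x^2))"

lemma weighted_L2_fourier_sobolev:
  assumes "f \<in> fourier_sobolev"
  shows "f \<in> weighted_L2" "fourier f \<in> weighted_L2"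
  using fourier_sobolevD[OF assms] by (auto simp: weighted_L2_def)

lemma weighted_inner_integrable:
  assumes f: "f \<in> weighted_L2" and g: "g \<in> weighted_L2" and I: "I \<in> sets borel"
  shows "set_integrable lborel I (\<lambda>x. f x * cnj (g x) * of_real (1 + x^2))"
proof -
  have [measurable]: "f \<in> borel_measurable borel" "g \<in> borel_measurable borel"
    using f g by (auto simp: weighted_L2_def)
  have pos: "1 + x^2 > (0::real)" for x by (simp add: add_pos_nonneg)
  have "integrable lborel (\<lambda>x. (cmod (f x) * sqrt (1 + x^2)) * (cmod (g x) * sqrt (1 + x^2)))"
    by (rule integral_cauchy_schwarz(1)) (use f g in \<open>auto simp: weighted_L2_def power_mult_distrib\<close>)
  then have "integrable lborel (\<lambda>x. f x * cnj (g x) * of_real (1 + x^2))"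
  proof (rule Bochner_Integration.integrable_bound)
    have "norm (f x * cnj (g x) * of_real (1 + x^2))
      = (cmod (f x) * sqrt (1 + x^2)) * (cmod (g x) * sqrt (1 + x^2))" for x
      using pos[of x] by (simp only: norm_mult complex_mod_cnj norm_of_real) simp
    then show "AE x in lborel. norm (f x * cnj (g x) * of_real (1 + x^2))
      \<le> norm ((cmod (f x) * sqrt (1 + x^2)) * (cmod (g x) * sqrt (1 + x^2)))"
      by (intro AE_I2) simp
  qed simp
  then have "set_integrable lborel UNIV (\<lambda>x. f x * cnj (g x) * of_real (1 + x^2))"
    by (simp add: set_integrable_def)
  then show ?thesis by (rule set_integrable_subset) (use I in auto)
qed

lemma weighted_inner_add_left:
  assumes "f \<in> weighted_L2" "g \<in> weighted_L2" "h \<in> weighted_L2" "I \<in> sets borel"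
  shows "weighted_inner I (\<lambda>x. f x + g x) h = weighted_inner I f h + weighted_inner I g h"
  unfolding weighted_inner_def distrib_right
  by (intro set_integral_add weighted_inner_integrable assms)

lemma weighted_inner_cmult_left:
  "weighted_inner I (\<lambda>x. c * f x) g = c * weighted_inner I f g"
  unfolding weighted_inner_def mult.assoc by (rule set_integral_mult_right)

lemma cnj_weighted_inner: "cnj (weighted_inner I f g) = weighted_inner I g f"
  unfolding weighted_inner_def set_lebesgue_integral_def
  by (subst Bochner_Integration.integral_cnj[symmetric], rule Bochner_Integration.integral_cong[OF refl])
    (simp add: mult_ac)

lemma weighted_inner_self:
  "weighted_inner I f f = of_real (LINT x:I|lborel. (cmod (f x))^2 * (1 + x^2))"
  unfolding weighted_inner_def set_lebesgue_integral_def
  by (subst integral_complex_of_real[symmetric], rule Bochner_Integration.integral_cong[OF refl])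
    (simp add: scaleR_conv_of_real flip: complex_norm_square)

text \<open>As a type, the space can instantiate the classes of real Hilbert spaces, to which the
  two preceding theorems apply. The complex structure is carried separately by
  \<open>fs_scale\<close> and \<open>fs_form\<close>.\<close>

typedef fs_space = fourier_sobolev
  morphisms fun_of Abs_fs
  using fourier_sobolev_zero by blast

setup_lifting type_definition_fs_space

lift_definition fs_scale :: "complex \<Rightarrow> fs_space \<Rightarrow> fs_space" is "\<lambda>c f x. c * f x"
  by (rule fourier_sobolev_cmult)

lift_definition fs_fourier :: "fs_space \<Rightarrow> fs_space" is fourier
  by (rule fourier_sobolev_fourier)

text \<open>With \<open>UNIV\<close> for both sets this is the inner product of the space; with the
  windows it is the form of the localization operator (\<open>fs_cinner_op\<close>). Both share one
  algebra of sesquilinear forms.\<close>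

definition fs_form :: "real set \<Rightarrow> real set \<Rightarrow> fs_space \<Rightarrow> fs_space \<Rightarrow> complex" where
  "fs_form I J f g = weighted_inner I (fun_of f) (fun_of g)
     + weighted_inner J (fourier (fun_of f)) (fourier (fun_of g))"

definition fs_energy :: "real set \<Rightarrow> real set \<Rightarrow> fs_space \<Rightarrow> real" where
  "fs_energy I J f = (LINT x:I|lborel. (cmod (fun_of f x))^2 * (1 + x^2))
     + (LINT x:J|lborel. (cmod (fourier (fun_of f) x))^2 * (1 + x^2))"

lemma fs_inner_fun_of: "fs_inner (fun_of f) (fun_of g) = fs_form UNIV UNIV f g"
  by (simp add: fs_inner_def fs_form_def weighted_inner_def set_lebesgue_integral_def)

lemma weighted_L2_fun_of: "fun_of f \<in> weighted_L2" "fourier (fun_of f) \<in> weighted_L2"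
  using weighted_L2_fourier_sobolev[OF fun_of] by auto

lemma fs_form_self: "fs_form I J f f = of_real (fs_energy I J f)"
  by (simp add: fs_form_def fs_energy_def weighted_inner_self)

lemma cnj_fs_form: "cnj (fs_form I J f g) = fs_form I J g f"
  by (simp add: fs_form_def cnj_weighted_inner)

lemma fs_form_scale_left: "fs_form I J (fs_scale c f) g = c * fs_form I J f g"
  by (simp add: fs_form_def fs_scale.rep_eq fourier_cmult[abs_def] weighted_inner_cmult_left distrib_left)

lemma fs_form_scale_right: "fs_form I J f (fs_scale c g) = cnj c * fs_form I J f g"
  by (metis cnj_fs_form complex_cnj_mult fs_form_scale_left)

lemma fs_energy_nonneg: "fs_energy I J f \<ge> 0"
  unfolding fs_energy_def set_lebesgue_integral_def
  by (intro add_nonneg_nonneg Bochner_Integration.integral_nonneg) auto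

lemma weighted_square_set_integrable:
  assumes "f \<in> weighted_L2" "I \<in> sets borel"
  shows "set_integrable lborel I (\<lambda>x. (cmod (f x))^2 * (1 + x^2))"
proof -
  have "set_integrable lborel UNIV (\<lambda>x. (cmod (f x))^2 * (1 + x^2))"
    using assms by (simp add: weighted_L2_def set_integrable_def)
  then show ?thesis by (rule set_integrable_subset) (use assms in auto)
qed

lemma fs_energy_mono:
  assumes "I \<in> sets borel" "J \<in> sets borel"
  shows "fs_energy I J f \<le> fs_energy UNIV UNIV f"
proof -
  have "(LINT x:I|lborel. (cmod (f x))^2 * (1 + x^2)) \<le> (LINT x:UNIV|lborel. (cmod (f x))^2 * (1 + x^2))"
    if f: "f \<in> weighted_L2" and I: "I \<in> sets borel" for f I
    using weighted_square_set_integrable[OF f I] weighted_square_set_integrable[OF f, of UNIV]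
    unfolding set_lebesgue_integral_def set_integrable_def
    by (intro integral_mono) (auto simp: indicator_def)
  then show ?thesis
    unfolding fs_energy_def by (meson add_mono assms weighted_L2_fun_of)
qed

instantiation fs_space :: real_vector
begin

lift_definition zero_fs_space :: fs_space is "\<lambda>x. 0"
  by (rule fourier_sobolev_zero)

lift_definition plus_fs_space :: "fs_space \<Rightarrow> fs_space \<Rightarrow> fs_space" is "\<lambda>f g x. f x + g x"
  by (rule fourier_sobolev_add)

definition "- f = fs_scale (- 1) f"

definition "f - g = f + fs_scale (- 1) g"

definition "r *\<^sub>R f = fs_scale (of_real r) f"

instance
proof
  fix f g h :: fs_space and a b :: real
  note rep_eqs = zero_fs_space.rep_eq plus_fs_space.rep_eq minus_fs_space_def
    uminus_fs_space_def scaleR_fs_space_def fs_scale.rep_eq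
  note eqI = fun_of_inject[THEN iffD1, OF ext]
  show "f + g + h = f + (g + h)" by (intro eqI) (simp add: rep_eqs add.assoc)
  show "f + g = g + f" by (intro eqI) (simp add: rep_eqs add.commute)
  show "0 + f = f" by (intro eqI) (simp add: rep_eqs)
  show "- f + f = 0" by (intro eqI) (simp add: rep_eqs)
  show "f - g = f + - g" by (intro eqI) (simp add: rep_eqs)
  show "a *\<^sub>R (f + g) = a *\<^sub>R f + a *\<^sub>R g" by (intro eqI) (simp add: rep_eqs distrib_left)
  show "(a + b) *\<^sub>R f = a *\<^sub>R f + b *\<^sub>R f" by (intro eqI) (simp add: rep_eqs distrib_right)
  show "a *\<^sub>R b *\<^sub>R f = (a * b) *\<^sub>R f" by (intro eqI) (simp only: rep_eqs of_real_mult mult.assoc)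
  show "1 *\<^sub>R f = f" by (intro eqI) (simp add: rep_eqs)
qed

end

lemma fs_form_add_left:
  assumes "I \<in> sets borel" "J \<in> sets borel"
  shows "fs_form I J (f + g) h = fs_form I J f h + fs_form I J g h"
proof -
  have "fourier (\<lambda>x. fun_of f x + fun_of g x) = (\<lambda>t. fourier (fun_of f) t + fourier (fun_of g) t)"
    using fourier_sobolevD(5)[OF fun_of] by (intro ext fourier_add)
  then show ?thesis
    using assms by (simp add: fs_form_def plus_fs_space.rep_eq weighted_inner_add_left weighted_L2_fun_of)
qed

lemma fs_scale_of_real: "scaleR r f = fs_scale (of_real r) f"
  by (rule scaleR_fs_space_def)

lemma cmod_fun_of_le_energy: "(cmod (fun_of f t))^2 \<le> pi * fs_energy UNIV UNIV f"
proof -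
  have "(cmod (fun_of f t))^2 \<le> pi * (LINT \<xi>|lborel. (cmod (fourier (fun_of f) \<xi>))^2 * (1 + \<xi>^2))"
    by (rule norm_fourier_sobolev_le[OF fun_of])
  also have "\<dots> \<le> pi * fs_energy UNIV UNIV f"
    unfolding fs_energy_def set_lebesgue_integral_def by (intro mult_left_mono) simp_all
  finally show ?thesis .
qed

instantiation fs_space :: real_inner
begin

definition "inner f g = Re (fs_form UNIV UNIV f g)"

definition "norm f = sqrt (inner f (f :: fs_space))"

definition "sgn f = f /\<^sub>R norm (f :: fs_space)"

definition "dist f g = norm (f - g :: fs_space)"

definition "uniformity = (INF e\<in>{0<..}. principal {(x, y :: fs_space). dist x y < e})"

definition "open U = (\<forall>x\<in>U. \<forall>\<^sub>F (x', y) in uniformity. x' = x \<longrightarrow> y \<in> (U :: fs_space set))"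

instance
proof
  fix f g h :: fs_space and a :: real
  show "sgn f = f /\<^sub>R norm f" by (rule sgn_fs_space_def)
  show "dist f g = norm (f - g)" by (rule dist_fs_space_def)
  show "uniformity = (INF e\<in>{0<..}. principal {(x, y :: fs_space). dist x y < e})"
    by (rule uniformity_fs_space_def)
  show "open U = (\<forall>x\<in>U. \<forall>\<^sub>F (x', y) in uniformity. x' = x \<longrightarrow> y \<in> U)" for U :: "fs_space set"
    by (rule open_fs_space_def)
  show "inner f g = inner g f"
    unfolding inner_fs_space_def by (subst cnj_fs_form[symmetric]) simp
  show "inner (f + g) h = inner f h + inner g h"
    by (simp add: inner_fs_space_def fs_form_add_left)
  show "inner (a *\<^sub>R f) g = a * inner f g"
    by (simp add: inner_fs_space_def fs_scale_of_real fs_form_scale_left)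
  have i: "inner f f = fs_energy UNIV UNIV f" by (simp add: inner_fs_space_def fs_form_self)
  show "0 \<le> inner f f" unfolding i by (rule fs_energy_nonneg)
  show "(inner f f = 0) = (f = 0)"
  proof
    assume "inner f f = 0"
    then have "fun_of f t = 0" for t using cmod_fun_of_le_energy[of f t] by (simp add: i)
    then show "f = 0" by (intro fun_of_inject[THEN iffD1]) (simp add: zero_fs_space.rep_eq fun_eq_iff)
  next
    assume "f = 0"
    then show "inner f f = 0"
      unfolding i by (simp add: fs_energy_def zero_fs_space.rep_eq fourier_def set_lebesgue_integral_def)
  qed
  show "norm f = sqrt (inner f f)" by (rule norm_fs_space_def)
qed

end

lemma norm_fs_square: "(norm f)^2 = fs_energy UNIV UNIV f"
  unfolding power2_norm_eq_inner inner_fs_space_def fs_form_self by simp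

lemma fun_of_simps [simp]:
  "fun_of 0 t = 0" "fun_of (f + g) t = fun_of f t + fun_of g t"
  "fun_of (f - g) t = fun_of f t - fun_of g t" "fun_of (- f) t = - fun_of f t"
  "fun_of (r *\<^sub>R f) t = of_real r * fun_of f t" "fun_of (fs_scale c f) t = c * fun_of f t"
  by (simp_all add: zero_fs_space.rep_eq plus_fs_space.rep_eq minus_fs_space_def uminus_fs_space_def
      scaleR_fs_space_def fs_scale.rep_eq)

lemma fs_eqI: "(\<And>t. fun_of f t = fun_of g t) \<Longrightarrow> f = g"
  by (intro fun_of_inject[THEN iffD1] ext)

lemma fourier_fun_of_add: "fourier (fun_of (f + g)) t = fourier (fun_of f) t + fourier (fun_of g) t"
  using fourier_sobolevD(5)[OF fun_of] by (simp add: plus_fs_space.rep_eq fourier_add)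

lemma fs_scale_minus_one: "- f = fs_scale (- 1) f"
  by (rule uminus_fs_space_def)

lemma fourier_fun_of_diff: "fourier (fun_of (f - g)) t = fourier (fun_of f) t - fourier (fun_of g) t"
  unfolding minus_fs_space_def fourier_fun_of_add fs_scale.rep_eq fourier_cmult by simp

lemma cmod_fun_of_le: "(cmod (fun_of f t))^2 \<le> pi * (norm f)^2"
  unfolding norm_fs_square by (rule cmod_fun_of_le_energy)

lemma fs_form_add_right:
  assumes "I \<in> sets borel" "J \<in> sets borel"
  shows "fs_form I J f (g + h) = fs_form I J f g + fs_form I J f h"
  using fs_form_add_left[OF assms, of g h f] by (metis cnj_fs_form complex_cnj_add)

lemma fs_form_minus_left: "fs_form I J (- f) g = - fs_form I J f g"
  by (simp add: fs_scale_minus_one fs_form_scale_left)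

lemma fs_form_minus_right: "fs_form I J f (- g) = - fs_form I J f g"
  by (simp add: fs_scale_minus_one fs_form_scale_right)

lemma fs_form_diff_left:
  assumes "I \<in> sets borel" "J \<in> sets borel"
  shows "fs_form I J (f - g) h = fs_form I J f h - fs_form I J g h"
  using fs_form_add_left[OF assms, of f "- g" h] by (simp add: fs_form_minus_left)

lemma fs_form_diff_right:
  assumes "I \<in> sets borel" "J \<in> sets borel"
  shows "fs_form I J f (g - h) = fs_form I J f g - fs_form I J f h"
  using fs_form_add_right[OF assms, of f g "- h"] by (simp add: fs_form_minus_right)

lemma fs_energy_scale: "fs_energy I J (fs_scale c f) = (cmod c)^2 * fs_energy I J f"
proof -
  have "complex_of_real (fs_energy I J (fs_scale c f)) = (c * cnj c) * of_real (fs_energy I J f)"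
    unfolding fs_form_self[symmetric] by (simp add: fs_form_scale_left fs_form_scale_right mult_ac)
  also have "\<dots> = complex_of_real ((cmod c)^2 * fs_energy I J f)"
    by (simp flip: complex_norm_square)
  finally show ?thesis by (simp only: of_real_eq_iff)
qed

lemma fs_energy_diff:
  assumes "I \<in> sets borel" "J \<in> sets borel"
  shows "fs_energy I J (f - g) = fs_energy I J f - 2 * Re (fs_form I J f g) + fs_energy I J g"
proof -
  have "complex_of_real (fs_energy I J (f - g)) = fs_form I J f f - fs_form I J f g - cnj (fs_form I J f g) + fs_form I J g g"
    unfolding fs_form_self[symmetric] using assms
    by (simp add: fs_form_diff_left fs_form_diff_right cnj_fs_form)
  from arg_cong[OF this, of Re] show ?thesis by (simp add: fs_form_self)
qed

text \<open>The discriminant argument over real \<open>s\<close> bounds only the real part of the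
  form. Scaling \<open>f\<close> by the conjugate of the form's value \<open>c\<close> makes the
  form equal to \<open>(cmod c)^2\<close>, so its real part is everything; one such factor then
  cancels.\<close>

lemma fs_form_cauchy_schwarz:
  assumes [simp]: "I \<in> sets borel" "J \<in> sets borel"
  shows "(cmod (fs_form I J f g))^2 \<le> fs_energy I J f * fs_energy I J g"
proof (cases "fs_form I J f g = 0")
  case True
  then show ?thesis by (simp add: fs_energy_nonneg)
next
  case False
  define c where "c = fs_form I J f g"
  have Re_le: "(Re (fs_form I J h g))^2 \<le> fs_energy I J h * fs_energy I J g" for h
  proof (rule discriminant_le)
    fix s :: real
    have "fs_energy I J (h - fs_scale (of_real s) g)
        = fs_energy I J h - 2 * s * Re (fs_form I J h g) + s^2 * fs_energy I J g"
      by (simp add: fs_energy_diff fs_form_scale_right fs_energy_scale)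
    then show "0 \<le> fs_energy I J h - 2 * s * Re (fs_form I J h g) + s^2 * fs_energy I J g"
      using fs_energy_nonneg by metis
  qed (rule fs_energy_nonneg)
  have "Re (fs_form I J (fs_scale (cnj c) f) g) = (cmod c)^2"
    by (simp add: fs_form_scale_left cmod_power2 flip: c_def) (simp add: power2_eq_square)
  with Re_le[of "fs_scale (cnj c) f"]
  have "(cmod c)^2 * (cmod c)^2 \<le> (fs_energy I J f * fs_energy I J g) * (cmod c)^2"
    by (simp add: fs_energy_scale power2_eq_square mult_ac)
  then have "(cmod c)^2 \<le> fs_energy I J f * fs_energy I J g"
    by (rule mult_right_le_imp_le) (use False in \<open>simp add: c_def\<close>)
  then show ?thesis by (simp add: c_def)
qed

lemma norm_fs_form_le:
  assumes "I \<in> sets borel" "J \<in> sets borel"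
  shows "cmod (fs_form I J f g) \<le> norm f * norm g"
proof (rule power2_le_imp_le)
  have "(cmod (fs_form I J f g))^2 \<le> fs_energy I J f * fs_energy I J g"
    by (rule fs_form_cauchy_schwarz[OF assms])
  also have "\<dots> \<le> (norm f)^2 * (norm g)^2"
    unfolding norm_fs_square by (intro mult_mono fs_energy_mono assms fs_energy_nonneg)
  finally show "(cmod (fs_form I J f g))^2 \<le> (norm f * norm g)^2" by (simp add: power_mult_distrib)
qed simp

text \<open>Bounded point evaluations make a Cauchy sequence converge uniformly, so the limit
  \<open>g\<close> is continuous. Fatou places \<open>g\<close> in the weighted space; then the
  transforms converge pointwise to \<open>fourier g\<close>, and Fatou applies once more on the
  frequency side.\<close>

instance fs_space :: complete_space
proof
  fix X :: "nat \<Rightarrow> fs_space" assume X: "Cauchy X"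
  define f where "f = (\<lambda>n. fun_of (X n))"
  have fs: "f n \<in> fourier_sobolev" for n by (simp add: f_def fun_of)
  note D = fourier_sobolevD[OF fs]
  have f_diff: "fourier (\<lambda>x. f m x - f n x) = (\<lambda>t. fourier (f m) t - fourier (f n) t)" for m n
    using fourier_fun_of_diff[of "X m" "X n"] by (simp add: f_def fun_eq_iff flip: fun_of_simps(3))
  have dist_le: "cmod (f m t - f n t) \<le> sqrt pi * dist (X m) (X n)" for m n t
  proof (rule power2_le_imp_le)
    show "(cmod (f m t - f n t))^2 \<le> (sqrt pi * dist (X m) (X n))^2"
      using cmod_fun_of_le[of "X m - X n" t] by (simp add: f_def dist_norm power_mult_distrib)
  qed simp
  have UC: "uniformly_Cauchy_on UNIV f"
  proof (rule uniformly_Cauchy_onI)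
    fix e :: real assume "e > 0"
    then obtain M where "\<And>m n. m \<ge> M \<Longrightarrow> n \<ge> M \<Longrightarrow> dist (X m) (X n) < e / sqrt pi"
      using X[unfolded Cauchy_def, rule_format, of "e / sqrt pi"] by auto
    then have "dist (f m x) (f n x) < e" if "m \<ge> M" "n \<ge> M" for m n x
      using that dist_le[of m x n] by (fastforce simp: dist_norm pos_less_divide_eq mult.commute)
    then show "\<exists>M. \<forall>x\<in>UNIV. \<forall>m\<ge>M. \<forall>n\<ge>M. dist (f m x) (f n x) < e" by blast
  qed
  then obtain g where g: "uniform_limit UNIV f g sequentially"
    using Cauchy_uniformly_convergent[OF UC] unfolding uniformly_convergent_on_def by blast
  have gc: "continuous_on UNIV g"
    by (rule uniform_limit_theorem[OF _ g]) (use D in auto)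
  have g_lim: "(\<lambda>n. f n t) \<longlonglongrightarrow> g t" for t using tendsto_uniform_limitI[OF g] by simp
  have g_meas [measurable]: "g \<in> borel_measurable borel" using gc by (rule borel_measurable_continuous_onI)
  have [measurable]: "f n \<in> borel_measurable borel" for n by (rule D)
  have energy_lt: "\<exists>M. \<forall>m\<ge>M. \<forall>n\<ge>M. fs_energy UNIV UNIV (X m - X n) \<le> e" if e: "e > 0" for e
  proof -
    obtain M where M: "\<And>m n. m \<ge> M \<Longrightarrow> n \<ge> M \<Longrightarrow> dist (X m) (X n) < sqrt e"
      using X[unfolded Cauchy_def, rule_format, of "sqrt e"] e by auto
    have "fs_energy UNIV UNIV (X m - X n) \<le> e" if "m \<ge> M" "n \<ge> M" for m n
    proof -
      have "(dist (X m) (X n))^2 \<le> (sqrt e)^2" using M[OF that] by (intro power_mono) auto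
      then show ?thesis using \<open>e > 0\<close> by (simp add: dist_norm norm_fs_square)
    qed
    then show ?thesis by blast
  qed
  have energy_split: "(LINT x|lborel. (cmod (f m x - f n x))^2 * (1 + x^2)) \<le> fs_energy UNIV UNIV (X m - X n)"
     "(LINT x|lborel. (cmod (fourier (f m) x - fourier (f n) x))^2 * (1 + x^2)) \<le> fs_energy UNIV UNIV (X m - X n)"
     "integrable lborel (\<lambda>x. (cmod (f m x - f n x))^2 * (1 + x^2))"
     "integrable lborel (\<lambda>x. (cmod (fourier (f m) x - fourier (f n) x))^2 * (1 + x^2))" for m n
    using fourier_sobolevD(3,4)[OF fun_of, of "X m - X n"]
    by (simp_all add: fs_energy_def f_def fourier_fun_of_diff set_lebesgue_integral_def)
  \<comment> \<open>Kept abstract in \<open>u\<close> and \<open>v\<close> because it is applied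
    first to the functions and later to their transforms, whose pointwise limit is available only
    after \<open>g\<close> is known to be integrable.\<close>
  have lim: "integrable lborel (\<lambda>x. (cmod (u m x - v x))^2 * (1 + x^2))
        \<and> (LINT x|lborel. (cmod (u m x - v x))^2 * (1 + x^2)) \<le> e"
    if M: "\<forall>m\<ge>M. \<forall>n\<ge>M. fs_energy UNIV UNIV (X m - X n) \<le> e" and m: "m \<ge> M"
      and int: "\<And>n. integrable lborel (\<lambda>x. (cmod (u m x - u n x))^2 * (1 + x^2))"
      and le: "\<And>n. (LINT x|lborel. (cmod (u m x - u n x))^2 * (1 + x^2)) \<le> fs_energy UNIV UNIV (X m - X n)"
      and uv: "\<And>x. (\<lambda>n. u n x) \<longlonglongrightarrow> v x"
    for M m e u and v :: "real \<Rightarrow> complex"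
  proof -
    have *: "(\<lambda>n. (cmod (u m x - u (n + M) x))^2 * (1 + x^2)) \<longlonglongrightarrow> (cmod (u m x - v x))^2 * (1 + x^2)" for x
      by (intro tendsto_intros LIMSEQ_ignore_initial_segment[of "\<lambda>n. u n x"] uv)
    have **: "(LINT x|lborel. (cmod (u m x - u (n + M) x))^2 * (1 + x^2)) \<le> e" for n
      using le[of "n + M"] M m by (meson le_add2 order_trans)
    show ?thesis
      using integrable_fatou[OF int _ ** *] by auto
  qed
  note lim1 = lim[of _ _ _ f, OF _ _ energy_split(3,1) g_lim]
  obtain M1 where M1: "\<forall>m\<ge>M1. \<forall>n\<ge>M1. fs_energy UNIV UNIV (X m - X n) \<le> 1"
    using energy_lt[of 1] by auto
  have w_diff: "integrable lborel (\<lambda>x. (cmod (g x - f M1 x))^2 * (1 + x^2))"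
    using lim1[OF M1, of M1] by (simp add: norm_minus_commute)
  have gw: "integrable lborel (\<lambda>x. (cmod (g x))^2 * (1 + x^2))"
    using weighted_square_integrable_add[OF _ _ w_diff D(3)[of M1]] by simp
  have gi: "integrable lborel g" using weighted_square_integrable(1)[OF g_meas gw] .
  have fg: "fourier (\<lambda>x. f n x - g x) t = fourier (f n) t - fourier g t" for n t
    using fourier_add[OF D(5)[of n] integrable_mult_right[OF gi, of "- 1"], of t]
      fourier_cmult[of "- 1" g t] by simp
  have ghat: "(\<lambda>n. fourier (f n) t) \<longlonglongrightarrow> fourier g t" for t
  proof (rule LIMSEQ_I)
    fix r :: real assume r: "r > 0"
    obtain M where M: "\<forall>m\<ge>M. \<forall>n\<ge>M. fs_energy UNIV UNIV (X m - X n) \<le> r^2 / (2 * pi)"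
      using energy_lt[of "r^2 / (2 * pi)"] r by auto
    have "norm (fourier (f n) t - fourier g t) < r" if "n \<ge> M" for n
    proof -
      note l = lim1[OF M that]
      have "(cmod (fourier (\<lambda>x. f n x - g x) t))^2 \<le> (LINT x|lborel. cmod (f n x - g x))^2"
        by (intro power_mono norm_fourier_le) auto
      also have "\<dots> \<le> pi * (LINT x|lborel. (cmod (f n x - g x))^2 * (1 + x^2))"
        by (rule weighted_square_integrable(2)) (use l in auto)
      also have "\<dots> \<le> pi * (r^2 / (2 * pi))" using l by (intro mult_left_mono) auto
      also have "\<dots> < r^2" using r by simp
      finally show ?thesis unfolding fg using r by (simp add: power2_less_imp_less)
    qed
    then show "\<exists>no. \<forall>n\<ge>no. norm (fourier (f n) t - fourier g t) < r" by blast
  qed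
  note lim2 = lim[of _ _ _ "\<lambda>n. fourier (f n)", OF _ _ energy_split(4,2) ghat]
  have ghm [measurable]: "fourier g \<in> borel_measurable borel"
    using continuous_on_fourier[OF gi] by (rule borel_measurable_continuous_onI)
  have "integrable lborel (\<lambda>x. (cmod (fourier g x - fourier (f M1) x))^2 * (1 + x^2))"
    using lim2[OF M1, of M1] by (simp add: norm_minus_commute)
  from weighted_square_integrable_add[OF _ _ this D(4)[of M1]] D(8)[of M1]
  have "integrable lborel (\<lambda>x. (cmod (fourier g x))^2 * (1 + x^2))" by simp
  with gc gw have gH: "g \<in> fourier_sobolev" by (simp add: fourier_sobolev_def)
  define G where "G = Abs_fs g"
  have G: "fun_of G = g" using gH by (simp add: G_def Abs_fs_inverse)
  have "X \<longlonglongrightarrow> G"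
  proof (rule LIMSEQ_I)
    fix r :: real assume r: "r > 0"
    obtain M where M: "\<forall>m\<ge>M. \<forall>n\<ge>M. fs_energy UNIV UNIV (X m - X n) \<le> r^2 / 4"
      using energy_lt[of "r^2 / 4"] r by auto
    have "norm (X n - G) < r" if "n \<ge> M" for n
    proof -
      have "(norm (X n - G))^2 = (LINT x|lborel. (cmod (f n x - g x))^2 * (1 + x^2))
          + (LINT x|lborel. (cmod (fourier (f n) x - fourier g x))^2 * (1 + x^2))"
        by (simp add: norm_fs_square fs_energy_def fourier_fun_of_diff G f_def set_lebesgue_integral_def)
      also have "\<dots> \<le> r^2 / 4 + r^2 / 4"
        using lim1[OF M that] lim2[OF M that] by (intro add_mono) auto
      also have "\<dots> < r^2" using r by simp
      finally show ?thesis using r by (simp add: power2_less_imp_less)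
    qed
    then show "\<exists>no. \<forall>n\<ge>no. norm (X n - G) < r" by blast
  qed
  then show "convergent X" by (rule convergentI)
qed

section \<open>Reproducing kernel and localization operator\<close>

abbreviation fs_cinner :: "fs_space \<Rightarrow> fs_space \<Rightarrow> complex" where
  "fs_cinner \<equiv> fs_form UNIV UNIV"

lemma fs_cinner_eqI:
  assumes "\<And>f. fs_cinner f g = fs_cinner f h"
  shows "g = h"
proof -
  have "fs_cinner (g - h) (g - h) = 0" by (simp add: fs_form_diff_right assms)
  then have "(norm (g - h))^2 = 0" by (simp add: fs_form_self norm_fs_square)
  then show ?thesis by simp
qed

text \<open>The real functional \<open>Re (\<phi> f)\<close> has a representer; evaluating at
  \<open>fs_scale (- \<i>) f\<close> shows that it also gives the imaginary part.\<close>

lemma fs_riesz_representation: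
  fixes \<phi> :: "fs_space \<Rightarrow> complex"
  assumes add: "\<And>f g. \<phi> (f + g) = \<phi> f + \<phi> g" and scale: "\<And>c f. \<phi> (fs_scale c f) = c * \<phi> f"
    and bound: "\<And>f. cmod (\<phi> f) \<le> norm f * K"
  obtains h where "\<And>f. fs_cinner f h = \<phi> f"
proof -
  have "bounded_linear (\<lambda>f. Re (\<phi> f))"
    by (rule bounded_linear_intro[where K = K])
      (auto simp: add scale fs_scale_of_real intro: order_trans[OF abs_Re_le_cmod bound])
  then obtain h where h: "\<And>f. inner h f = Re (\<phi> f)" using riesz_representation by blast
  have Re_h: "Re (fs_cinner f h) = Re (\<phi> f)" for f
    using h[of f] by (subst (asm) inner_commute) (simp add: inner_fs_space_def)
  have "fs_cinner f h = \<phi> f" for f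
    using Re_h[of f] Re_h[of "fs_scale (- \<i>) f"] by (simp add: complex_eq_iff fs_form_scale_left scale)
  then show thesis by (rule that)
qed

lemma norm_fun_of_le: "cmod (fun_of f t) \<le> norm f * sqrt pi"
  by (rule power2_le_imp_le) (use cmod_fun_of_le[of f t] in \<open>simp_all add: power_mult_distrib mult.commute\<close>)

definition fs_ker :: "real \<Rightarrow> fs_space" where
  "fs_ker t = (SOME k. \<forall>f. fs_cinner f k = fun_of f t)"

lemma fs_cinner_ker: "fs_cinner f (fs_ker t) = fun_of f t"
proof -
  obtain h where "\<And>f. fs_cinner f h = fun_of f t"
    using fs_riesz_representation[of "\<lambda>f. fun_of f t" "sqrt pi"] norm_fun_of_le by auto
  then have "\<exists>k. \<forall>f. fs_cinner f k = fun_of f t" by blast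
  from someI_ex[OF this] show ?thesis unfolding fs_ker_def by blast
qed

lemma fs_kernel_eq: "fs_kernel t = fun_of (fs_ker t)"
  unfolding fs_kernel_def
proof (rule the_equality)
  show "fun_of (fs_ker t) \<in> fourier_sobolev \<and> (\<forall>f\<in>fourier_sobolev. f t = fs_inner f (fun_of (fs_ker t)))"
  proof (intro conjI ballI)
    fix f assume "f \<in> fourier_sobolev"
    then obtain h where "f = fun_of h" using Abs_fs_inverse by metis
    then show "f t = fs_inner f (fun_of (fs_ker t))" by (simp add: fs_inner_fun_of fs_cinner_ker)
  qed (rule fun_of)
next
  fix k assume k: "k \<in> fourier_sobolev \<and> (\<forall>f\<in>fourier_sobolev. f t = fs_inner f k)"
  then obtain h where h: "k = fun_of h" using Abs_fs_inverse by metis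
  have "fs_cinner f h = fs_cinner f (fs_ker t)" for f
    using k[THEN conjunct2, rule_format, OF fun_of[of f]] by (simp add: h fs_cinner_ker fs_inner_fun_of)
  then show "k = fun_of (fs_ker t)" using fs_cinner_eqI h by metis
qed

text \<open>Introduced as the Riesz representative of the window form rather than by the integral
  formula, so that its values lie in the space by construction. Testing against the kernel recovers
  the integral formula (\<open>fun_of_op\<close>).\<close>

definition fs_op :: "real set \<Rightarrow> real set \<Rightarrow> fs_space \<Rightarrow> fs_space" where
  "fs_op I J f = (SOME h. \<forall>g. fs_cinner h g = fs_form I J f g)"

lemma fs_cinner_op:
  assumes [simp]: "I \<in> sets borel" "J \<in> sets borel"
  shows "fs_cinner (fs_op I J f) g = fs_form I J f g"
proof -
  have "\<exists>h. \<forall>g. fs_cinner g h = fs_form I J g f"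
  proof (rule fs_riesz_representation[of "\<lambda>g. fs_form I J g f" "norm f"])
    fix g h :: fs_space and c :: complex
    show "fs_form I J (g + h) f = fs_form I J g f + fs_form I J h f" by (rule fs_form_add_left) simp_all
    show "fs_form I J (fs_scale c g) f = c * fs_form I J g f" by (rule fs_form_scale_left)
    show "cmod (fs_form I J g f) \<le> norm g * norm f" by (rule norm_fs_form_le) simp_all
    assume "\<And>g. fs_cinner g h = fs_form I J g f"
    then show "\<exists>h. \<forall>g. fs_cinner g h = fs_form I J g f" by blast
  qed
  then obtain h where h: "\<And>g. fs_cinner g h = fs_form I J g f" by blast
  have "fs_cinner h g = fs_form I J f g" for g using arg_cong[OF h[of g], of cnj] by (simp add: cnj_fs_form)
  then have "\<exists>h. \<forall>g. fs_cinner h g = fs_form I J f g" by blast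
  from someI_ex[OF this] show ?thesis unfolding fs_op_def by blast
qed

lemma fun_of_op:
  assumes "I \<in> sets borel" "J \<in> sets borel"
  shows "fun_of (fs_op I J f) = fs_localization I J (fun_of f)"
proof
  fix t
  have "fun_of (fs_op I J f) t = fs_form I J f (fs_ker t)"
    using fs_cinner_ker[of "fs_op I J f" t] by (simp add: fs_cinner_op[OF assms])
  then show "fun_of (fs_op I J f) t = fs_localization I J (fun_of f) t"
    by (simp add: fs_form_def weighted_inner_def fs_localization_def fs_kernel_eq)
qed

lemma fs_op_add:
  assumes [simp]: "I \<in> sets borel" "J \<in> sets borel"
  shows "fs_op I J (f + g) = fs_op I J f + fs_op I J g"
  by (rule fs_cinner_eqI, subst (1 2) cnj_fs_form[symmetric]) (simp add: fs_cinner_op fs_form_add_left)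

lemma fs_op_scale:
  assumes [simp]: "I \<in> sets borel" "J \<in> sets borel"
  shows "fs_op I J (fs_scale c f) = fs_scale c (fs_op I J f)"
  by (rule fs_cinner_eqI, subst (1 2) cnj_fs_form[symmetric]) (simp add: fs_cinner_op fs_form_scale_left)

text \<open>The squared norm of \<open>T f\<close> is the form at \<open>f\<close> and
  \<open>T f\<close>; Cauchy-Schwarz and cancellation leave the local energy. Thus closeness of
  functions and transforms on the windows alone forces closeness of the images, the key to
  compactness.\<close>

lemma norm_fs_op_square_le:
  assumes [simp]: "I \<in> sets borel" "J \<in> sets borel"
  shows "(norm (fs_op I J f))^2 \<le> fs_energy I J f"
proof (cases "fs_op I J f = 0")
  case True
  then show ?thesis by (simp add: fs_energy_nonneg)
next
  case False
  let ?g = "fs_op I J f"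
  have "fs_form I J f ?g = of_real ((norm ?g)^2)"
    by (simp add: fs_cinner_op[symmetric] fs_form_self norm_fs_square)
  then have "((norm ?g)^2)^2 \<le> fs_energy I J f * fs_energy I J ?g"
    using fs_form_cauchy_schwarz[of I J f ?g] by (simp add: norm_power)
  also have "\<dots> \<le> fs_energy I J f * (norm ?g)^2"
    unfolding norm_fs_square by (intro mult_left_mono fs_energy_mono fs_energy_nonneg) auto
  finally have "(norm ?g)^2 * (norm ?g)^2 \<le> fs_energy I J f * (norm ?g)^2"
    by (simp add: power2_eq_square)
  then show ?thesis by (rule mult_right_le_imp_le) (use False in simp)
qed

lemma bounded_linear_fs_op:
  assumes [simp]: "I \<in> sets borel" "J \<in> sets borel"
  shows "bounded_linear (fs_op I J)"
proof (rule bounded_linear_intro[where K = 1])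
  show "norm (fs_op I J f) \<le> norm f * 1" for f
  proof (rule power2_le_imp_le)
    have "(norm (fs_op I J f))^2 \<le> fs_energy I J f" by (rule norm_fs_op_square_le) auto
    also have "\<dots> \<le> (norm f)^2" unfolding norm_fs_square by (rule fs_energy_mono) auto
    finally show "(norm (fs_op I J f))^2 \<le> (norm f * 1)^2" by simp
  qed simp
qed (simp_all add: fs_op_add fs_op_scale fs_scale_of_real)

lemma inner_fs_op:
  assumes [simp]: "I \<in> sets borel" "J \<in> sets borel"
  shows "inner (fs_op I J f) g = Re (fs_form I J f g)"
  by (simp add: inner_fs_space_def fs_cinner_op)

lemma inner_fs_op_self:
  assumes "I \<in> sets borel" "J \<in> sets borel"
  shows "inner (fs_op I J f) f = fs_energy I J f"
  by (simp add: inner_fs_op[OF assms] fs_form_self)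

lemma fs_op_symmetric:
  assumes "I \<in> sets borel" "J \<in> sets borel"
  shows "inner (fs_op I J f) g = inner f (fs_op I J g)"
  unfolding inner_commute[of f] inner_fs_op[OF assms] by (subst cnj_fs_form[symmetric]) simp

section \<open>The Fourier transform acting on forms and kernels\<close>

lemma weighted_inner_reflect:
  assumes "\<And>x. - x \<in> I \<longleftrightarrow> x \<in> I"
  shows "weighted_inner I (\<lambda>x. f (- x)) (\<lambda>x. g (- x)) = weighted_inner I f g"
proof -
  have "indicat_real I (- x) = indicat_real I x" for x using assms[of x] by (simp add: indicator_def)
  then show ?thesis
    unfolding weighted_inner_def set_lebesgue_integral_def
    using lborel_integral_real_affine[of "- 1" "\<lambda>x. indicat_real I x *\<^sub>R (f x * cnj (g x) * of_real (1 + x^2))" 0]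
    by simp
qed

lemma fs_fourier_fourier: "fun_of (fs_fourier (fs_fourier f)) = (\<lambda>x. fun_of f (- x))"
  by (simp add: fs_fourier.rep_eq fourier_sobolev_fourier_fourier[OF fun_of])

lemma fs_fourier_period: "fs_fourier (fs_fourier (fs_fourier (fs_fourier f))) = f"
  by (rule fs_eqI) (simp add: fs_fourier_fourier)

text \<open>One transform exchanges the two sides; on the side where two transforms meet, the
  resulting reflection is invisible to a symmetric \<open>J\<close>.\<close>

lemma fs_form_fourier:
  assumes "\<And>x. - x \<in> J \<longleftrightarrow> x \<in> J"
  shows "fs_form I J (fs_fourier f) (fs_fourier g) = fs_form J I f g"
  using weighted_inner_reflect[OF assms]
  by (simp add: fs_form_def fs_fourier.rep_eq fourier_sobolev_fourier_fourier[OF fun_of])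

lemma fs_energy_fourier:
  assumes "\<And>x. - x \<in> J \<longleftrightarrow> x \<in> J"
  shows "fs_energy I J (fs_fourier f) = fs_energy J I f"
  using fs_form_fourier[OF assms, of I f f] by (simp add: fs_form_self)

lemma norm_fs_fourier: "norm (fs_fourier f) = norm f"
  using fs_energy_fourier[of UNIV UNIV f] by (simp flip: norm_fs_square)

text \<open>Three transforms act as the inverse transform, since four are the identity. This is the
  vector \<open>L\<close> of the overview.\<close>

definition fs_fourier_ker :: "real \<Rightarrow> fs_space" where
  "fs_fourier_ker \<xi> = fs_fourier (fs_fourier (fs_fourier (fs_ker \<xi>)))"

lemma fs_cinner_fourier_ker: "fs_cinner f (fs_fourier_ker \<xi>) = fourier (fun_of f) \<xi>"
  using fs_form_fourier[of UNIV UNIV f "fs_fourier_ker \<xi>"] fs_cinner_ker[of "fs_fourier f" \<xi>]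
  by (simp add: fs_fourier_ker_def fs_fourier_period fs_fourier.rep_eq)

text \<open>Each of the three transforms swaps the windows. This reduces the frequency part of the
  trace to the space part with the radii exchanged.\<close>

lemma fs_energy_fourier_ker:
  assumes I: "\<And>x. - x \<in> I \<longleftrightarrow> x \<in> I" and J: "\<And>x. - x \<in> J \<longleftrightarrow> x \<in> J"
  shows "fs_energy I J (fs_fourier_ker \<xi>) = fs_energy J I (fs_ker \<xi>)"
  unfolding fs_fourier_ker_def by (simp add: fs_energy_fourier I J)

lemma fs_fourier_diff: "fs_fourier (f - g) = fs_fourier f - fs_fourier g"
  by (rule fs_eqI) (simp add: fs_fourier.rep_eq fourier_fun_of_diff)

text \<open>The squared norm of the kernel is its own value at \<open>t\<close>, hence at most
  \<open>sqrt pi\<close> times its norm.\<close>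

lemma norm_fs_ker_le: "(norm (fs_ker t))^2 \<le> pi"
proof -
  let ?n = "norm (fs_ker t)"
  have "complex_of_real (?n^2) = fun_of (fs_ker t) t"
    unfolding norm_fs_square fs_form_self[symmetric] by (rule fs_cinner_ker)
  then have "cmod (complex_of_real (?n^2)) \<le> ?n * sqrt pi" using norm_fun_of_le by metis
  then have "?n * ?n \<le> sqrt pi * ?n" by (simp add: power2_eq_square norm_mult mult.commute)
  then have "?n \<le> sqrt pi"
  proof (cases "?n = 0")
    case False
    then have "?n > 0" by simp
    with \<open>?n * ?n \<le> sqrt pi * ?n\<close> show ?thesis by (rule mult_right_le_imp_le)
  next
    case True
    show ?thesis unfolding True by simp
  qed
  then have "?n^2 \<le> (sqrt pi)^2" by (intro power_mono) auto
  then show ?thesis by simp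
qed

lemma fs_equicontinuous:
  assumes "e > 0"
  obtains d where "d > 0" "\<And>f x y. norm f \<le> 1 \<Longrightarrow> \<bar>x - y\<bar> < d \<Longrightarrow> cmod (fun_of f x - fun_of f y) < e"
proof -
  obtain m where m: "isCont m 0" "m 0 = 0" "\<And>f x y. f \<in> fourier_sobolev \<Longrightarrow>
      (cmod (f x - f y))^2 \<le> m (x - y) * (LINT \<xi>|lborel. (cmod (fourier f \<xi>))^2 * (1 + \<xi>^2))"
    by (rule fourier_sobolev_equicontinuous) blast
  obtain d where d: "d > 0" "\<And>h. \<bar>h\<bar> < d \<Longrightarrow> \<bar>m h\<bar> < e^2"
  proof -
    have "\<exists>d>0. \<forall>h. dist h 0 < d \<longrightarrow> dist (m h) (m 0) < e^2"
      using m(1) assms unfolding continuous_at_eps_delta by (meson zero_less_power)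
    then show thesis using that by (auto simp: m(2) dist_real_def)
  qed
  have "cmod (fun_of f x - fun_of f y) < e" if f: "norm f \<le> 1" and xy: "\<bar>x - y\<bar> < d" for f x y
  proof -
    define A where "A = (LINT \<xi>|lborel. (cmod (fourier (fun_of f) \<xi>))^2 * (1 + \<xi>^2))"
    have "A \<le> (norm f)^2" unfolding A_def norm_fs_square fs_energy_def set_lebesgue_integral_def by simp
    also have "\<dots> \<le> 1^2" using f by (intro power_mono) auto
    finally have A: "A \<le> 1" by simp
    have A0: "A \<ge> 0" by (simp add: A_def)
    have "(cmod (fun_of f x - fun_of f y))^2 \<le> m (x - y) * A"
      unfolding A_def by (rule m(3)[OF fun_of])
    also have "\<dots> \<le> \<bar>m (x - y)\<bar> * 1" using A A0 by (intro mult_mono) auto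
    also have "\<dots> < e^2" using d(2)[OF xy] by simp
    finally show ?thesis using assms by (simp add: power2_less_imp_less)
  qed
  with d(1) that show thesis by blast
qed

text \<open>The norm of \<open>fs_ker s - fs_ker t\<close> is the difference of the values at
  \<open>s\<close> and \<open>t\<close> of a single unit vector, the normalised difference itself,
  and the unit ball is equicontinuous.\<close>

lemma continuous_on_fs_ker: "continuous_on A fs_ker"
proof -
  have "continuous_on UNIV fs_ker"
    unfolding continuous_on_iff
  proof (intro ballI allI impI)
    fix t e :: real assume e: "e > 0"
    obtain d where d: "d > 0" "\<And>f x y. norm f \<le> 1 \<Longrightarrow> \<bar>x - y\<bar> < d \<Longrightarrow> cmod (fun_of f x - fun_of f y) < e"
      using fs_equicontinuous[OF e] by blast
    have "dist (fs_ker s) (fs_ker t) < e" if s: "dist s t < d" for s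
    proof (cases "fs_ker s = fs_ker t")
      case False
      define g where "g = fs_ker s - fs_ker t"
      have g0: "norm g > 0" using False by (simp add: g_def)
      have g_eq: "fs_cinner x g = fun_of x s - fun_of x t" for x
        by (simp add: g_def fs_form_diff_right fs_cinner_ker)
      have "fs_cinner (g /\<^sub>R norm g) g = fun_of (g /\<^sub>R norm g) s - fun_of (g /\<^sub>R norm g) t"
        using g_eq .
      moreover have "fs_cinner (g /\<^sub>R norm g) g = of_real (norm g)"
        using g0 by (simp add: fs_scale_of_real fs_form_scale_left fs_form_self power2_eq_square field_simps flip: norm_fs_square)
      moreover have "cmod (fun_of (g /\<^sub>R norm g) s - fun_of (g /\<^sub>R norm g) t) < e"
        using s g0 by (intro d(2)) (auto simp: dist_real_def)
      ultimately have "norm g < e" by simp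
      then show ?thesis by (simp add: dist_norm g_def)
    qed (use e in simp)
    then show "\<exists>d>0. \<forall>s\<in>UNIV. dist s t < d \<longrightarrow> dist (fs_ker s) (fs_ker t) < e"
      using d(1) by blast
  qed
  then show ?thesis by (rule continuous_on_subset) simp
qed

lemma continuous_on_fs_fourier_ker: "continuous_on A fs_fourier_ker"
proof -
  have "dist (fs_fourier_ker s) (fs_fourier_ker t) = dist (fs_ker s) (fs_ker t)" for s t
    by (simp add: dist_norm fs_fourier_ker_def norm_fs_fourier flip: fs_fourier_diff)
  then show ?thesis using continuous_on_fs_ker[of A] by (simp add: continuous_on_iff)
qed

lemma continuous_on_fs_energy:
  assumes "I \<in> sets borel" "J \<in> sets borel" "continuous_on A g"
  shows "continuous_on A (\<lambda>t. fs_energy I J (g t))"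
  unfolding inner_fs_op_self[OF assms(1,2), symmetric]
  using bounded_linear.continuous_on[OF bounded_linear_fs_op[OF assms(1,2)] assms(3)] assms(3)
  by (intro continuous_intros) auto

lemma set_integrable_continuous_compact:
  fixes h :: "real \<Rightarrow> real"
  assumes "compact I" "continuous_on I h"
  shows "set_integrable lborel I h"
  using borel_integrable_compact[OF assms] unfolding set_integrable_def by (simp add: mult.commute)

text \<open>Arzela-Ascoli on \<open>I\<close> for the functions, then on \<open>J\<close> for the
  transforms of the subsequence, makes the local energy of differences small, and
  \<open>norm_fs_op_square_le\<close> passes this to the images.\<close>

lemma fs_op_compact:
  fixes X :: "nat \<Rightarrow> fs_space"
  assumes I: "compact I" and J: "compact J" and X: "\<And>n. norm (X n) \<le> 1"
  shows "\<exists>r :: nat \<Rightarrow> nat. strict_mono r \<and> Cauchy (\<lambda>n. fs_op I J (X (r n)))"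
proof -
  have [simp]: "I \<in> sets borel" "J \<in> sets borel" using I J by (auto intro: borel_compact)
  have conv: "\<exists>g k. strict_mono (k :: nat \<Rightarrow> nat) \<and> (\<forall>e>0. \<exists>N. \<forall>n x. n \<ge> N \<and> x \<in> S \<longrightarrow> cmod (fun_of (Y (k n)) x - g x) < e)"
    if S: "compact S" and Y: "\<And>n. norm (Y n) \<le> 1" for S :: "real set" and Y :: "nat \<Rightarrow> fs_space"
  proof (rule Arzela_Ascoli[OF S, of "\<lambda>n. fun_of (Y n)" "sqrt pi"])
    show "norm (fun_of (Y n) x) \<le> sqrt pi" for n x
      using order_trans[OF norm_fun_of_le[of "Y n" x] mult_right_mono[OF Y[of n], of "sqrt pi"]] by simp
    show "\<exists>d>0. \<forall>n y. y \<in> S \<and> norm (x - y) < d \<longrightarrow> cmod (fun_of (Y n) x - fun_of (Y n) y) < e"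
      if e: "e > 0" for x e
    proof -
      obtain d where "d > 0" "\<And>f x y. norm f \<le> 1 \<Longrightarrow> \<bar>x - y\<bar> < d \<Longrightarrow> cmod (fun_of f x - fun_of f y) < e"
        using fs_equicontinuous[OF e] by blast
      then show ?thesis using Y by (intro exI[of _ d]) auto
    qed
  qed blast
  obtain g1 k1 where "strict_mono (k1 :: nat \<Rightarrow> nat) \<and>
      (\<forall>e>0. \<exists>N. \<forall>n x. n \<ge> N \<and> x \<in> I \<longrightarrow> cmod (fun_of (X (k1 n)) x - g1 x) < e)"
    using conv[of I X, OF I X] by (elim exE)
  note 1 = this[THEN conjunct1] this[THEN conjunct2, rule_format]
  have "norm (fs_fourier (X (k1 n))) \<le> 1" for n using X by (simp add: norm_fs_fourier)
  from conv[of J "\<lambda>n. fs_fourier (X (k1 n))", OF J this]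
  obtain g2 k2 where "strict_mono (k2 :: nat \<Rightarrow> nat) \<and>
      (\<forall>e>0. \<exists>N. \<forall>n x. n \<ge> N \<and> x \<in> J \<longrightarrow> cmod (fun_of (fs_fourier (X (k1 (k2 n)))) x - g2 x) < e)"
    by (elim exE)
  note 2 = this[THEN conjunct1] this[THEN conjunct2, rule_format]
  define r where "r = k1 \<circ> k2"
  have r: "strict_mono r" unfolding r_def using 1(1) 2(1) by (rule strict_mono_o)
  define M where "M = (LINT x:I|lborel. 1 + x^2) + (LINT x:J|lborel. 1 + x^2)"
  have w_int: "set_integrable lborel S (\<lambda>x::real. c * (1 + x^2))" if "compact S" for S c
    by (rule set_integrable_continuous_compact[OF that]) (intro continuous_intros)
  have M0: "M \<ge> 0" unfolding M_def set_lebesgue_integral_def by (intro add_nonneg_nonneg Bochner_Integration.integral_nonneg) auto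
  have piece: "(LINT x:S|lborel. (cmod (h x))^2 * (1 + x^2)) \<le> e * (LINT x:S|lborel. 1 + x^2)"
    if S: "compact S" and h: "h \<in> weighted_L2" and le: "\<And>x. x \<in> S \<Longrightarrow> (cmod (h x))^2 \<le> e" for S h e
  proof -
    have "(LINT x:S|lborel. (cmod (h x))^2 * (1 + x^2)) \<le> (LINT x:S|lborel. e * (1 + x^2))"
      by (intro set_integral_mono weighted_square_set_integrable h w_int S borel_compact mult_right_mono le) auto
    then show ?thesis by simp
  qed
  have "Cauchy (\<lambda>n. fs_op I J (X (r n)))"
  proof (rule metric_CauchyI)
    fix e :: real assume e: "e > 0"
    \<comment> \<open>Two members of the subsequence differ by at most
      \<open>\<eta> = 2 * \<delta>\<close> on the windows, which gives energy at most
      \<open>\<eta>^2 * M\<close>. The choice makes \<open>\<eta> * (M + 1) = e / 2\<close>;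
      \<open>M + 1\<close> is positive even for windows of measure zero.\<close>
    define \<delta> where "\<delta> = e / (4 * (M + 1))"
    have \<delta>: "\<delta> > 0" using e M0 by (simp add: \<delta>_def)
    define \<eta> where "\<eta> = 2 * \<delta>"
    have \<eta>: "\<eta> * (M + 1) = e / 2" using M0 by (simp add: \<eta>_def \<delta>_def divide_simps)
    obtain N1 where N1: "\<And>n x. n \<ge> N1 \<Longrightarrow> x \<in> I \<Longrightarrow> cmod (fun_of (X (k1 n)) x - g1 x) < \<delta>"
      using 1(2)[OF \<delta>] by blast
    obtain N2 where N2: "\<And>n x. n \<ge> N2 \<Longrightarrow> x \<in> J \<Longrightarrow> cmod (fun_of (fs_fourier (X (k1 (k2 n)))) x - g2 x) < \<delta>"
      using 2(2)[OF \<delta>] by blast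
    have k2: "k2 n \<ge> n" for n using 2(1) by (rule seq_suble)
    have "dist (fs_op I J (X (r m))) (fs_op I J (X (r n))) < e" if mn: "m \<ge> max N1 N2" "n \<ge> max N1 N2" for m n
    proof -
      let ?h = "X (r m) - X (r n)"
      have a: "(cmod (fun_of ?h x))^2 \<le> \<eta>^2" if "x \<in> I" for x
      proof -
        have "cmod (fun_of (X (r m)) x - fun_of (X (r n)) x) < \<delta> + \<delta>"
          using norm_triangle_lt[of "fun_of (X (r m)) x - g1 x" "g1 x - fun_of (X (r n)) x" "\<delta> + \<delta>"]
            N1[of "k2 m" x] N1[of "k2 n" x] k2[of m] k2[of n] mn that
          by (simp add: r_def norm_minus_commute)
        then show ?thesis by (intro power_mono) (simp_all add: \<eta>_def)
      qed
      have b: "(cmod (fourier (fun_of ?h) x))^2 \<le> \<eta>^2" if "x \<in> J" for x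
      proof -
        have "cmod (fun_of (fs_fourier (X (r m))) x - fun_of (fs_fourier (X (r n))) x) < \<delta> + \<delta>"
          using norm_triangle_lt[of "fun_of (fs_fourier (X (r m))) x - g2 x" "g2 x - fun_of (fs_fourier (X (r n))) x" "\<delta> + \<delta>"]
            N2[of m x] N2[of n x] mn that
          by (simp add: r_def norm_minus_commute)
        then show ?thesis by (intro power_mono) (simp_all add: \<eta>_def fs_fourier.rep_eq fourier_fun_of_diff)
      qed
      have "(norm (fs_op I J ?h))^2 \<le> fs_energy I J ?h" by (rule norm_fs_op_square_le) auto
      also have "\<dots> \<le> \<eta>^2 * (LINT x:I|lborel. 1 + x^2) + \<eta>^2 * (LINT x:J|lborel. 1 + x^2)"
        unfolding fs_energy_def by (intro add_mono piece weighted_L2_fun_of I J a b)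
      also have "\<dots> = \<eta>^2 * M" by (simp add: M_def distrib_left)
      also have "\<dots> < e^2"
      proof -
        have "\<eta>^2 * M \<le> \<eta>^2 * (M + 1)^2"
          using M0 by (intro mult_left_mono) (auto simp: power2_eq_square algebra_simps)
        also have "\<dots> = (e / 2)^2" unfolding \<eta>[symmetric] by (rule power_mult_distrib[symmetric])
        also have "\<dots> < e^2" using e by (simp add: power2_eq_square)
        finally show ?thesis .
      qed
      finally have "norm (fs_op I J ?h) < e" using e by (simp add: power2_less_imp_less)
      then show ?thesis
        by (simp add: dist_norm bounded_linear.linear[OF bounded_linear_fs_op] linear_diff)
    qed
    then show "\<exists>M. \<forall>m\<ge>M. \<forall>n\<ge>M. dist (fs_op I J (X (r m))) (fs_op I J (X (r n))) < e" by blast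
  qed
  with r show ?thesis by blast
qed

section \<open>Eigenvalues of the localization operator\<close>

lemma fs_form_zero [simp]: "fs_form I J 0 g = 0" "fs_form I J g 0 = 0"
  using fs_form_scale_left[of I J 0 0 g] fs_form_scale_right[of I J g 0 0] fs_scale_of_real[of 0 "0 :: fs_space"]
  by simp_all

lemma fs_form_sum_left:
  assumes "I \<in> sets borel" "J \<in> sets borel"
  shows "fs_form I J (\<Sum>e\<in>F. h e) g = (\<Sum>e\<in>F. fs_form I J (h e) g)"
  by (induction F rule: infinite_finite_induct) (simp_all add: fs_form_add_left[OF assms])

lemma fs_form_sum_right:
  assumes "I \<in> sets borel" "J \<in> sets borel"
  shows "fs_form I J g (\<Sum>e\<in>F. h e) = (\<Sum>e\<in>F. fs_form I J g (h e))"
  by (induction F rule: infinite_finite_induct) (simp_all add: fs_form_add_right[OF assms])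

lemma fs_scale_zero [simp]: "fs_scale 0 f = 0"
  by (rule fs_eqI) simp

lemma fs_scale_scale: "fs_scale a (fs_scale b f) = fs_scale (a * b) f"
  by (rule fs_eqI) (simp add: mult.assoc)

lemma norm_fs_scale: "norm (fs_scale c f) = cmod c * norm f"
  by (rule power2_eq_imp_eq) (simp_all add: norm_fs_square fs_energy_scale power_mult_distrib)

definition fs_orthonormal :: "fs_space set \<Rightarrow> bool" where
  "fs_orthonormal F \<longleftrightarrow> (\<forall>e\<in>F. \<forall>e'\<in>F. fs_cinner e e' = (if e = e' then 1 else 0))"

definition fs_proj :: "fs_space set \<Rightarrow> fs_space \<Rightarrow> fs_space" where
  "fs_proj F f = (\<Sum>e\<in>F. fs_scale (fs_cinner f e) e)"

lemma fs_cinner_proj: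
  assumes "finite F" "fs_orthonormal F" "e \<in> F"
  shows "fs_cinner (fs_proj F f) e = fs_cinner f e"
proof -
  have "fs_cinner (fs_proj F f) e = (\<Sum>e'\<in>F. fs_cinner f e' * (if e' = e then 1 else 0))"
    unfolding fs_proj_def using assms
    by (simp add: fs_form_sum_left fs_form_scale_left fs_orthonormal_def)
  also have "\<dots> = fs_cinner f e" using assms by (simp add: sum.delta if_distrib cong: if_cong)
  finally show ?thesis .
qed

text \<open>Pythagoras for the window form: members of \<open>F\<close> are orthogonal to the
  residual \<open>f - fs_proj F f\<close> in this form as well, because it is a multiple of the
  inner product against each of them. With \<open>UNIV\<close> and \<open>m = 1\<close> it yields
  the contraction property of the projection.\<close>

lemma fs_energy_proj:
  assumes IJ [simp]: "I \<in> sets borel" "J \<in> sets borel" and F: "finite F" "fs_orthonormal F"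
    and m: "\<And>h e. e \<in> F \<Longrightarrow> fs_form I J h e = of_real (m e) * fs_cinner h e"
  shows "fs_energy I J f = fs_energy I J (f - fs_proj F f) + (\<Sum>e\<in>F. m e * (cmod (fs_cinner f e))^2)"
proof -
  let ?p = "fs_proj F f"
  have form_p: "fs_form I J h ?p = (\<Sum>e\<in>F. of_real (m e) * (cnj (fs_cinner f e) * fs_cinner h e))" for h
    unfolding fs_proj_def using m
    by (simp add: fs_form_sum_right fs_form_scale_right mult_ac)
  have fp: "fs_form I J f ?p = of_real (\<Sum>e\<in>F. m e * (cmod (fs_cinner f e))^2)"
    unfolding form_p of_real_sum of_real_mult complex_norm_square by (simp add: mult.commute)
  have "fs_form I J ?p ?p = (\<Sum>e\<in>F. of_real (m e) * (cnj (fs_cinner f e) * fs_cinner f e))"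
    unfolding form_p[of ?p] using F by (intro sum.cong refl) (simp add: fs_cinner_proj)
  then have "fs_form I J ?p ?p = fs_form I J f ?p" by (simp add: form_p[of f])
  then have pp: "fs_energy I J ?p = (\<Sum>e\<in>F. m e * (cmod (fs_cinner f e))^2)"
    unfolding fs_form_self fp of_real_eq_iff .
  show ?thesis
    unfolding fs_energy_diff[OF IJ] fp pp by simp
qed

lemma norm_minus_fs_proj_le:
  assumes "finite F" "fs_orthonormal F"
  shows "(norm (f - fs_proj F f))^2 \<le> (norm f)^2"
  using fs_energy_proj[of UNIV UNIV F "\<lambda>_. 1" f] assms
  by (simp add: norm_fs_square sum_nonneg)

section \<open>Finite orthonormal families of eigenvectors and the trace identity\<close>

locale fs_window =
  fixes I J :: "real set"
  assumes compact_window: "compact I" "compact J"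
begin

lemma borel_window [simp, intro]: "I \<in> sets borel" "J \<in> sets borel"
  using compact_window by (auto intro: borel_compact)

abbreviation "E \<equiv> fs_energy I J"
abbreviation "T \<equiv> fs_op I J"

text \<open>For a unit eigenvector the eigenvalue is \<open>E e\<close>, as
  \<open>inner (T e) e = E e\<close>; hence the energies themselves serve as the list of
  eigenvalues.\<close>

definition eigensystem :: "real \<Rightarrow> fs_space set \<Rightarrow> bool" where
  "eigensystem \<epsilon> F \<longleftrightarrow> finite F \<and> fs_orthonormal F \<and> (\<forall>e\<in>F. E e \<ge> \<epsilon> \<and> T e = E e *\<^sub>R e)"

definition window_trace :: real where
  "window_trace = (LINT t:I|lborel. E (fs_ker t) * (1 + t^2))
     + (LINT \<xi>:J|lborel. E (fs_fourier_ker \<xi>) * (1 + \<xi>^2))"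

text \<open>Bounds the weighted integrals of the squared norms of the kernel vectors over both
  windows; it is the factor of \<open>\<epsilon>\<close> in the remainder of the trace
  identity.\<close>

definition window_mass :: real where
  "window_mass = pi * ((LINT t:I|lborel. 1 + t^2) + (LINT t:J|lborel. 1 + t^2))"

lemma window_mass_nonneg: "window_mass \<ge> 0"
  unfolding window_mass_def set_lebesgue_integral_def
  by (intro mult_nonneg_nonneg add_nonneg_nonneg Bochner_Integration.integral_nonneg) auto

lemma eigensystem_form:
  assumes "eigensystem \<epsilon> F" "e \<in> F"
  shows "fs_form I J h e = of_real (E e) * fs_cinner h e"
proof -
  have "fs_form I J e h = of_real (E e) * fs_cinner e h"
    using assms fs_cinner_op[OF borel_window, of e h]
    by (simp add: eigensystem_def fs_scale_of_real fs_form_scale_left)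
  from arg_cong[OF this, of cnj] show ?thesis by (simp add: cnj_fs_form)
qed

lemma eigensystem_energy:
  assumes "eigensystem \<epsilon> F"
  shows "E f = E (f - fs_proj F f) + (\<Sum>e\<in>F. E e * (cmod (fs_cinner f e))^2)"
  using assms eigensystem_form[OF assms]
  by (intro fs_energy_proj) (auto simp: eigensystem_def)

text \<open>\<open>eigensystem_energy\<close> is integrated at the kernel vectors. Pairing
  \<open>e\<close> with them gives the values of \<open>e\<close> and of its transform up to
  conjugation, so each term of the sum becomes \<open>E e\<close> times a weighted square integral
  over a window.\<close>

lemma trace_decomposition:
  assumes F: "eigensystem \<epsilon> F"
  shows "window_trace - (\<Sum>e\<in>F. (E e)^2)
    = (LINT t:I|lborel. E (fs_ker t - fs_proj F (fs_ker t)) * (1 + t^2))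
     + (LINT \<xi>:J|lborel. E (fs_fourier_ker \<xi> - fs_proj F (fs_fourier_ker \<xi>)) * (1 + \<xi>^2))"
proof -
  have part: "(LINT t:S|lborel. E (k t) * (1 + t^2)) - (\<Sum>e\<in>F. E e * (LINT t:S|lborel. (cmod (u e t))^2 * (1 + t^2)))
      = (LINT t:S|lborel. E (k t - fs_proj F (k t)) * (1 + t^2))"
    if S: "compact S" and k: "continuous_on S k" and u: "\<And>e. u e \<in> weighted_L2"
      and ku: "\<And>e t. cmod (fs_cinner (k t) e) = cmod (u e t)"
    for S k and u :: "fs_space \<Rightarrow> real \<Rightarrow> complex"
  proof -
    have i1: "set_integrable lborel S (\<lambda>t. E (k t) * (1 + t^2))"
      by (intro set_integrable_continuous_compact S continuous_intros continuous_on_fs_energy k borel_window)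
    have i2: "set_integrable lborel S (\<lambda>t. E e * ((cmod (u e t))^2 * (1 + t^2)))" for e
      using weighted_square_set_integrable[OF u, of S e] S by (simp add: borel_compact)
    have i3: "set_integrable lborel S (\<lambda>t. \<Sum>e\<in>F. E e * ((cmod (u e t))^2 * (1 + t^2)))"
      using i2 unfolding set_integrable_def scaleR_sum_right by (rule Bochner_Integration.integrable_sum)
    have s: "(LINT t:S|lborel. (\<Sum>e\<in>F. E e * ((cmod (u e t))^2 * (1 + t^2))))
        = (\<Sum>e\<in>F. E e * (LINT t:S|lborel. (cmod (u e t))^2 * (1 + t^2)))"
      unfolding set_integral_mult_right[symmetric]
      using i2 unfolding set_integrable_def set_lebesgue_integral_def scaleR_sum_right
      by (rule Bochner_Integration.integral_sum)
    have "E (k t - fs_proj F (k t)) * (1 + t^2)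
        = E (k t) * (1 + t^2) - (\<Sum>e\<in>F. E e * ((cmod (u e t))^2 * (1 + t^2)))" for t
    proof -
      have "E (k t - fs_proj F (k t)) = E (k t) - (\<Sum>e\<in>F. E e * (cmod (u e t))^2)"
        using eigensystem_energy[OF F, of "k t"] by (simp add: ku)
      then show ?thesis
        by (simp only: left_diff_distrib sum_distrib_right mult.assoc)
    qed
    then show ?thesis
      by (simp only: set_integral_diff(2)[OF i1 i3] s)
  qed
  have "(LINT t:I|lborel. E (fs_ker t) * (1 + t^2))
        - (\<Sum>e\<in>F. E e * (LINT t:I|lborel. (cmod (fun_of e t))^2 * (1 + t^2)))
      = (LINT t:I|lborel. E (fs_ker t - fs_proj F (fs_ker t)) * (1 + t^2))"
  proof (rule part[OF compact_window(1) continuous_on_fs_ker weighted_L2_fun_of(1)])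
    show "cmod (fs_cinner (fs_ker t) e) = cmod (fun_of e t)" for e t
      using arg_cong[OF cnj_fs_form[of UNIV UNIV e "fs_ker t"], of cmod] by (simp add: fs_cinner_ker)
  qed
  moreover have "(LINT t:J|lborel. E (fs_fourier_ker t) * (1 + t^2))
        - (\<Sum>e\<in>F. E e * (LINT t:J|lborel. (cmod (fourier (fun_of e) t))^2 * (1 + t^2)))
      = (LINT t:J|lborel. E (fs_fourier_ker t - fs_proj F (fs_fourier_ker t)) * (1 + t^2))"
  proof (rule part[OF compact_window(2) continuous_on_fs_fourier_ker weighted_L2_fun_of(2)])
    show "cmod (fs_cinner (fs_fourier_ker t) e) = cmod (fourier (fun_of e) t)" for e t
      using arg_cong[OF cnj_fs_form[of UNIV UNIV e "fs_fourier_ker t"], of cmod] by (simp add: fs_cinner_fourier_ker)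
  qed
  \<comment> \<open>The integrals over \<open>I\<close> and \<open>J\<close> add up to
    \<open>E e\<close>, the second factor of the square.\<close>
  moreover have "(\<Sum>e\<in>F. (E e)^2)
      = (\<Sum>e\<in>F. E e * (LINT t:I|lborel. (cmod (fun_of e t))^2 * (1 + t^2)))
       + (\<Sum>e\<in>F. E e * (LINT t:J|lborel. (cmod (fourier (fun_of e) t))^2 * (1 + t^2)))"
    unfolding sum.distrib[symmetric] distrib_left[symmetric]
    by (intro sum.cong refl) (simp only: fs_energy_def power2_eq_square)
  ultimately show ?thesis unfolding window_trace_def by linarith
qed

lemma eigensystem_sum_le:
  assumes "eigensystem \<epsilon> F"
  shows "(\<Sum>e\<in>F. (E e)^2) \<le> window_trace"
proof -
  have "0 \<le> window_trace - (\<Sum>e\<in>F. (E e)^2)"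
    unfolding trace_decomposition[OF assms] set_lebesgue_integral_def
    by (intro add_nonneg_nonneg Bochner_Integration.integral_nonneg scaleR_nonneg_nonneg mult_nonneg_nonneg fs_energy_nonneg) auto
  then show ?thesis by simp
qed

lemma eigensystem_extend:
  assumes F: "eigensystem \<epsilon> F" and m: "m \<ge> \<epsilon>" and v: "v \<noteq> 0" "T v = m *\<^sub>R v"
    and ortho: "\<And>e. e \<in> F \<Longrightarrow> fs_cinner v e = 0"
  obtains G where "eigensystem \<epsilon> G" "card G > card F"
proof -
  define w where "w = v /\<^sub>R norm v"
  have w1: "norm w = 1" using v(1) by (simp add: w_def)
  have ww: "fs_cinner w w = 1" using w1 by (simp add: fs_form_self flip: norm_fs_square)
  have wF0: "fs_cinner w e = 0" if "e \<in> F" for e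
    using ortho[OF that] by (simp add: w_def fs_scale_of_real fs_form_scale_left)
  have Tw: "T w = m *\<^sub>R w"
    by (simp add: w_def v(2) linear_scale[OF bounded_linear.linear[OF bounded_linear_fs_op[OF borel_window]]])
  have Ew: "E w = m"
    using inner_fs_op_self[OF borel_window, of w] w1 by (simp add: Tw power2_norm_eq_inner[symmetric])
  have wF: "w \<notin> F" using wF0 ww by auto
  have "fs_cinner e w = 0" if "e \<in> F" for e
    using wF0[OF that] cnj_fs_form[of UNIV UNIV w e] by simp
  then have "eigensystem \<epsilon> (insert w F)"
    using F wF0 ww wF m Tw Ew by (auto simp: eigensystem_def fs_orthonormal_def)
  moreover have "card (insert w F) > card F" using wF F by (simp add: eigensystem_def)
  ultimately show thesis by (rule that)
qed

text \<open>Otherwise the form exceeds \<open>\<epsilon>\<close> somewhere on the orthogonal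
  complement of \<open>F\<close>, which is closed and invariant, and compactness supplies an
  eigenvector there that extends \<open>F\<close>.\<close>

lemma eigensystem_complete:
  assumes \<epsilon>: "\<epsilon> > 0" and F: "eigensystem \<epsilon> F"
    and max: "\<And>G. eigensystem \<epsilon> G \<Longrightarrow> card G \<le> card F"
    and h: "\<And>e. e \<in> F \<Longrightarrow> fs_cinner h e = 0"
  shows "E h \<le> \<epsilon> * (norm h)^2"
proof (rule ccontr)
  assume "\<not> E h \<le> \<epsilon> * (norm h)^2"
  then have big: "inner (T h) h > \<epsilon> * (norm h)^2" by (simp add: inner_fs_op_self)
  define V where "V = {f. \<forall>e\<in>F. fs_cinner f e = 0}"
  have V: "subspace V"
    by (auto simp: V_def subspace_def fs_form_add_left fs_scale_of_real fs_form_scale_left)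
  have "closed V"
  proof -
    have cont: "continuous_on UNIV (\<lambda>f. fs_cinner f e)" for e
    proof -
      have "bounded_linear (\<lambda>f. fs_cinner f e)"
        by (rule bounded_linear_intro[where K = "norm e"])
          (auto simp: fs_form_add_left fs_scale_of_real fs_form_scale_left scaleR_conv_of_real intro: norm_fs_form_le)
      then show ?thesis by (rule bounded_linear.continuous_on[OF _ continuous_on_id])
    qed
    have "V = (\<Inter>e\<in>F. {f. fs_cinner f e = 0})" by (auto simp: V_def)
    moreover have "closed {f. fs_cinner f e = 0}" for e
      by (intro closed_Collect_eq cont continuous_on_const)
    ultimately show ?thesis by (simp add: closed_INT)
  qed
  have "T ` V \<subseteq> V"
    by (auto simp: V_def fs_cinner_op eigensystem_form[OF F])
  have hV: "h \<in> V" using h by (simp add: V_def)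
  obtain m v where mv: "m > \<epsilon>" "v \<in> V" "v \<noteq> 0" "T v = m *\<^sub>R v"
  proof (rule compact_positive_operator_eigenvector[OF bounded_linear_fs_op[OF borel_window]
        fs_op_symmetric[OF borel_window] _ fs_op_compact[OF compact_window] V \<open>closed V\<close> \<open>T ` V \<subseteq> V\<close> hV big \<epsilon>])
    show "0 \<le> inner (T x) x" for x by (simp add: inner_fs_op_self fs_energy_nonneg)
  qed blast+
  have "fs_cinner v e = 0" if "e \<in> F" for e using mv(2) that by (simp add: V_def)
  with eigensystem_extend[OF F less_imp_le[OF mv(1)] mv(3,4)]
  obtain G where "eigensystem \<epsilon> G" "card G > card F" by blast
  with max[of G] show False by simp
qed

text \<open>Each member contributes at least \<open>\<epsilon>^2\<close> to a sum that never exceeds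
  the trace, so the cardinalities are bounded.\<close>

lemma maximal_eigensystem:
  assumes \<epsilon>: "\<epsilon> > 0"
  obtains F where "eigensystem \<epsilon> F" "\<And>G. eigensystem \<epsilon> G \<Longrightarrow> card G \<le> card F"
proof -
  have empty: "eigensystem \<epsilon> {}" by (simp add: eigensystem_def fs_orthonormal_def)
  have "card F \<le> nat \<lceil>window_trace / \<epsilon>^2\<rceil>" if F: "eigensystem \<epsilon> F" for F
  proof -
    have "real (card F) * \<epsilon>^2 = (\<Sum>e\<in>F. \<epsilon>^2)" by simp
    also have "\<dots> \<le> (\<Sum>e\<in>F. (E e)^2)"
      using F \<epsilon> by (intro sum_mono power_mono) (auto simp: eigensystem_def)
    also have "\<dots> \<le> window_trace" by (rule eigensystem_sum_le[OF F])
    finally have "real (card F) \<le> window_trace / \<epsilon>^2" using \<epsilon> by (simp add: pos_le_divide_eq)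
    then show ?thesis by linarith
  qed
  then have "\<forall>F. eigensystem \<epsilon> F \<longrightarrow> card F < Suc (nat \<lceil>window_trace / \<epsilon>^2\<rceil>)" by (simp add: less_Suc_eq_le)
  from ex_has_greatest_nat[of "eigensystem \<epsilon>", OF empty this] that show thesis by blast
qed

text \<open>Complements \<open>eigensystem_complete\<close>, whose bound still admits eigenvectors
  in the complement with eigenvalue exactly \<open>\<epsilon>\<close>; these too would extend the
  family.\<close>

lemma maximal_eigensystem_eigenvector:
  assumes "eigensystem \<epsilon> F" and max: "\<And>G. eigensystem \<epsilon> G \<Longrightarrow> card G \<le> card F"
    and "m \<ge> \<epsilon>" "T h = m *\<^sub>R h" "\<And>e. e \<in> F \<Longrightarrow> fs_cinner h e = 0"
  shows "h = 0"
proof (rule ccontr)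
  assume "h \<noteq> 0"
  from eigensystem_extend[OF assms(1,3) this assms(4,5)]
  obtain G where "eigensystem \<epsilon> G" "card G > card F" by blast
  with max[of G] show False by simp
qed

text \<open>Subtracting the projection moves the kernel vectors into the complement without raising
  their squared norm above \<open>pi\<close>, so their remaining energy is at most
  \<open>\<epsilon> * pi\<close>.\<close>

lemma maximal_eigensystem_sum_ge:
  assumes F: "eigensystem \<epsilon> F"
    and max: "\<And>G. eigensystem \<epsilon> G \<Longrightarrow> card G \<le> card F" and \<epsilon>: "\<epsilon> > 0"
  shows "window_trace - \<epsilon> * window_mass \<le> (\<Sum>e\<in>F. (E e)^2)"
proof -
  have F': "finite F" "fs_orthonormal F" using F by (auto simp: eigensystem_def)
  have E_le: "E (k - fs_proj F k) \<le> \<epsilon> * pi" if k: "(norm k)^2 \<le> pi" for k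
  proof -
    have "E (k - fs_proj F k) \<le> \<epsilon> * (norm (k - fs_proj F k))^2"
      by (rule eigensystem_complete[OF \<epsilon> F max]) (simp_all add: fs_form_diff_left fs_cinner_proj[OF F'])
    also have "\<dots> \<le> \<epsilon> * pi"
      using order_trans[OF norm_minus_fs_proj_le[OF F'] k] \<epsilon> by (intro mult_left_mono) auto
    finally show ?thesis .
  qed
  have part: "(LINT t:S|lborel. E (k t - fs_proj F (k t)) * (1 + t^2)) \<le> \<epsilon> * pi * (LINT t:S|lborel. 1 + t^2)"
    if S: "compact S" and k: "continuous_on S k" and k_le: "\<And>t. (norm (k t))^2 \<le> pi" for S k
  proof -
    have "bounded_linear (\<lambda>f. fs_scale (fs_cinner f e) e)" for e
    proof (rule bounded_linear_intro[where K = "norm e * norm e"])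
      show "norm (fs_scale (fs_cinner f e) e) \<le> norm f * (norm e * norm e)" for f
        unfolding norm_fs_scale mult.assoc[symmetric] by (intro mult_right_mono norm_fs_form_le) auto
    qed (auto intro!: fs_eqI simp: fs_form_add_left fs_scale_of_real fs_form_scale_left distrib_right)
    then have "continuous_on S (\<lambda>t. fs_proj F (k t))"
      unfolding fs_proj_def by (intro continuous_on_sum bounded_linear.continuous_on[OF _ k])
    then have i: "set_integrable lborel S (\<lambda>t. E (k t - fs_proj F (k t)) * (1 + t^2))"
      by (intro set_integrable_continuous_compact S continuous_intros continuous_on_fs_energy k borel_window)
    have "(LINT t:S|lborel. E (k t - fs_proj F (k t)) * (1 + t^2)) \<le> (LINT t:S|lborel. \<epsilon> * pi * (1 + t^2))"
      by (intro set_integral_mono i set_integrable_continuous_compact S continuous_intros mult_right_mono E_le k_le) auto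
    then show ?thesis by simp
  qed
  have "window_trace - (\<Sum>e\<in>F. (E e)^2) \<le> \<epsilon> * pi * (LINT t:I|lborel. 1 + t^2) + \<epsilon> * pi * (LINT t:J|lborel. 1 + t^2)"
    unfolding trace_decomposition[OF F]
    by (intro add_mono part compact_window continuous_on_fs_ker continuous_on_fs_fourier_ker)
      (simp_all add: norm_fs_ker_le fs_fourier_ker_def norm_fs_fourier)
  also have "\<dots> = \<epsilon> * window_mass" by (simp add: window_mass_def algebra_simps)
  finally show ?thesis by simp
qed

end

section \<open>From eigenvector families to eigenvalues with multiplicity\<close>

lemma fun_of_lincomb:
  "fun_of (\<Sum>e\<in>B. fs_scale (c e) e) = (\<Sum>e\<in>B. (\<lambda>x. c e * fun_of e x))"
  by (induction B rule: infinite_finite_induct) (auto simp: fun_eq_iff)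

lemma fs_scale_zero_right [simp]: "fs_scale c 0 = 0"
  by (rule fs_eqI) simp

lemma fs_orthonormal_independent:
  assumes B: "finite B" "fs_orthonormal B"
  shows "cfun.independent (fun_of ` B)"
proof
  assume "cfun.dependent (fun_of ` B)"
  then obtain u e0 where u: "e0 \<in> B" "u (fun_of e0) \<noteq> 0" "(\<Sum>v\<in>fun_of ` B. (\<lambda>x. u v * v x)) = 0"
    using B(1) by (subst (asm) cfun.dependent_finite) auto
  have "inj_on fun_of B" by (simp add: inj_on_def fun_of_inject)
  then have "(\<Sum>v\<in>fun_of ` B. (\<lambda>x. u v * v x)) = fun_of (\<Sum>e\<in>B. fs_scale (u (fun_of e)) e)"
    unfolding fun_of_lincomb by (simp add: sum.reindex)
  with u(3) have "(\<Sum>e\<in>B. fs_scale (u (fun_of e)) e) = 0"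
    by (intro fs_eqI) (simp add: fun_eq_iff)
  then have "0 = fs_cinner (\<Sum>e\<in>B. fs_scale (u (fun_of e)) e) e0" by simp
  also have "\<dots> = (\<Sum>e\<in>B. u (fun_of e) * (if e = e0 then 1 else 0))"
    using B u(1) by (simp add: fs_form_sum_left fs_form_scale_left fs_orthonormal_def)
  also have "\<dots> = u (fun_of e0)" using B u(1) by (simp add: sum.delta if_distrib cong: if_cong)
  finally show False using u(2) by simp
qed

context fs_window
begin

abbreviation "Loc \<equiv> fs_localization I J"

lemma eigenspace_eq: "fs_eigenspace Loc \<mu> = fun_of ` {f. T f = fs_scale \<mu> f}"
proof -
  have iff: "Loc (fun_of g) = (\<lambda>t. \<mu> * fun_of g t) \<longleftrightarrow> T g = fs_scale \<mu> g" for g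
    unfolding fun_of_op[OF borel_window, symmetric] fs_scale.rep_eq[symmetric] fun_of_inject ..
  have "f \<in> fs_eigenspace Loc \<mu> \<longleftrightarrow> f \<in> fun_of ` {f. T f = fs_scale \<mu> f}" for f
  proof (cases "f \<in> fourier_sobolev")
    case True
    then obtain g where "f = fun_of g" using Abs_fs_inverse by metis
    then show ?thesis using iff[of g] fun_of[of g] by (auto simp: fs_eigenspace_def fun_of_inject)
  next
    case False
    then show ?thesis using fun_of by (auto simp: fs_eigenspace_def)
  qed
  then show ?thesis by blast
qed

lemma eigenvalues_iff: "\<mu> \<in> fs_eigenvalues Loc \<longleftrightarrow> (\<exists>f. f \<noteq> 0 \<and> T f = fs_scale \<mu> f)"
proof -
  have "fun_of f \<noteq> (\<lambda>t. 0) \<longleftrightarrow> f \<noteq> 0" for f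
    by (metis fs_eqI fun_of_simps(1) ext)
  then show ?thesis by (auto simp: fs_eigenvalues_def eigenspace_eq)
qed

lemma eigenvalue_real_nonneg:
  assumes "\<mu> \<in> fs_eigenvalues Loc"
  shows "\<mu> = of_real (Re \<mu>)" "Re \<mu> \<ge> 0"
proof -
  obtain f where f: "f \<noteq> 0" "T f = fs_scale \<mu> f" using assms eigenvalues_iff by blast
  have "of_real (E f) = \<mu> * of_real ((norm f)^2)"
    using fs_cinner_op[OF borel_window, of f f] by (simp add: f(2) fs_form_scale_left fs_form_self norm_fs_square)
  then have "\<mu> = of_real (E f / (norm f)^2)" using f(1) by (simp add: field_simps)
  then show "\<mu> = of_real (Re \<mu>)" "Re \<mu> \<ge> 0" by (simp_all add: fs_energy_nonneg del: of_real_divide)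
qed

text \<open>Symmetry kills the coefficients of an eigenvector along members with another eigenvalue.
  What remains after projection is again an eigenvector for \<open>m\<close>, orthogonal to
  \<open>F\<close>, hence zero by maximality.\<close>

lemma eigensystem_eigenspace:
  assumes F: "eigensystem \<epsilon> F" and m: "m \<ge> \<epsilon>" "m > 0"
    and max: "\<And>G. eigensystem \<epsilon> G \<Longrightarrow> card G \<le> card F"
  shows "fs_eigenspace Loc (of_real m) = cfun.span (fun_of ` {e \<in> F. E e = m})"
proof
  let ?B = "{e \<in> F. E e = m}"
  have F': "finite F" "fs_orthonormal F" using F by (auto simp: eigensystem_def)
  show "fs_eigenspace Loc (of_real m) \<subseteq> cfun.span (fun_of ` ?B)"
  proof
    fix f' assume "f' \<in> fs_eigenspace Loc (of_real m)"
    then obtain f where f: "f' = fun_of f" "T f = fs_scale (of_real m) f" unfolding eigenspace_eq by blast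
    have zero: "fs_cinner f e = 0" if "e \<in> F" "E e \<noteq> m" for e
      using eigensystem_form[OF F that(1), of f] fs_cinner_op[OF borel_window, of f e] that(2)
      by (simp add: f(2) fs_form_scale_left)
    interpret T: bounded_linear T by (rule bounded_linear_fs_op[OF borel_window])
    have "T (fs_proj F f) = (\<Sum>e\<in>F. fs_scale (fs_cinner f e) (T e))"
      unfolding fs_proj_def T.sum by (simp add: fs_op_scale)
    also have "\<dots> = (\<Sum>e\<in>F. m *\<^sub>R fs_scale (fs_cinner f e) e)"
    proof (intro sum.cong refl)
      fix e assume e: "e \<in> F"
      then have "T e = E e *\<^sub>R e" using F by (simp add: eigensystem_def)
      then show "fs_scale (fs_cinner f e) (T e) = m *\<^sub>R fs_scale (fs_cinner f e) e"
        using zero[OF e] by (cases "E e = m") (simp_all add: fs_scale_of_real fs_scale_scale mult.commute)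
    qed
    also have "\<dots> = m *\<^sub>R fs_proj F f" by (simp add: fs_proj_def scaleR_sum_right)
    finally have Tg: "T (f - fs_proj F f) = m *\<^sub>R (f - fs_proj F f)"
      by (simp add: T.diff f(2) scaleR_diff_right fs_scale_of_real[symmetric])
    have "f - fs_proj F f = 0"
      by (rule maximal_eigensystem_eigenvector[OF F max m(1) Tg]) (simp_all add: fs_form_diff_left fs_cinner_proj[OF F'])
    then have "f = (\<Sum>e\<in>F. fs_scale (fs_cinner f e) e)" by (simp add: fs_proj_def)
    also have "\<dots> = (\<Sum>e\<in>?B. fs_scale (fs_cinner f e) e)"
      using F' zero by (intro sum.mono_neutral_right) auto
    finally have "f' = (\<Sum>e\<in>?B. (\<lambda>x. fs_cinner f e * fun_of e x))"
      using f(1) fun_of_lincomb[of "\<lambda>e. fs_cinner f e" ?B] by simp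
    also have "\<dots> \<in> cfun.span (fun_of ` ?B)"
      by (intro cfun.span_sum cfun.span_scale cfun.span_base) auto
    finally show "f' \<in> cfun.span (fun_of ` ?B)" .
  qed
  show "cfun.span (fun_of ` ?B) \<subseteq> fs_eigenspace Loc (of_real m)"
  proof (rule cfun.span_minimal)
    show "fun_of ` ?B \<subseteq> fs_eigenspace Loc (of_real m)"
      using F by (auto simp: eigenspace_eq eigensystem_def fs_scale_of_real)
    show "cfun.subspace (fs_eigenspace Loc (of_real m))"
    proof (rule cfun.subspaceI)
      show "0 \<in> fs_eigenspace Loc (of_real m)"
        unfolding eigenspace_eq
        by (rule image_eqI[of _ _ 0])
          (auto simp: fun_eq_iff bounded_linear.linear[OF bounded_linear_fs_op, THEN linear_0] intro: fs_eqI)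
    next
      fix x y assume "x \<in> fs_eigenspace Loc (of_real m)" "y \<in> fs_eigenspace Loc (of_real m)"
      then obtain f g where fg: "x = fun_of f" "y = fun_of g" "T f = fs_scale (of_real m) f" "T g = fs_scale (of_real m) g"
        unfolding eigenspace_eq by blast
      have "x + y = fun_of (f + g)" by (simp add: fg fun_eq_iff)
      moreover have "T (f + g) = fs_scale (of_real m) (f + g)"
        by (rule fs_eqI) (simp add: fs_op_add fg distrib_left)
      ultimately show "x + y \<in> fs_eigenspace Loc (of_real m)" unfolding eigenspace_eq by blast
    next
      fix c x assume "x \<in> fs_eigenspace Loc (of_real m)"
      then obtain f where f: "x = fun_of f" "T f = fs_scale (of_real m) f"
        unfolding eigenspace_eq by blast
      have "(\<lambda>t. c * x t) = fun_of (fs_scale c f)" by (simp add: f fun_eq_iff)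
      moreover have "T (fs_scale c f) = fs_scale (of_real m) (fs_scale c f)"
        by (simp add: fs_op_scale f fs_scale_scale mult.commute)
      ultimately show "(\<lambda>t. c * x t) \<in> fs_eigenspace Loc (of_real m)" unfolding eigenspace_eq by blast
    qed
  qed
qed

lemma eigensystem_multiplicity:
  assumes F: "eigensystem \<epsilon> F" and m: "m \<ge> \<epsilon>" "m > 0"
    and max: "\<And>G. eigensystem \<epsilon> G \<Longrightarrow> card G \<le> card F"
  shows "fs_multiplicity Loc (of_real m) = card {e \<in> F. E e = m}"
proof -
  let ?B = "{e \<in> F. E e = m}"
  have "cfun.independent (fun_of ` ?B)"
    using F by (intro fs_orthonormal_independent) (auto simp: eigensystem_def fs_orthonormal_def)
  then have "cfun.dim (cfun.span (fun_of ` ?B)) = card (fun_of ` ?B)"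
    by (rule cfun.dim_span_eq_card_independent)
  also have "\<dots> = card ?B" by (intro card_image) (simp add: inj_on_def fun_of_inject)
  finally have "cfun.dim (cfun.span (fun_of ` ?B)) = card ?B" .
  moreover have "fs_eigenspace Loc (of_real m) = cfun.span (fun_of ` ?B)"
    by (rule eigensystem_eigenspace[OF F m]) (rule max)
  ultimately show ?thesis by (simp add: fs_multiplicity_def)
qed

lemma eigenvalue_finite_multiplicity:
  assumes \<mu>: "\<mu> \<in> fs_eigenvalues Loc" "\<mu> \<noteq> 0"
  shows "fs_finite_multiplicity Loc \<mu>"
proof -
  define m where "m = Re \<mu>"
  have \<mu>m: "\<mu> = of_real m" using eigenvalue_real_nonneg(1)[OF \<mu>(1)] by (simp add: m_def)
  have "m \<noteq> 0" using \<mu>(2) \<mu>m by auto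
  moreover have "m \<ge> 0" unfolding m_def by (rule eigenvalue_real_nonneg(2)[OF \<mu>(1)])
  ultimately have m: "m > 0" by simp
  obtain F where F: "eigensystem m F"
    "\<And>G. eigensystem m G \<Longrightarrow> card G \<le> card F"
    using maximal_eigensystem[OF m] by blast
  have "fs_eigenspace Loc \<mu> = cfun.span (fun_of ` {e \<in> F. E e = m})"
    unfolding \<mu>m by (rule eigensystem_eigenspace[OF F(1) order_refl m F(2)])
  moreover have "finite (fun_of ` {e \<in> F. E e = m})" using F(1) by (simp add: eigensystem_def)
  ultimately show ?thesis unfolding fs_finite_multiplicity_def by blast
qed

text \<open>A maximal family realises each eigenvalue from \<open>\<epsilon>\<close> upwards as
  often as its multiplicity, so grouping its members by energy turns the sum over eigenvalues into
  the sum over \<open>F\<close>.\<close>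

lemma large_eigenvalues_sum:
  assumes \<epsilon>: "\<epsilon> > 0"
  defines "S \<equiv> {\<mu> \<in> fs_eigenvalues Loc. Re \<mu> \<ge> \<epsilon>}"
  shows "finite S" "(\<Sum>\<mu>\<in>S. real (fs_multiplicity Loc \<mu>) * (Re \<mu>)^2) \<le> window_trace"
    "window_trace - \<epsilon> * window_mass \<le> (\<Sum>\<mu>\<in>S. real (fs_multiplicity Loc \<mu>) * (Re \<mu>)^2)"
proof -
  obtain F where F: "eigensystem \<epsilon> F"
    "\<And>G. eigensystem \<epsilon> G \<Longrightarrow> card G \<le> card F"
    using maximal_eigensystem[OF \<epsilon>] by blast
  have finF: "finite F" using F(1) by (simp add: eigensystem_def)
  have S_eq: "S = of_real ` (E ` F)"
  proof (intro equalityI subsetI)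
    fix \<mu> assume "\<mu> \<in> S"
    then have \<mu>: "\<mu> \<in> fs_eigenvalues Loc" "Re \<mu> \<ge> \<epsilon>" by (auto simp: S_def)
    then obtain f where f: "f \<noteq> 0" "T f = fs_scale \<mu> f" using eigenvalues_iff by blast
    have r: "\<mu> = of_real (Re \<mu>)" by (rule eigenvalue_real_nonneg[OF \<mu>(1)])
    have "T f = Re \<mu> *\<^sub>R f" unfolding fs_scale_of_real r[symmetric] by (rule f(2))
    then obtain e where e: "e \<in> F" "fs_cinner f e \<noteq> 0"
      using maximal_eigensystem_eigenvector[OF F \<mu>(2), of f] f(1) by blast
    have "\<mu> = of_real (E e)"
      using eigensystem_form[OF F(1) e(1), of f] fs_cinner_op[OF borel_window, of f e] e(2)
      by (simp add: f(2) fs_form_scale_left)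
    with e(1) show "\<mu> \<in> of_real ` (E ` F)" by blast
  next
    fix \<mu> :: complex assume "\<mu> \<in> of_real ` (E ` F)"
    then obtain e where e: "e \<in> F" "\<mu> = of_real (E e)" by blast
    then have "E e \<ge> \<epsilon>" "T e = fs_scale \<mu> e" using F(1) by (auto simp: eigensystem_def fs_scale_of_real)
    moreover have "e \<noteq> 0"
    proof
      have "fs_cinner e e = 1" using e(1) F(1) by (simp add: eigensystem_def fs_orthonormal_def)
      moreover assume "e = 0"
      ultimately show False by simp
    qed
    ultimately show "\<mu> \<in> S" using e(2) by (auto simp: S_def eigenvalues_iff)
  qed
  then show "finite S" using finF by simp
  have "(\<Sum>\<mu>\<in>S. real (fs_multiplicity Loc \<mu>) * (Re \<mu>)^2)
      = (\<Sum>m\<in>E ` F. real (fs_multiplicity Loc (of_real m)) * m^2)"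
    unfolding S_eq by (subst sum.reindex) (auto simp: inj_on_def)
  also have "\<dots> = (\<Sum>m\<in>E ` F. \<Sum>e\<in>{e \<in> F. E e = m}. (E e)^2)"
  proof (intro sum.cong refl)
    fix m assume "m \<in> E ` F"
    then have "m \<ge> \<epsilon>" using F(1) by (auto simp: eigensystem_def)
    then show "real (fs_multiplicity Loc (of_real m)) * m^2 = (\<Sum>e\<in>{e \<in> F. E e = m}. (E e)^2)"
      using eigensystem_multiplicity[OF F(1) \<open>m \<ge> \<epsilon>\<close> less_le_trans[OF \<epsilon> \<open>m \<ge> \<epsilon>\<close>]] F(2) by simp
  qed
  also have "\<dots> = (\<Sum>e\<in>F. (E e)^2)"
    by (rule sum.image_gen[OF finF, symmetric])
  finally have eq: "(\<Sum>\<mu>\<in>S. real (fs_multiplicity Loc \<mu>) * (Re \<mu>)^2) = (\<Sum>e\<in>F. (E e)^2)" .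
  show "(\<Sum>\<mu>\<in>S. real (fs_multiplicity Loc \<mu>) * (Re \<mu>)^2) \<le> window_trace"
    unfolding eq by (rule eigensystem_sum_le[OF F(1)])
  show "window_trace - \<epsilon> * window_mass \<le> (\<Sum>\<mu>\<in>S. real (fs_multiplicity Loc \<mu>) * (Re \<mu>)^2)"
    unfolding eq by (rule maximal_eigensystem_sum_ge[OF F(1,2) \<epsilon>])
qed

text \<open>All terms are nonnegative. Finite partial sums stay below the trace, and those
  containing every eigenvalue from \<open>\<epsilon>\<close> upwards miss it by at most
  \<open>\<epsilon> * window_mass\<close>.\<close>

theorem eigenvalue_squares_has_sum:
  "((\<lambda>\<mu>. of_nat (fs_multiplicity Loc \<mu>) * \<mu>^2) has_sum of_real window_trace) (fs_eigenvalues Loc)"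
proof -
  let ?h = "\<lambda>\<mu>. real (fs_multiplicity Loc \<mu>) * (Re \<mu>)^2"
  let ?S = "\<lambda>\<epsilon>. {\<mu> \<in> fs_eigenvalues Loc. Re \<mu> \<ge> \<epsilon>}"
  have upper: "sum ?h Y \<le> window_trace" if Y: "finite Y" "Y \<subseteq> fs_eigenvalues Loc" for Y
  proof -
    \<comment> \<open>The eigenvalue 0 contributes nothing, whatever value
      \<open>fs_multiplicity\<close> takes there. The other members of the finite set have a
      positive lower bound.\<close>
    define Y' where "Y' = {\<mu> \<in> Y. Re \<mu> \<noteq> 0}"
    have Y': "finite Y'" using Y by (simp add: Y'_def)
    \<comment> \<open>The inserted 1 keeps the minimum defined and positive when \<open>Y'\<close>
      is empty.\<close>
    define \<epsilon> where "\<epsilon> = Min (insert 1 (Re ` Y'))"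
    have pos: "Re \<mu> > 0" if "\<mu> \<in> Y'" for \<mu>
      using that Y(2) eigenvalue_real_nonneg(2)[of \<mu>] by (auto simp: Y'_def)
    have \<epsilon>: "\<epsilon> > 0" using Y' pos by (auto simp: \<epsilon>_def)
    have "Y' \<subseteq> ?S \<epsilon>" using Y' Y(2) by (auto simp: Y'_def \<epsilon>_def)
    have "sum ?h Y = sum ?h Y'" using Y by (intro sum.mono_neutral_right) (auto simp: Y'_def)
    also have "\<dots> \<le> sum ?h (?S \<epsilon>)"
      by (intro sum_mono2 large_eigenvalues_sum(1)[OF \<epsilon>] \<open>Y' \<subseteq> ?S \<epsilon>\<close>) auto
    also have "\<dots> \<le> window_trace" by (rule large_eigenvalues_sum(2)[OF \<epsilon>])
    finally show ?thesis .
  qed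
  have "(?h has_sum window_trace) (fs_eigenvalues Loc)"
    unfolding has_sum_def
  proof (rule tendstoI)
    fix e :: real assume e: "e > 0"
    define \<epsilon> where "\<epsilon> = e / (2 * (window_mass + 1))"
    have \<epsilon>: "\<epsilon> > 0" using e window_mass_nonneg by (simp add: \<epsilon>_def)
    have small: "\<epsilon> * window_mass < e"
    proof -
      have "\<epsilon> * window_mass \<le> \<epsilon> * (window_mass + 1)" using \<epsilon> by simp
      also have "\<dots> = e / 2" using window_mass_nonneg by (simp add: \<epsilon>_def divide_simps)
      finally show ?thesis using e by simp
    qed
    show "\<forall>\<^sub>F Y in finite_subsets_at_top (fs_eigenvalues Loc). dist (sum ?h Y) window_trace < e"
      unfolding eventually_finite_subsets_at_top
    proof (intro exI[of _ "?S \<epsilon>"] conjI allI impI)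
      show "finite (?S \<epsilon>)" by (rule large_eigenvalues_sum(1)[OF \<epsilon>])
      fix Y assume Y: "finite Y \<and> ?S \<epsilon> \<subseteq> Y \<and> Y \<subseteq> fs_eigenvalues Loc"
      have "window_trace - \<epsilon> * window_mass \<le> sum ?h (?S \<epsilon>)" by (rule large_eigenvalues_sum(3)[OF \<epsilon>])
      also have "\<dots> \<le> sum ?h Y" using Y by (intro sum_mono2) auto
      finally show "dist (sum ?h Y) window_trace < e"
        using upper[of Y] Y small by (simp add: dist_real_def)
    qed auto
  qed
  then have "((\<lambda>\<mu>. complex_of_real (?h \<mu>)) has_sum of_real window_trace) (fs_eigenvalues Loc)"
    by (rule has_sum_of_real)
  then show ?thesis
  proof (rule has_sum_cong[THEN iffD1, rotated])
    fix \<mu> assume "\<mu> \<in> fs_eigenvalues Loc"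
    then have "complex_of_real (Re \<mu>) = \<mu>" by (rule eigenvalue_real_nonneg(1)[symmetric])
    then show "complex_of_real (?h \<mu>) = of_nat (fs_multiplicity Loc \<mu>) * \<mu>^2"
      by (simp only: of_real_mult of_real_of_nat_eq of_real_power)
  qed
qed

end

section \<open>Approximation of the reproducing kernel\<close>

definition peak_freq :: "real \<Rightarrow> real" where
  "peak_freq t = sqrt (2 + t^2)"

definition peak :: "real \<Rightarrow> real \<Rightarrow> real" where
  "peak t x = pi / peak_freq t * exp (- 2 * pi * peak_freq t * \<bar>x - t\<bar>)"

lemma peak_freq_square: "(peak_freq t)^2 = 2 + t^2"
  by (simp add: peak_freq_def add_nonneg_nonneg)

lemma peak_freq_ge_one: "peak_freq t \<ge> 1"
  by (simp add: peak_freq_def real_le_rsqrt)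

lemma peak_freq_pos: "peak_freq t > 0"
  using peak_freq_ge_one[of t] by simp

lemma abs_le_peak_freq: "\<bar>t\<bar> \<le> peak_freq t"
  unfolding peak_freq_def by (rule real_le_rsqrt) simp

lemma peak_freq_le: "peak_freq t \<le> \<bar>t\<bar> + 2"
  unfolding peak_freq_def by (rule real_le_lsqrt) (simp_all add: power2_eq_square algebra_simps)

lemma has_bochner_integral_exp_abs_shift:
  fixes c t :: real
  assumes c: "c > 0"
  shows "has_bochner_integral lborel (\<lambda>x. exp (- c * \<bar>x - t\<bar>)) (2 / c)"
proof -
  have "has_bochner_integral lborel (\<lambda>x. Re (complex_of_real (exp (- c * \<bar>x\<bar>)) * cis (0 * x))) (Re (complex_of_real (2 * c / (c^2 + 0^2))))"
    by (rule has_bochner_integral_Re[OF has_bochner_integral_exp_abs_cis[OF c]])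
  then have "has_bochner_integral lborel (\<lambda>x. exp (- c * \<bar>x\<bar>)) (2 / c)"
    using c by (simp add: power2_eq_square)
  then have "has_bochner_integral lborel (\<lambda>x. exp (- c * \<bar>- t + 1 * x\<bar>)) (2 / c /\<^sub>R \<bar>1\<bar>)"
    by (subst (asm) lborel_has_bochner_integral_real_affine_iff[of 1 _ _ "- t"]) auto
  then show ?thesis by (simp add: add.commute)
qed

lemma fourier_peak: "fourier (\<lambda>x. of_real (peak t x)) \<xi> = cis (- 2 * pi * t * \<xi>) / of_real (2 + t^2 + \<xi>^2)"
proof -
  let ?w = "peak_freq t"
  have w: "?w > 0" by (rule peak_freq_pos)
  have "fourier (\<lambda>x. of_real (peak t x)) \<xi> = (LINT x|lborel. of_real (peak t (t + 1 * x)) * cis (- 2 * pi * \<xi> * (t + 1 * x)))"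
    unfolding fourier_eq_cis by (subst lborel_integral_real_affine[of 1 _ t]) simp_all
  also have "\<dots> = (LINT x|lborel. (of_real (pi / ?w) * cis (- 2 * pi * t * \<xi>))
      * (of_real (exp (- (2 * pi * ?w) * \<bar>x\<bar>)) * cis ((- 2 * pi * \<xi>) * x)))"
  proof (intro Bochner_Integration.integral_cong refl)
    fix x
    have "cis (- 2 * pi * \<xi> * (t + 1 * x)) = cis (- 2 * pi * t * \<xi>) * cis ((- 2 * pi * \<xi>) * x)"
      by (simp add: cis_mult algebra_simps)
    then show "of_real (peak t (t + 1 * x)) * cis (- 2 * pi * \<xi> * (t + 1 * x))
      = (of_real (pi / ?w) * cis (- 2 * pi * t * \<xi>)) * (of_real (exp (- (2 * pi * ?w) * \<bar>x\<bar>)) * cis ((- 2 * pi * \<xi>) * x))"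
      by (simp add: peak_def mult_ac)
  qed
  also have "\<dots> = (of_real (pi / ?w) * cis (- 2 * pi * t * \<xi>))
      * of_real (2 * (2 * pi * ?w) / ((2 * pi * ?w)^2 + (- 2 * pi * \<xi>)^2))"
    unfolding integral_mult_right_zero
    using w by (subst has_bochner_integral_integral_eq[OF has_bochner_integral_exp_abs_cis]) simp_all
  also have "\<dots> = cis (- 2 * pi * t * \<xi>) * of_real (pi / ?w * (2 * (2 * pi * ?w) / ((2 * pi * ?w)^2 + (- 2 * pi * \<xi>)^2)))"
    by (simp only: of_real_mult mult_ac)
  also have "pi / ?w * (2 * (2 * pi * ?w) / ((2 * pi * ?w)^2 + (- 2 * pi * \<xi>)^2)) = 1 / (2 + t^2 + \<xi>^2)"
  proof -
    have "(2 * pi * ?w)^2 + (- 2 * pi * \<xi>)^2 = 4 * pi^2 * (2 + t^2 + \<xi>^2)"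
      by (simp add: power_mult_distrib peak_freq_square algebra_simps)
    then show ?thesis using w by (simp add: power2_eq_square)
  qed
  finally show ?thesis by (simp add: divide_inverse of_real_inverse)
qed

text \<open>The square is first bounded at half the rate, by \<open>exp (pi * z)\<close>, so that
  squaring gives the fourth power at the full rate.\<close>

lemma power_le_exp_two_pi:
  assumes z: "(z::real) \<ge> 0"
  shows "z \<le> exp (2 * pi * z)" "z^2 \<le> exp (2 * pi * z)" "z ^ 4 \<le> exp (2 * pi * z)"
proof -
  have pi: "pi > 3" using pi_gt3 by simp
  have q: "z^2 \<le> exp (pi * z)"
  proof -
    have "3 * z \<le> pi * z" using pi z by (intro mult_right_mono) auto
    then have "(3 * z)^2 \<le> (pi * z)^2" using z by (intro power_mono) auto
    then have "9 * z^2 \<le> (pi * z)^2" by simp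
    then have "z^2 \<le> (pi * z)^2 / 2" using zero_le_power2[of z] by linarith
    also have "\<dots> \<le> exp (pi * z)"
    proof -
      have "0 \<le> pi * z" using z by simp
      with exp_lower_Taylor_quadratic[of "pi * z"] show ?thesis by linarith
    qed
    finally show ?thesis .
  qed
  have mono: "exp (pi * z) \<le> exp (2 * pi * z)" using z pi by simp
  show "z^2 \<le> exp (2 * pi * z)" using q mono by linarith
  have "z \<le> 1 + pi * z" using z pi mult_right_mono[of 1 pi z] by simp
  also have "\<dots> \<le> exp (pi * z)" by (rule exp_ge_add_one_self)
  finally show "z \<le> exp (2 * pi * z)" using mono by linarith
  have "z ^ 4 = (z^2)^2" by simp
  also have "\<dots> \<le> (exp (pi * z))^2" using q by (intro power_mono) auto
  also have "\<dots> = exp (2 * pi * z)" by (simp add: exp_double[symmetric] mult.assoc)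
  finally show "z ^ 4 \<le> exp (2 * pi * z)" .
qed

lemma peak_square: "(peak t x)^2 = pi^2 / (2 + t^2) * (exp (- 2 * pi * peak_freq t * \<bar>x - t\<bar>))^2"
  by (simp add: peak_def power_mult_distrib power_divide peak_freq_square)

text \<open>Spends one of the two factors \<open>exp (- 2 pi w |x - t|)\<close> of \<open>(peak t x)\<^sup>2\<close> on a polynomial weight.\<close>
lemma peak_square_weight_le:
  assumes "0 \<le> v" "v \<le> C * exp (2 * pi * (peak_freq t * \<bar>x - t\<bar>))"
  shows "(peak t x)^2 * v \<le> C * pi^2 / (2 + t^2) * exp (- 2 * pi * peak_freq t * \<bar>x - t\<bar>)"
proof -
  let ?z = "2 * pi * (peak_freq t * \<bar>x - t\<bar>)"
  have "(peak t x)^2 * v \<le> (peak t x)^2 * (C * exp ?z)"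
    by (intro mult_left_mono assms) simp
  also have "\<dots> = C * pi^2 / (2 + t^2) * (exp (- ?z) * (exp (- ?z) * exp ?z))"
  proof -
    have "(peak t x)^2 = pi^2 / (2 + t^2) * (exp (- ?z) * exp (- ?z))"
      unfolding peak_square by (simp only: power2_eq_square[of "exp _"] mult.assoc mult_minus_left)
    then show ?thesis by (simp only: times_divide_eq_left times_divide_eq_right mult_ac)
  qed
  also have "exp (- ?z) * exp ?z = 1" by (simp flip: exp_add)
  finally show ?thesis by (simp add: mult_ac)
qed

text \<open>The exponential left over by \<open>peak_square_weight_le\<close> has integral
  \<open>1 / (pi * w)\<close> for \<open>w = peak_freq t\<close>; together with
  \<open>pi^2 / w^2\<close> this gives \<open>pi / w^3\<close>.\<close>

lemma peak_square_weight_integral: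
  assumes [measurable]: "v \<in> borel_measurable borel" and v: "\<And>x. 0 \<le> v x"
    "\<And>x. v x \<le> C * exp (2 * pi * (peak_freq t * \<bar>x - t\<bar>))"
  shows "integrable lborel (\<lambda>x. (peak t x)^2 * v x)"
    and "(LINT x|lborel. (peak t x)^2 * v x) \<le> C * pi / peak_freq t ^ 3"
proof -
  let ?w = "peak_freq t"
  have w: "?w > 0" by (rule peak_freq_pos)
  have h: "has_bochner_integral lborel (\<lambda>x. C * pi^2 / (2 + t^2) * exp (- (2 * pi * ?w) * \<bar>x - t\<bar>))
      (C * pi^2 / (2 + t^2) * (2 / (2 * pi * ?w)))"
    using w by (intro has_bochner_integral_mult_right has_bochner_integral_exp_abs_shift) simp
  have le: "(peak t x)^2 * v x \<le> C * pi^2 / (2 + t^2) * exp (- (2 * pi * ?w) * \<bar>x - t\<bar>)" for x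
    using peak_square_weight_le[OF v] by simp
  have nn: "0 \<le> (peak t x)^2 * v x" for x using v(1) by simp
  show i: "integrable lborel (\<lambda>x. (peak t x)^2 * v x)"
  proof (rule Bochner_Integration.integrable_bound[OF integrable.intros[OF h]])
    show "AE x in lborel. norm ((peak t x)^2 * v x) \<le> norm (C * pi^2 / (2 + t^2) * exp (- (2 * pi * ?w) * \<bar>x - t\<bar>))"
      using le nn by (intro AE_I2) (metis abs_of_nonneg order_trans real_norm_def abs_ge_self)
  qed (simp add: peak_def)
  have "(LINT x|lborel. (peak t x)^2 * v x) \<le> (LINT x|lborel. C * pi^2 / (2 + t^2) * exp (- (2 * pi * ?w) * \<bar>x - t\<bar>))"
    by (intro integral_mono i integrable.intros[OF h] le)
  also have "\<dots> = C * pi^2 / (2 + t^2) * (2 / (2 * pi * ?w))" by (rule has_bochner_integral_integral_eq[OF h])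
  also have "\<dots> = C * pi / ?w ^ 3"
    unfolding peak_freq_square[symmetric] by (simp add: power2_eq_square power3_eq_cube)
  finally show "(LINT x|lborel. (peak t x)^2 * v x) \<le> C * pi / ?w ^ 3" .
qed

text \<open>Factor into \<open>x - t\<close> and \<open>(x - t) + 2 * t\<close>. As
  \<open>peak_freq t\<close> is at least 1 and at least \<open>\<bar>t\<bar>\<close>, the product is
  at most \<open>z^2 + 2 * z\<close> with \<open>z = peak_freq t * \<bar>x - t\<bar>\<close>; hence
  the constant 3.\<close>

lemma abs_diff_square_le: "\<bar>x^2 - t^2\<bar> \<le> 3 * exp (2 * pi * (peak_freq t * \<bar>x - t\<bar>))"
proof -
  let ?w = "peak_freq t"
  define z where "z = ?w * \<bar>x - t\<bar>"
  have w: "?w \<ge> 1" by (rule peak_freq_ge_one)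
  have z: "z \<ge> 0" using w by (simp add: z_def)
  have xt: "\<bar>x - t\<bar> \<le> z" using w mult_right_mono[of 1 ?w "\<bar>x - t\<bar>"] by (simp add: z_def)
  have "x^2 - t^2 = (x - t) * ((x - t) + 2 * t)" by (simp add: power2_eq_square algebra_simps)
  then have "\<bar>x^2 - t^2\<bar> = \<bar>x - t\<bar> * \<bar>(x - t) + 2 * t\<bar>" by (simp only: abs_mult)
  also have "\<dots> \<le> \<bar>x - t\<bar> * (\<bar>x - t\<bar> + 2 * ?w)"
    using abs_le_peak_freq[of t] by (intro mult_left_mono) auto
  also have "\<dots> = \<bar>x - t\<bar> * \<bar>x - t\<bar> + 2 * z" by (simp add: z_def algebra_simps)
  also have "\<dots> \<le> z^2 + 2 * z" using mult_mono[OF xt xt z] by (simp add: power2_eq_square)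
  also have "\<dots> \<le> 3 * exp (2 * pi * z)" using power_le_exp_two_pi[OF z] by linarith
  finally show ?thesis by (simp add: z_def)
qed

lemma peak_continuous: "continuous_on UNIV (peak t)"
  unfolding peak_def by (intro continuous_intros)

lemma peak_measurable [measurable]: "peak t \<in> borel_measurable borel"
  by (rule borel_measurable_continuous_onI[OF peak_continuous])

lemma peak_fourier_sobolev: "(\<lambda>x. complex_of_real (peak t x)) \<in> fourier_sobolev"
proof -
  have "integrable lborel (\<lambda>x. (peak t x)^2 * (1 + x^2))"
  \<comment> \<open>The constant comes from splitting \<open>1 + x^2\<close> as
    \<open>(1 + t^2) + (x^2 - t^2)\<close> and adding the 3 of
    \<open>abs_diff_square_le\<close>.\<close>
  proof (rule peak_square_weight_integral(1)[where C = "4 + t^2"])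
    fix x
    let ?e = "exp (2 * pi * (peak_freq t * \<bar>x - t\<bar>))"
    have "x^2 - t^2 \<le> 3 * ?e" using abs_diff_square_le[of x t] by linarith
    moreover have "(1 + t^2) * 1 \<le> (1 + t^2) * ?e"
      using peak_freq_pos[of t] by (intro mult_left_mono) auto
    ultimately show "1 + x^2 \<le> (4 + t^2) * ?e" by (simp add: algebra_simps)
  qed auto
  moreover have "integrable lborel (\<lambda>\<xi>. (cmod (fourier (\<lambda>x. of_real (peak t x)) \<xi>))^2 * (1 + \<xi>^2))"
  proof (rule Bochner_Integration.integrable_bound[OF integrable_inverse_one_plus_square])
    show "AE \<xi> in lborel. norm ((cmod (fourier (\<lambda>x. of_real (peak t x)) \<xi>))^2 * (1 + \<xi>^2)) \<le> norm (1 / (1 + \<xi>^2))"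
    proof (rule AE_I2)
      fix \<xi> :: real
      have pos: "0 < 1 + \<xi>^2" by (simp add: add_pos_nonneg)
      have "0 < 2 + t^2 + \<xi>^2" by (simp add: add_pos_nonneg)
      then have c: "cmod (fourier (\<lambda>x. of_real (peak t x)) \<xi>) = 1 / (2 + t^2 + \<xi>^2)"
        unfolding fourier_peak norm_divide by (simp del: of_real_add)
      have "1 / (2 + t^2 + \<xi>^2) \<le> 1 / (1 + \<xi>^2)" using pos by (intro divide_left_mono) (auto intro!: mult_pos_pos add_pos_nonneg)
      then have "(1 / (2 + t^2 + \<xi>^2))^2 \<le> (1 / (1 + \<xi>^2))^2" by (intro power_mono) auto
      then have "(1 / (2 + t^2 + \<xi>^2))^2 * (1 + \<xi>^2) \<le> (1 / (1 + \<xi>^2))^2 * (1 + \<xi>^2)"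
        using pos by (intro mult_right_mono) auto
      also have "\<dots> = 1 / (1 + \<xi>^2)" using pos by (simp add: power2_eq_square)
      finally show "norm ((cmod (fourier (\<lambda>x. of_real (peak t x)) \<xi>))^2 * (1 + \<xi>^2)) \<le> norm (1 / (1 + \<xi>^2))"
        unfolding c using pos by simp
    qed
    have "(\<lambda>\<xi>. (cmod (cis (- 2 * pi * t * \<xi>) / of_real (2 + t^2 + \<xi>^2)))^2 * (1 + \<xi>^2)) \<in> borel_measurable borel"
      by measurable
    then show "(\<lambda>\<xi>. (cmod (fourier (\<lambda>x. of_real (peak t x)) \<xi>))^2 * (1 + \<xi>^2)) \<in> borel_measurable lborel"
      unfolding fourier_peak measurable_lborel1 measurable_lborel2 .
  qed
  ultimately show ?thesis
    using peak_continuous[of t] by (auto simp: fourier_sobolev_def intro!: continuous_on_of_real)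
qed

section \<open>Distance between the peak and the reproducing kernel\<close>

definition fs_peak :: "real \<Rightarrow> fs_space" where
  "fs_peak t = Abs_fs (\<lambda>x. of_real (peak t x))"

lemma fun_of_peak: "fun_of (fs_peak t) = (\<lambda>x. of_real (peak t x))"
  unfolding fs_peak_def by (rule Abs_fs_inverse[OF peak_fourier_sobolev])

text \<open>The peak is a fundamental solution of the operator with the potential \<open>x\<^sup>2\<close> frozen at \<open>t\<close>; the
  integral is the error made by freezing it.\<close>
lemma fs_cinner_peak:
  "fs_cinner f (fs_peak t) = fun_of f t + (LINT x|lborel. fun_of f x * of_real (peak t x) * of_real (x^2 - t^2))"
proof -
  let ?f = "fun_of f" and ?u = "\<lambda>x. complex_of_real (peak t x)"
  note Df = fourier_sobolevD[OF fun_of[of f]] and Du = fourier_sobolevD[OF peak_fourier_sobolev[of t]]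
  have L2: "?f \<in> weighted_L2" "fourier ?f \<in> weighted_L2" "?u \<in> weighted_L2" "fourier ?u \<in> weighted_L2"
    using weighted_L2_fun_of[of f] weighted_L2_fun_of[of "fs_peak t"] by (simp_all add: fun_of_peak)
  have i1: "integrable lborel (\<lambda>x. ?f x * cnj (?u x) * of_real (1 + x^2))"
    and i2: "integrable lborel (\<lambda>x. fourier ?f x * cnj (fourier ?u x) * of_real (1 + x^2))"
    using weighted_inner_integrable[OF L2(1,3), of UNIV] weighted_inner_integrable[OF L2(2,4), of UNIV]
    by (simp_all add: set_integrable_def)
  \<comment> \<open>The two weights add up to \<open>2 + t^2 + \<xi>^2\<close>, the denominator in
    \<open>fourier_peak\<close>, which leaves the integrand of the inverse transform.\<close>
  have eq: "fourier ?f \<xi> * cnj (fourier ?u \<xi>) * of_real (1 + \<xi>^2) + of_real (1 + t^2) * (fourier ?f \<xi> * cnj (fourier ?u \<xi>))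
      = fourier ?f \<xi> * cis (2 * pi * t * \<xi>)" for \<xi>
  proof -
    have nz: "2 + t^2 + \<xi>^2 \<noteq> 0" by (smt (verit) zero_le_power2)
    have "cnj (fourier ?u \<xi>) = cis (2 * pi * t * \<xi>) / of_real (2 + t^2 + \<xi>^2)"
      unfolding fourier_peak by (simp add: cis_cnj)
    then have "cnj (fourier ?u \<xi>) * of_real (2 + t^2 + \<xi>^2) = cis (2 * pi * t * \<xi>)"
      using nz by (simp del: of_real_add)
    then have "fourier ?f \<xi> * cis (2 * pi * t * \<xi>) = fourier ?f \<xi> * (cnj (fourier ?u \<xi>) * of_real ((1 + \<xi>^2) + (1 + t^2)))"
      by (simp add: algebra_simps)
    then show ?thesis by (simp add: algebra_simps)
  qed
  have fu: "integrable lborel (\<lambda>x. fourier ?f x * cnj (fourier ?u x))" "integrable lborel (\<lambda>x. ?f x * cnj (?u x))"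
  proof -
    have "integrable lborel (\<lambda>x. g x * cnj (h x))"
      if g: "g \<in> weighted_L2" and h: "h \<in> weighted_L2" for g h
    proof (rule Bochner_Integration.integrable_bound)
      have [measurable]: "g \<in> borel_measurable borel" "h \<in> borel_measurable borel"
        using g h by (auto simp: weighted_L2_def)
      show "integrable lborel (\<lambda>x. g x * cnj (h x) * of_real (1 + x^2))"
        using weighted_inner_integrable[OF g h, of UNIV] by (simp add: set_integrable_def)
      have "cmod (g x) * cmod (h x) * 1 \<le> cmod (g x) * cmod (h x) * \<bar>1 + x^2\<bar>" for x
        by (intro mult_left_mono) auto
      then show "AE x in lborel. norm (g x * cnj (h x)) \<le> norm (g x * cnj (h x) * of_real (1 + x^2))"
        by (intro AE_I2) (simp only: norm_mult norm_of_real complex_mod_cnj mult_1_right)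
      show "(\<lambda>x. g x * cnj (h x)) \<in> borel_measurable lborel" by measurable
    qed
    from this[OF L2(2,4)] this[OF L2(1,3)]
    show "integrable lborel (\<lambda>x. fourier ?f x * cnj (fourier ?u x))" "integrable lborel (\<lambda>x. ?f x * cnj (?u x))" .
  qed
  \<comment> \<open>Moves the term with factor \<open>1 + t^2\<close> to the space side, where
    subtracting it from the weight \<open>1 + x^2\<close> leaves \<open>x^2 - t^2\<close>.\<close>
  have parseval: "(LINT x|lborel. ?f x * cnj (?u x)) = (LINT \<xi>|lborel. fourier ?f \<xi> * cnj (fourier ?u \<xi>))"
    by (rule fourier_parseval[OF Df(5) Du(5,6,1)])
  have inv: "(LINT \<xi>|lborel. fourier ?f \<xi> * cis (2 * pi * t * \<xi>)) = ?f t"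
    using Df by (intro fourier_inversion) (auto simp: continuous_on_eq_continuous_at)
  have "(LINT \<xi>|lborel. fourier ?f \<xi> * cnj (fourier ?u \<xi>) * of_real (1 + \<xi>^2))
      + of_real (1 + t^2) * (LINT \<xi>|lborel. fourier ?f \<xi> * cnj (fourier ?u \<xi>)) = ?f t"
    unfolding inv[symmetric] eq[symmetric]
    by (subst Bochner_Integration.integral_add[OF i2 integrable_mult_right[OF fu(1)]]) simp
  then have second: "(LINT \<xi>|lborel. fourier ?f \<xi> * cnj (fourier ?u \<xi>) * of_real (1 + \<xi>^2))
      = ?f t - of_real (1 + t^2) * (LINT x|lborel. ?f x * cnj (?u x))"
    unfolding parseval by (simp add: algebra_simps)
  have "(LINT x|lborel. ?f x * of_real (peak t x) * of_real (x^2 - t^2))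
      = (LINT x|lborel. ?f x * cnj (?u x) * of_real (1 + x^2) - of_real (1 + t^2) * (?f x * cnj (?u x)))"
    by (intro Bochner_Integration.integral_cong) (simp_all add: algebra_simps)
  also have "\<dots> = (LINT x|lborel. ?f x * cnj (?u x) * of_real (1 + x^2)) - of_real (1 + t^2) * (LINT x|lborel. ?f x * cnj (?u x))"
    by (subst Bochner_Integration.integral_diff[OF i1 integrable_mult_right[OF fu(2)]]) simp
  finally have third: "(LINT x|lborel. ?f x * of_real (peak t x) * of_real (x^2 - t^2)) = \<dots>" .
  have "fs_cinner f (fs_peak t) = (LINT x|lborel. ?f x * cnj (?u x) * of_real (1 + x^2))
      + (LINT \<xi>|lborel. fourier ?f \<xi> * cnj (fourier ?u \<xi>) * of_real (1 + \<xi>^2))"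
    by (simp only: fs_form_def weighted_inner_def fun_of_peak set_lebesgue_integral_def indicator_UNIV scaleR_one)
  then show ?thesis unfolding second third by simp
qed

text \<open>Pairing the difference with itself leaves only the freezing error of
  \<open>fs_cinner_peak\<close>, an integral linear in the difference. Cauchy-Schwarz, with
  \<open>sqrt (1 + x^2)\<close> assigned to the difference, bounds it by the norm times
  \<open>sqrt D\<close>, and one norm cancels.\<close>

lemma fs_ker_minus_peak_norm: "(norm (fs_ker t - fs_peak t))^2 \<le> 10 * pi / peak_freq t ^ 5"
proof -
  let ?e = "fs_ker t - fs_peak t" and ?w = "peak_freq t"
  have w1: "?w \<ge> 1" by (rule peak_freq_ge_one)
  define a where "a = (\<lambda>x. cmod (fun_of ?e x) * sqrt (1 + x^2))"
  define b where "b = (\<lambda>x. peak t x * (\<bar>x^2 - t^2\<bar> / sqrt (1 + x^2)))"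
  define D where "D = (LINT x|lborel. (b x)^2)"
  note De = fourier_sobolevD[OF fun_of[of ?e]]
  have [measurable]: "fun_of ?e \<in> borel_measurable borel" by (rule De)
  have pos: "1 + x^2 > (0::real)" for x by (simp add: add_pos_nonneg)
  have a2: "(a x)^2 = (cmod (fun_of ?e x))^2 * (1 + x^2)" for x
    using pos[of x] by (simp add: a_def power_mult_distrib)
  define v where "v = (\<lambda>x. \<bar>x^2 - t^2\<bar>^2 / (1 + x^2))"
  have b2: "(b x)^2 = (peak t x)^2 * v x" for x
    using pos[of x] by (simp add: b_def v_def power_mult_distrib power_divide)
  \<comment> \<open>Division by \<open>1 + x^2\<close> absorbs the growth of
    \<open>(x + t)^2\<close>. The remaining \<open>(x - t)^2\<close> equals \<open>z^2 / w^2\<close>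
    with \<open>w = peak_freq t\<close>, which improves the decay from \<open>w^3\<close> to
    \<open>w^5\<close>.\<close>
  have v_le: "v x \<le> 10 / ?w^2 * exp (2 * pi * (?w * \<bar>x - t\<bar>))" for x
  proof -
    define z where "z = ?w * \<bar>x - t\<bar>"
    have z: "z \<ge> 0" using w1 by (simp add: z_def)
    have z2: "(x - t)^2 = z^2 / ?w^2" using w1 by (simp add: z_def power_mult_distrib)
    have "\<bar>x^2 - t^2\<bar>^2 = (x - t)^2 * (x + t)^2" by (simp add: power2_eq_square algebra_simps)
    also have "\<dots> \<le> (x - t)^2 * ((2 * (x - t)^2 + 8) * (1 + x^2))"
    proof (intro mult_left_mono)
      \<comment> \<open>The right side exceeds the left by exactly
        \<open>(3 * x - t)^2\<close>.\<close>
      have "(x + t)^2 \<le> 2 * (x - t)^2 + 8 * x^2"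
        using zero_le_power2[of "3 * x - t"] by (simp add: power2_eq_square algebra_simps)
      also have "\<dots> \<le> (2 * (x - t)^2 + 8) * (1 + x^2)"
        by (simp add: distrib_left distrib_right)
      finally show "(x + t)^2 \<le> (2 * (x - t)^2 + 8) * (1 + x^2)" .
    qed simp
    finally have "v x \<le> (x - t)^2 * (2 * (x - t)^2 + 8)"
      unfolding v_def using pos[of x] by (simp add: pos_divide_le_eq mult.assoc)
    also have "\<dots> = z^2 / ?w^2 * (2 * (z^2 / ?w^2) + 8)" unfolding z2 ..
    also have "\<dots> \<le> z^2 / ?w^2 * (2 * (z^2 / 1) + 8)"
      using w1 by (intro mult_left_mono add_right_mono divide_left_mono) (auto intro: mult_pos_pos one_le_power)
    also have "\<dots> = 1 / ?w^2 * (2 * z ^ 4 + 8 * z^2)" by (simp add: power2_eq_square power4_eq_xxxx field_simps)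
    also have "\<dots> \<le> 1 / ?w^2 * (10 * exp (2 * pi * z))"
      using power_le_exp_two_pi(2,3)[OF z] by (intro mult_left_mono) auto
    finally show ?thesis by (simp add: z_def)
  qed
  have v0: "v x \<ge> 0" for x using pos[of x] by (simp add: v_def)
  have [measurable]: "v \<in> borel_measurable borel" unfolding v_def by measurable
  note vi = peak_square_weight_integral[of v, OF _ v0 v_le]
  have D: "D \<le> 10 * pi / ?w ^ 5"
  proof -
    have "D = (LINT x|lborel. (peak t x)^2 * v x)" by (simp only: D_def b2)
    also have "\<dots> \<le> 10 / ?w^2 * pi / ?w ^ 3" by (rule vi(2)) simp
    also have "\<dots> = 10 * pi / ?w ^ 5" by (simp add: power_add[symmetric])
    finally show ?thesis .
  qed
  have "of_real ((norm ?e)^2) = fs_cinner ?e (fs_ker t) - fs_cinner ?e (fs_peak t)"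
    by (simp add: norm_fs_square fs_form_self[symmetric] fs_form_diff_right)
  also have "\<dots> = - (LINT x|lborel. fun_of ?e x * of_real (peak t x) * of_real (x^2 - t^2))"
    unfolding fs_cinner_ker fs_cinner_peak by simp
  finally have "cmod (of_real ((norm ?e)^2)) = cmod (LINT x|lborel. fun_of ?e x * of_real (peak t x) * of_real (x^2 - t^2))"
    by (simp only: norm_minus_cancel)
  then have "(norm ?e)^2 = cmod (LINT x|lborel. fun_of ?e x * of_real (peak t x) * of_real (x^2 - t^2))"
    by (simp add: norm_power)
  also have "\<dots> \<le> (LINT x|lborel. \<bar>a x * b x\<bar>)"
  proof -
    have "norm (fun_of ?e x * of_real (peak t x) * of_real (x^2 - t^2)) = \<bar>a x * b x\<bar>" for x
      using pos[of x] unfolding a_def b_def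
      by (simp only: norm_mult norm_of_real abs_mult abs_norm_cancel abs_divide abs_abs real_sqrt_abs) simp
    then show ?thesis using integral_norm_bound[of lborel "\<lambda>x. fun_of ?e x * of_real (peak t x) * of_real (x^2 - t^2)"] by simp
  qed
  finally have "((norm ?e)^2)^2 \<le> (LINT x|lborel. \<bar>a x * b x\<bar>)^2" by (intro power_mono) auto
  also have "\<dots> \<le> (LINT x|lborel. (a x)^2) * D"
    unfolding D_def
  proof (rule integral_cauchy_schwarz(2))
    show "a \<in> borel_measurable lborel" "b \<in> borel_measurable lborel"
      unfolding a_def b_def by measurable
    show "integrable lborel (\<lambda>x. (a x)^2)" unfolding a2 by (rule De(3))
    show "integrable lborel (\<lambda>x. (b x)^2)" unfolding b2 by (rule vi(1)) simp
  qed
  also have "\<dots> \<le> (norm ?e)^2 * D"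
    unfolding norm_fs_square fs_energy_def a2 set_lebesgue_integral_def
    by (intro mult_right_mono) (simp_all add: D_def)
  finally have le: "(norm ?e)^2 * (norm ?e)^2 \<le> D * (norm ?e)^2" by (simp add: power2_eq_square mult_ac)
  have "(norm ?e)^2 \<le> D"
  proof (cases "?e = 0")
    case True
    then show ?thesis by (simp add: D_def)
  next
    case False
    then have "(norm ?e)^2 > 0" by simp
    with le show ?thesis by (rule mult_right_le_imp_le)
  qed
  with D show ?thesis by simp
qed

text \<open>\<open>fs_cinner_peak\<close> at the peak itself: the value \<open>pi / w\<close> at the
  top, with \<open>w = peak_freq t\<close>, plus a freezing error of at most
  \<open>3 * pi / w^3\<close>.\<close>

lemma fs_peak_norm: "(norm (fs_peak t))^2 \<le> 4 * pi / peak_freq t"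
proof -
  let ?w = "peak_freq t"
  have w1: "?w \<ge> 1" by (rule peak_freq_ge_one)
  have "of_real ((norm (fs_peak t))^2) = fs_cinner (fs_peak t) (fs_peak t)"
    by (simp add: norm_fs_square fs_form_self)
  also have "\<dots> = of_real (peak t t) + (LINT x|lborel. of_real ((peak t x)^2 * (x^2 - t^2)))"
    unfolding fs_cinner_peak fun_of_peak by (simp add: power2_eq_square mult.assoc)
  finally have "(norm (fs_peak t))^2 = peak t t + (LINT x|lborel. (peak t x)^2 * (x^2 - t^2))"
    unfolding integral_complex_of_real of_real_add[symmetric] of_real_eq_iff .
  also have "(LINT x|lborel. (peak t x)^2 * (x^2 - t^2)) \<le> (LINT x|lborel. (peak t x)^2 * \<bar>x^2 - t^2\<bar>)"
  proof (rule integral_mono_AE')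
    show "integrable lborel (\<lambda>x. (peak t x)^2 * \<bar>x^2 - t^2\<bar>)"
      by (rule peak_square_weight_integral(1)[OF _ _ abs_diff_square_le]) auto
  qed (auto intro!: AE_I2 mult_left_mono)
  also have "\<dots> \<le> 3 * pi / ?w ^ 3"
    by (rule peak_square_weight_integral(2)[OF _ _ abs_diff_square_le]) auto
  also have "\<dots> \<le> 3 * pi / ?w"
    using w1 power_increasing[of 1 3 ?w] by (intro divide_left_mono) (auto intro!: mult_pos_pos)
  finally show ?thesis by (simp add: peak_def)
qed

text \<open>With \<open>w = peak_freq t\<close>, the squared norms of the peak and of the difference
  are of order \<open>1 / w\<close> and \<open>1 / w^5\<close>, so the cross term is of order
  \<open>1 / w^3\<close>. Order \<open>1 / w^2\<close> would already absorb the factor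
  \<open>1 + t^2\<close>.\<close>

lemma fs_energy_ker_peak:
  assumes IJ [simp]: "I \<in> sets borel" "J \<in> sets borel"
  shows "(1 + t^2) * \<bar>fs_energy I J (fs_ker t) - fs_energy I J (fs_peak t)\<bar> \<le> 24 * pi"
proof -
  let ?w = "peak_freq t"
  define e where "e = fs_peak t - fs_ker t"
  have w1: "?w \<ge> 1" by (rule peak_freq_ge_one)
  have e2: "(norm e)^2 \<le> 10 * pi / ?w ^ 5"
    using fs_ker_minus_peak_norm[of t] by (simp add: e_def norm_minus_commute)
  have "fs_energy I J (fs_ker t) = fs_energy I J (fs_peak t - e)" by (simp add: e_def)
  then have "fs_energy I J (fs_ker t) - fs_energy I J (fs_peak t) = - 2 * Re (fs_form I J (fs_peak t) e) + fs_energy I J e"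
    by (simp add: fs_energy_diff)
  then have "\<bar>fs_energy I J (fs_ker t) - fs_energy I J (fs_peak t)\<bar>
      \<le> 2 * cmod (fs_form I J (fs_peak t) e) + fs_energy I J e"
    using abs_Re_le_cmod[of "fs_form I J (fs_peak t) e"] fs_energy_nonneg[of I J e] by linarith
  also have "\<dots> \<le> 2 * (norm (fs_peak t) * norm e) + (norm e)^2"
    using norm_fs_form_le[OF IJ, of "fs_peak t" e] fs_energy_mono[OF IJ, of e] by (simp add: norm_fs_square)
  also have "\<dots> \<le> 2 * (7 * pi / ?w ^ 3) + 10 * pi / ?w ^ 3"
  proof (intro add_mono mult_left_mono)
    have "(norm (fs_peak t) * norm e)^2 \<le> (4 * pi / ?w) * (10 * pi / ?w ^ 5)"
      unfolding power_mult_distrib using w1 by (intro mult_mono fs_peak_norm e2) auto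
    also have "\<dots> = 40 * pi^2 / ?w ^ 6"
      by (simp add: power2_eq_square eval_nat_numeral mult_ac)
    \<comment> \<open>Rounds 40 up to a perfect square; the final 24 is
      \<open>2 * 7 + 10\<close>.\<close>
    also have "\<dots> \<le> 49 * pi^2 / ?w ^ 6" using w1 by (intro divide_right_mono) auto
    also have "\<dots> = (7 * pi / ?w ^ 3)^2"
      by (simp add: power_divide power_mult_distrib flip: power_mult)
    finally show "norm (fs_peak t) * norm e \<le> 7 * pi / ?w ^ 3"
      using w1 by (rule_tac power2_le_imp_le) auto
    have "10 * pi / ?w ^ 5 \<le> 10 * pi / ?w ^ 3"
      using w1 by (intro divide_left_mono power_increasing) (auto intro!: mult_pos_pos)
    with e2 show "(norm e)^2 \<le> 10 * pi / ?w ^ 3" by simp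
  qed simp
  also have "\<dots> = 24 * pi / ?w ^ 3" by simp
  also have "\<dots> \<le> 24 * pi / ?w^2"
    using w1 by (intro divide_left_mono power_increasing) (auto intro!: mult_pos_pos)
  finally have "?w^2 * \<bar>fs_energy I J (fs_ker t) - fs_energy I J (fs_peak t)\<bar> \<le> 24 * pi"
    using w1 by (simp add: pos_le_divide_eq mult.commute)
  moreover have "(1 + t^2) * \<bar>fs_energy I J (fs_ker t) - fs_energy I J (fs_peak t)\<bar>
      \<le> ?w^2 * \<bar>fs_energy I J (fs_ker t) - fs_energy I J (fs_peak t)\<bar>"
    unfolding peak_freq_square by (intro mult_right_mono) auto
  ultimately show ?thesis by linarith
qed

section \<open>Asymptotics of the trace\<close>

lemma arctan_ge: "y / (1 + y^2) \<le> arctan y" if "(y::real) \<ge> 0"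
proof -
  have "y / (1 + y^2) = sin (arctan y) * cos (arctan y)"
    by (simp add: sin_arctan cos_arctan)
  also have "\<dots> \<le> sin (arctan y) * 1"
    using that by (intro mult_left_mono) (simp_all add: sin_arctan)
  also have "\<dots> \<le> arctan y" using that by (simp add: sin_x_le_x)
  finally show ?thesis .
qed

lemma arctan_divide_swap:
  assumes "(a::real) > 0" "b > 0"
  shows "arctan (a / b) = pi / 2 - arctan (b / a)"
  using arctan_inverse[of "b / a"] assms by simp

lemma divide_sum_squares_le:
  fixes a b :: real
  assumes "a \<ge> 0" "b \<ge> 0"
  shows "a * b / (a^2 + b^2) \<le> 1 / 2"
proof (cases "a^2 + b^2 = 0")
  case False
  then have "a^2 + b^2 > 0" by (simp add: sum_power2_gt_zero_iff)
  then show ?thesis using sum_squares_bound[of a b] by (simp add: pos_divide_le_eq)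
qed simp

text \<open>The leading term of the contribution of the frequencies \<open>\<bar>\<xi>\<bar> \<le> R\<close> to the local density.\<close>
definition mixed_density :: "real \<Rightarrow> real \<Rightarrow> real" where
  "mixed_density R s = s * (pi / 2 - arctan (s / R)) - s^2 * R / (s^2 + R^2)"

definition mixed_primitive :: "real \<Rightarrow> real \<Rightarrow> real" where
  "mixed_primitive R s = (s^2 * (pi / 2 - arctan (s / R)) + R^2 * arctan (s / R) - s * R) / 2"

lemma has_derivative_arctan_scaled:
  assumes "R > 0"
  shows "((\<lambda>s. arctan (s / R)) has_real_derivative R / (s^2 + R^2)) (at s within A)"
proof -
  have "((\<lambda>s. arctan (s / R)) has_real_derivative (1 / (1 + (s / R)^2)) * (1 / R)) (at s within A)"
    using assms by (auto intro!: derivative_eq_intros simp: inverse_eq_divide)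
  moreover have "(1 / (1 + (s / R)^2)) * (1 / R) = R / (s^2 + R^2)"
  proof -
    have "1 + (s / R)^2 = (s^2 + R^2) / R^2" using assms by (simp add: field_simps)
    then show ?thesis using assms by (simp add: power2_eq_square)
  qed
  ultimately show ?thesis by simp
qed

lemma mixed_primitive_derivative:
  assumes R: "R > 0"
  shows "(mixed_primitive R has_real_derivative mixed_density R s) (at s within A)"
proof -
  have nz: "s^2 + R^2 \<noteq> 0" using R by (simp add: sum_power2_eq_zero_iff)
  have "(mixed_primitive R has_real_derivative
      (2 * s * (pi / 2 - arctan (s / R)) + s^2 * (0 - R / (s^2 + R^2)) + R^2 * (R / (s^2 + R^2)) - R) / 2) (at s within A)"
  proof -
    define A' where "A' = (\<lambda>s. arctan (s / R))"
    define q where "q = R / (s^2 + R^2)"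
    have A': "(A' has_real_derivative q) (at s within A)"
      unfolding A'_def q_def by (rule has_derivative_arctan_scaled[OF R])
    have "((\<lambda>s. (s^2 * (pi / 2 - A' s) + R^2 * A' s - s * R) / 2) has_real_derivative
        (2 * s * (pi / 2 - A' s) + s^2 * (0 - q) + R^2 * q - R) / 2) (at s within A)"
      by (auto intro!: derivative_eq_intros A' simp: field_simps)
    then show ?thesis unfolding mixed_primitive_def A'_def q_def .
  qed
  moreover have "(2 * s * (pi / 2 - arctan (s / R)) + s^2 * (0 - R / (s^2 + R^2)) + R^2 * (R / (s^2 + R^2)) - R) / 2
      = mixed_density R s"
  proof -
    define q where "q = R / (s^2 + R^2)"
    have "(s^2 + R^2) * q = R" using nz by (simp add: q_def)
    then have "s^2 * (0 - q) + R^2 * q - R = - 2 * (s^2 * q)" by (simp add: algebra_simps)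
    moreover have "mixed_density R s = s * (pi / 2 - arctan (s / R)) - s^2 * q"
      by (simp add: mixed_density_def q_def)
    ultimately show ?thesis unfolding q_def[symmetric] by simp
  qed
  ultimately show ?thesis by simp
qed

text \<open>The constant is independent of \<open>R\<close>, since the density is later evaluated at
  \<open>peak_freq t\<close> instead of \<open>\<bar>t\<bar>\<close>. The arctangent part of the
  derivative lies between 0 and \<open>pi / 2\<close>, and the subtracted terms are at most
  \<open>1 / 2\<close> and 1, so the derivative lies between \<open>- 3 / 2\<close> and
  \<open>pi / 2\<close>.\<close>

lemma mixed_density_lipschitz:
  assumes R: "R > 0" and "s \<ge> 0" "w \<ge> 0"
  shows "\<bar>mixed_density R w - mixed_density R s\<bar> \<le> 2 * \<bar>w - s\<bar>"
proof -
  let ?d = "\<lambda>s. pi / 2 - arctan (s / R) - s * R / (s^2 + R^2) - 2 * (s * R / (s^2 + R^2)) * (R^2 / (s^2 + R^2))"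
  have "norm (mixed_density R w - mixed_density R s) \<le> 2 * norm (w - s)"
  proof (rule field_differentiable_bound[of "{0..}" _ ?d])
    fix s :: real assume s: "s \<in> {0..}"
    have p: "s^2 + R^2 > 0" using R by (simp add: sum_power2_gt_zero_iff)
    define A where "A = (\<lambda>s. arctan (s / R))"
    define q where "q = R / (s^2 + R^2)"
    have A': "(A has_real_derivative q) (at s within {0..})"
      unfolding A_def q_def by (rule has_derivative_arctan_scaled[OF R])
    have first: "((\<lambda>s. s * (pi / 2 - A s)) has_real_derivative (pi / 2 - A s) + s * (0 - q)) (at s within {0..})"
      by (rule A' derivative_eq_intros refl)+ simp
    have "((\<lambda>s. s^2 * R) has_real_derivative 2 * s * R) (at s within {0..})"
      "((\<lambda>s. s^2 + R^2) has_real_derivative 2 * s) (at s within {0..})"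
      by (auto intro!: derivative_eq_intros)
    from DERIV_divide[OF this less_imp_neq[OF p, symmetric]]
    have second: "((\<lambda>s. s^2 * R / (s^2 + R^2)) has_real_derivative
        ((2 * s * R) * (s^2 + R^2) - s^2 * R * (2 * s)) / ((s^2 + R^2) * (s^2 + R^2))) (at s within {0..})" .
    have D: "(mixed_density R has_real_derivative
        (pi / 2 - arctan (s / R)) + s * (0 - R / (s^2 + R^2))
        - ((2 * s * R) * (s^2 + R^2) - s^2 * R * (2 * s)) / ((s^2 + R^2) * (s^2 + R^2))) (at s within {0..})"
      using DERIV_diff[OF first second] unfolding mixed_density_def A_def q_def .
    have eq: "(pi / 2 - arctan (s / R)) + s * (0 - R / (s^2 + R^2))
        - ((2 * s * R) * (s^2 + R^2) - s^2 * R * (2 * s)) / ((s^2 + R^2) * (s^2 + R^2)) = ?d s"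
    proof -
      have "(2 * s * R) * (s^2 + R^2) - s^2 * R * (2 * s) = 2 * (s * R) * R^2"
        by (simp add: power2_eq_square algebra_simps)
      then show ?thesis by simp
    qed
    show "(mixed_density R has_real_derivative ?d s) (at s within {0..})"
      by (rule DERIV_cong[OF D eq])
    have a: "0 \<le> arctan (s / R)" "arctan (s / R) \<le> pi / 2"
      using s R arctan_ubound[of "s / R"] by (simp_all add: less_imp_le)
    have b: "0 \<le> s * R / (s^2 + R^2)" "s * R / (s^2 + R^2) \<le> 1 / 2"
      using s R divide_sum_squares_le[of s R] by auto
    have c: "0 \<le> R^2 / (s^2 + R^2)" "R^2 / (s^2 + R^2) \<le> 1" using p by auto
    have "(s * R / (s^2 + R^2)) * (R^2 / (s^2 + R^2)) \<le> 1 / 2 * 1"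
      by (rule mult_mono[OF b(2) c(2) _ c(1)]) simp
    moreover have "0 \<le> (s * R / (s^2 + R^2)) * (R^2 / (s^2 + R^2))" by (rule mult_nonneg_nonneg[OF b(1) c(1)])
    ultimately show "norm (?d s) \<le> 2" using a b pi_less_4 unfolding real_norm_def by (intro abs_leI) linarith+
  qed (use assms in auto)
  then show ?thesis by simp
qed

lemma mixed_density_le: "s \<ge> 0 \<Longrightarrow> R > 0 \<Longrightarrow> mixed_density R s \<le> pi / 2 * s"
proof -
  assume "s \<ge> 0" "R > 0"
  then have "s * (pi / 2 - arctan (s / R)) \<le> s * (pi / 2)" by (intro mult_left_mono) auto
  moreover have "s^2 * R / (s^2 + R^2) \<ge> 0" using \<open>R > 0\<close> by auto
  ultimately show ?thesis by (simp add: mixed_density_def mult.commute)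
qed

lemma peak_freq_quotient:
  shows "(1 + t^2)^2 / peak_freq t ^ 3 \<le> \<bar>t\<bar> + 2" "\<bar>t\<bar> - 2 \<le> (1 + t^2)^2 / peak_freq t ^ 3"
    "(1 + t^2) / peak_freq t ^ 3 \<le> 1"
proof -
  let ?w = "peak_freq t"
  have w1: "?w \<ge> 1" by (rule peak_freq_ge_one)
  have t: "1 + t^2 = ?w^2 - 1" by (simp add: peak_freq_square)
  have q: "(1 + t^2)^2 / ?w ^ 3 = ?w - 2 / ?w + 1 / ?w ^ 3"
    unfolding t using w1 by (simp add: power2_eq_square power3_eq_cube field_simps)
  have w3: "?w ^ 3 \<ge> 1" "?w \<le> ?w ^ 3" "?w^2 \<le> ?w ^ 3"
    using w1 power_increasing[of 1 3 ?w] power_increasing[of 2 3 ?w] by (auto simp: one_le_power)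
  have "1 / ?w ^ 3 \<le> 1 / ?w" using w1 w3 by (intro divide_left_mono) (auto intro: mult_pos_pos)
  moreover have "1 / ?w \<le> 1" "0 \<le> 1 / ?w" "0 \<le> 1 / ?w ^ 3" "2 / ?w = 2 * (1 / ?w)" using w1 by simp_all
  ultimately show "(1 + t^2)^2 / ?w ^ 3 \<le> \<bar>t\<bar> + 2" "\<bar>t\<bar> - 2 \<le> (1 + t^2)^2 / ?w ^ 3"
    unfolding q using peak_freq_le[of t] abs_le_peak_freq[of t] by linarith+
  have "1 + t^2 \<le> ?w ^ 3" using w3(3) t by linarith
  then show "(1 + t^2) / ?w ^ 3 \<le> 1" using w1 by simp
qed

lemma peak_square_integral: "has_bochner_integral lborel (\<lambda>x. (peak t x)^2) (pi / (2 * peak_freq t ^ 3))"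
proof -
  let ?w = "peak_freq t"
  have w: "?w > 0" by (rule peak_freq_pos)
  have "has_bochner_integral lborel (\<lambda>x. pi^2 / ?w^2 * exp (- (4 * pi * ?w) * \<bar>x - t\<bar>)) (pi^2 / ?w^2 * (2 / (4 * pi * ?w)))"
    using w by (intro has_bochner_integral_mult_right has_bochner_integral_exp_abs_shift) simp
  moreover have "pi^2 / ?w^2 * exp (- (4 * pi * ?w) * \<bar>x - t\<bar>) = (peak t x)^2" for x
    by (simp add: peak_def power_mult_distrib power_divide exp_double[symmetric])
  moreover have "pi^2 / ?w^2 * (2 / (4 * pi * ?w)) = pi / (2 * ?w ^ 3)"
    using w by (simp add: power2_eq_square power3_eq_cube)
  ultimately show ?thesis by simp
qed

text \<open>Freezing the weight at \<open>t\<close> costs \<open>3 * pi / w^3\<close> for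
  \<open>w = peak_freq t\<close>. The upper bound extends the integral to the whole line. The lower
  bound also loses the mass outside the window, at most \<open>4 * pi / w^3\<close> provided the
  peak is at distance 1 from the endpoints.\<close>

lemma peak_mass_bounds:
  fixes R t :: real
  defines "a \<equiv> (LINT x:{-R..R}|lborel. (peak t x)^2 * (1 + x^2))"
  shows "(1 + t^2) * a \<le> pi / 2 * \<bar>t\<bar> + 4 * pi"
    and "\<bar>t\<bar> \<le> R - 1 \<Longrightarrow> pi / 2 * \<bar>t\<bar> - 8 * pi \<le> (1 + t^2) * a"
proof -
  let ?w = "peak_freq t"
  have w1: "?w \<ge> 1" by (rule peak_freq_ge_one)
  note P = peak_square_integral[of t]
  have D: "integrable lborel (\<lambda>x. (peak t x)^2 * \<bar>x^2 - t^2\<bar>)" "(LINT x|lborel. (peak t x)^2 * \<bar>x^2 - t^2\<bar>) \<le> 3 * pi / ?w ^ 3"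
    by (rule peak_square_weight_integral[OF _ _ abs_diff_square_le]; auto)+
  have W: "integrable lborel (\<lambda>x. (peak t x)^2 * (1 + x^2))"
    using fourier_sobolevD(3)[OF peak_fourier_sobolev[of t]] by simp
  define A where "A = (LINT x|lborel. (peak t x)^2 * (1 + x^2))"
  define B where "B = pi / (2 * ?w ^ 3)"
  have Pi: "integrable lborel (\<lambda>x. (1 + t^2) * (peak t x)^2)" "(LINT x|lborel. (1 + t^2) * (peak t x)^2) = (1 + t^2) * B"
    using has_bochner_integral_mult_right[OF P, of "1 + t^2"] by (auto simp: has_bochner_integral_iff B_def)
  have "\<bar>A - (1 + t^2) * B\<bar> = \<bar>LINT x|lborel. (peak t x)^2 * (1 + x^2) - (1 + t^2) * (peak t x)^2\<bar>"
    unfolding A_def Pi(2)[symmetric] by (simp only: Bochner_Integration.integral_diff[OF W Pi(1)])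
  also have "\<dots> \<le> (LINT x|lborel. \<bar>(peak t x)^2 * (1 + x^2) - (1 + t^2) * (peak t x)^2\<bar>)"
    by (rule integral_abs_bound)
  also have "\<dots> = (LINT x|lborel. (peak t x)^2 * \<bar>x^2 - t^2\<bar>)"
  proof (intro Bochner_Integration.integral_cong refl)
    fix x
    have "(peak t x)^2 * (1 + x^2) - (1 + t^2) * (peak t x)^2 = (peak t x)^2 * (x^2 - t^2)"
      by (simp add: algebra_simps)
    then show "\<bar>(peak t x)^2 * (1 + x^2) - (1 + t^2) * (peak t x)^2\<bar> = (peak t x)^2 * \<bar>x^2 - t^2\<bar>"
      by (simp add: abs_mult)
  qed
  finally have A_up: "A \<le> (1 + t^2) * B + 3 * pi / ?w ^ 3" and A_low: "(1 + t^2) * B - 3 * pi / ?w ^ 3 \<le> A"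
    using D(2) by linarith+
  have Iset: "integrable lborel (\<lambda>x. indicator {-R..R} x *\<^sub>R ((peak t x)^2 * (1 + x^2)))"
    using W by (intro integrable_mult_indicator) auto
  have B_eq: "(1 + t^2) * ((1 + t^2) * B) = pi / 2 * ((1 + t^2)^2 / ?w ^ 3)"
    by (simp add: B_def power2_eq_square)
  have E_eq: "(1 + t^2) * (k * pi / ?w ^ 3) = k * pi * ((1 + t^2) / ?w ^ 3)" for k
    by simp
  have E_le: "k * pi * ((1 + t^2) / ?w ^ 3) \<le> k * pi" if "k \<ge> 0" for k
    using peak_freq_quotient(3)[of t] that by (intro mult_left_le) auto
  have "a \<le> A"
    unfolding a_def A_def set_lebesgue_integral_def
    by (intro integral_mono Iset W) (auto simp: indicator_def)
  then have "(1 + t^2) * a \<le> (1 + t^2) * ((1 + t^2) * B + 3 * pi / ?w ^ 3)"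
    using A_up by (intro mult_left_mono) auto
  also have "\<dots> = pi / 2 * ((1 + t^2)^2 / ?w ^ 3) + 3 * pi * ((1 + t^2) / ?w ^ 3)"
    unfolding distrib_left[of "1 + t^2"] B_eq E_eq ..
  also have "\<dots> \<le> pi / 2 * (\<bar>t\<bar> + 2) + 3 * pi"
    by (intro add_mono mult_left_mono peak_freq_quotient E_le) auto
  also have "\<dots> = pi / 2 * \<bar>t\<bar> + 4 * pi" by (simp add: algebra_simps)
  finally show "(1 + t^2) * a \<le> pi / 2 * \<bar>t\<bar> + 4 * pi" .
  assume tR: "\<bar>t\<bar> \<le> R - 1"
  define v where "v = (\<lambda>x. indicator (- {-R..R}) x * (1 + x^2) :: real)"
  have v_le: "v x \<le> 4 * exp (2 * pi * (?w * \<bar>x - t\<bar>))" for x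
  proof (cases "x \<in> {-R..R}")
    case False
    define z where "z = ?w * \<bar>x - t\<bar>"
    \<comment> \<open>This is what the restriction on \<open>t\<close> provides: it gives
      \<open>z\<close> at least \<open>peak_freq t\<close>, so the exponential absorbs
      \<open>1 + t^2\<close> and not just \<open>x^2 - t^2\<close>.\<close>
    have "\<bar>x - t\<bar> \<ge> 1" using False tR by auto
    then have zw: "?w \<le> z" using w1 mult_left_mono[of 1 "\<bar>x - t\<bar>" ?w] by (simp add: z_def)
    have z: "z \<ge> 0" using zw w1 by linarith
    have "1 + t^2 \<le> ?w^2" by (simp add: peak_freq_square)
    also have "\<dots> \<le> z^2" using zw w1 by (intro power_mono) auto
    also have "\<dots> \<le> exp (2 * pi * z)" by (rule power_le_exp_two_pi(2)[OF z])
    finally have "1 + t^2 \<le> exp (2 * pi * z)" .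
    moreover have "\<bar>x^2 - t^2\<bar> \<le> 3 * exp (2 * pi * z)" using abs_diff_square_le[of x t] by (simp add: z_def)
    ultimately have "1 + x^2 \<le> 4 * exp (2 * pi * z)" by linarith
    then show ?thesis using False by (simp add: v_def z_def)
  qed (simp add: v_def)
  have v0: "v x \<ge> 0" for x by (simp add: v_def indicator_def)
  have [measurable]: "v \<in> borel_measurable borel" unfolding v_def by measurable
  note V = peak_square_weight_integral[of v, OF _ v0 v_le]
  have "A = a + (LINT x|lborel. (peak t x)^2 * v x)"
  proof -
    have "A = (LINT x|lborel. indicator {-R..R} x *\<^sub>R ((peak t x)^2 * (1 + x^2)) + (peak t x)^2 * v x)"
      unfolding A_def v_def by (intro Bochner_Integration.integral_cong) (auto simp: indicator_def)
    then show ?thesis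
      unfolding a_def set_lebesgue_integral_def
      by (simp only: Bochner_Integration.integral_add[OF Iset V(1)] measurable_lborel1 \<open>v \<in> borel_measurable borel\<close>)
  qed
  moreover have "(LINT x|lborel. (peak t x)^2 * v x) \<le> 4 * pi / ?w ^ 3" by (rule V(2)) simp
  moreover have "7 * pi / ?w ^ 3 = 3 * pi / ?w ^ 3 + 4 * pi / ?w ^ 3" by (simp add: add_divide_distrib[symmetric])
  ultimately have a_low: "(1 + t^2) * B - 7 * pi / ?w ^ 3 \<le> a" using A_low by linarith
  have "pi / 2 * \<bar>t\<bar> - 8 * pi = pi / 2 * (\<bar>t\<bar> - 2) - 7 * pi" by (simp add: right_diff_distrib)
  also have "\<dots> \<le> pi / 2 * ((1 + t^2)^2 / ?w ^ 3) - 7 * pi * ((1 + t^2) / ?w ^ 3)"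
    by (intro diff_mono mult_left_mono peak_freq_quotient E_le) auto
  also have "\<dots> = (1 + t^2) * ((1 + t^2) * B - 7 * pi / ?w ^ 3)"
    unfolding right_diff_distrib[of "1 + t^2"] B_eq E_eq ..
  also have "\<dots> \<le> (1 + t^2) * a" using a_low by (intro mult_left_mono) auto
  finally show "pi / 2 * \<bar>t\<bar> - 8 * pi \<le> (1 + t^2) * a" .
qed

text \<open>The integral is elementary. Its product with \<open>1 + t^2\<close> is within 3 of
  \<open>mixed_density\<close> at \<open>peak_freq t\<close>, and moving to
  \<open>\<bar>t\<bar>\<close>, at distance at most 2, costs 4 more by the Lipschitz bound.\<close>

lemma peak_frequency_mass:
  fixes R t :: real
  assumes R: "R > 0"
  defines "b \<equiv> (LINT \<xi>:{-R..R}|lborel. (1 / (2 + t^2 + \<xi>^2))^2 * (1 + \<xi>^2))"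
  shows "\<bar>(1 + t^2) * b - mixed_density R \<bar>t\<bar>\<bar> \<le> 7"
proof -
  let ?w = "peak_freq t"
  have w1: "?w \<ge> 1" by (rule peak_freq_ge_one)
  then have w0: "?w > 0" by simp
  \<comment> \<open>Partial fractions with \<open>Q = \<xi>^2 + w^2\<close> and
    \<open>w = peak_freq t\<close>: the integrand is \<open>1 / Q + (1 - w^2) / Q^2\<close>, and the
    primitive of \<open>1 / Q^2\<close> again combines \<open>arctan (\<xi> / w)\<close> and
    \<open>\<xi> / Q\<close>.\<close>
  define F where "F = (\<lambda>\<xi>. (1 + 1 / ?w^2) / 2 * (1 / ?w * arctan (\<xi> / ?w)) + (1 / ?w^2 - 1) / 2 * (\<xi> / (\<xi>^2 + ?w^2)))"
  have F': "(F has_real_derivative (1 / (2 + t^2 + \<xi>^2))^2 * (1 + \<xi>^2)) (at \<xi> within S)" for \<xi> S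
  proof -
    define Q where "Q = \<xi>^2 + ?w^2"
    have Q: "Q > 0" using w0 by (simp add: Q_def add_nonneg_pos)
    have "(F has_real_derivative (1 + 1 / ?w^2) / 2 * (1 / ?w * (?w / (\<xi>^2 + ?w^2)))
        + (1 / ?w^2 - 1) / 2 * ((1 * (\<xi>^2 + ?w^2) - \<xi> * (2 * \<xi>)) / ((\<xi>^2 + ?w^2) * (\<xi>^2 + ?w^2)))) (at \<xi> within S)"
      unfolding F_def
    proof (intro DERIV_add DERIV_cmult has_derivative_arctan_scaled[OF w0])
      have "((\<lambda>\<xi>. \<xi>) has_real_derivative 1) (at \<xi> within S)"
        "((\<lambda>\<xi>. \<xi>^2 + ?w^2) has_real_derivative 2 * \<xi>) (at \<xi> within S)"
        by (auto intro!: derivative_eq_intros)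
      from DERIV_divide[OF this less_imp_neq[OF Q[unfolded Q_def], symmetric]]
      show "((\<lambda>\<xi>. \<xi> / (\<xi>^2 + ?w^2)) has_real_derivative
          (1 * (\<xi>^2 + ?w^2) - \<xi> * (2 * \<xi>)) / ((\<xi>^2 + ?w^2) * (\<xi>^2 + ?w^2))) (at \<xi> within S)" .
    qed
    moreover have "(1 + 1 / ?w^2) / 2 * (1 / ?w * (?w / (\<xi>^2 + ?w^2)))
        + (1 / ?w^2 - 1) / 2 * ((1 * (\<xi>^2 + ?w^2) - \<xi> * (2 * \<xi>)) / ((\<xi>^2 + ?w^2) * (\<xi>^2 + ?w^2)))
      = (1 / (2 + t^2 + \<xi>^2))^2 * (1 + \<xi>^2)"
    proof -
      have "2 + t^2 + \<xi>^2 = Q" by (simp add: Q_def peak_freq_square)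
      moreover have "1 * (\<xi>^2 + ?w^2) - \<xi> * (2 * \<xi>) = 2 * ?w^2 - Q" by (simp add: Q_def power2_eq_square)
      moreover have "1 + \<xi>^2 = 1 + Q - ?w^2" by (simp add: Q_def)
      moreover have "(1 + 1 / ?w^2) / 2 * (1 / ?w * (?w / Q)) + (1 / ?w^2 - 1) / 2 * ((2 * ?w^2 - Q) / (Q * Q))
          = (1 / Q)^2 * (1 + Q - ?w^2)"
        using Q w0 by (simp add: power2_eq_square field_simps)
      ultimately show ?thesis by (simp only: Q_def)
    qed
    ultimately show ?thesis by simp
  qed
  have "b = F R - F (- R)"
    unfolding b_def set_lebesgue_integral_def
  proof (rule integral_FTC_atLeastAtMost)
    show "(F has_vector_derivative (1 / (2 + t^2 + \<xi>^2))^2 * (1 + \<xi>^2)) (at \<xi> within {- R..R})" for \<xi>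
      using F' by (simp add: has_real_derivative_iff_has_vector_derivative)
    have "2 + t^2 + \<xi>^2 \<noteq> 0" for \<xi> :: real by (smt (verit) zero_le_power2)
    then show "continuous_on {- R..R} (\<lambda>\<xi>. (1 / (2 + t^2 + \<xi>^2))^2 * (1 + \<xi>^2))"
      by (intro continuous_intros) auto
  qed (use R in simp)
  also have "F (- R) = - F R"
    unfolding F_def by (simp only: minus_divide_left[symmetric] arctan_minus power2_minus mult_minus_right minus_add_distrib)
  also have "F R - - F R = 2 * F R" by simp
  finally have b: "b = 2 * F R" .
  define A where "A = arctan (R / ?w)"
  define q where "q = R / (R^2 + ?w^2)"
  have A: "A = pi / 2 - arctan (?w / R)" unfolding A_def by (rule arctan_divide_swap[OF R w0])
  have A0: "0 \<le> A" "A \<le> 2" using R w0 arctan_ubound[of "R / ?w"] pi_less_4 by (simp_all add: A_def)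
  have q0: "0 \<le> q" using R by (simp add: q_def)
  have q1: "q \<le> 1 / 2"
  proof -
    have "q \<le> R * ?w / (R^2 + ?w^2)"
      unfolding q_def using R w1 by (intro divide_right_mono) (auto simp: mult_le_cancel_left1)
    also have "\<dots> \<le> 1 / 2" using R w0 by (intro divide_sum_squares_le) auto
    finally show ?thesis .
  qed
  have t: "1 + t^2 = ?w^2 - 1" by (simp add: peak_freq_square)
  have "(1 + t^2) * b = (?w - 1 / ?w ^ 3) * A - (?w^2 - 2 + 1 / ?w^2) * q"
  proof -
    have alg: "(w^2 - 1) * (2 * ((1 + 1 / w^2) / 2 * (1 / w * x) + (1 / w^2 - 1) / 2 * y))
        = (w - 1 / w ^ 3) * x - (w^2 - 2 + 1 / w^2) * y" if "w \<noteq> 0" for w x y :: real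
      using that by (simp add: power2_eq_square power3_eq_cube field_simps)
    show ?thesis unfolding t b F_def A_def q_def by (rule alg) (use w0 in simp)
  qed
  moreover have "mixed_density R ?w = ?w * A - ?w^2 * q"
    by (simp add: mixed_density_def A q_def add.commute)
  ultimately have "(1 + t^2) * b - mixed_density R ?w = (2 - 1 / ?w^2) * q - 1 / ?w ^ 3 * A"
    by (simp add: algebra_simps)
  moreover have "0 \<le> (2 - 1 / ?w^2) * q" "(2 - 1 / ?w^2) * q \<le> 2 * (1 / 2)"
  proof -
    have "1 / ?w^2 \<le> 1" using w1 by (simp add: one_le_power)
    then show "0 \<le> (2 - 1 / ?w^2) * q" using q0 by (intro mult_nonneg_nonneg) auto
    show "(2 - 1 / ?w^2) * q \<le> 2 * (1 / 2)" using q0 q1 by (intro mult_mono) auto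
  qed
  moreover have "0 \<le> 1 / ?w ^ 3 * A" "1 / ?w ^ 3 * A \<le> 1 * 2"
  proof -
    have i: "0 \<le> 1 / ?w ^ 3" "1 / ?w ^ 3 \<le> 1" using w1 by (simp_all add: one_le_power)
    show "0 \<le> 1 / ?w ^ 3 * A" by (rule mult_nonneg_nonneg[OF i(1) A0(1)])
    show "1 / ?w ^ 3 * A \<le> 1 * 2" by (rule mult_mono[OF i(2) A0(2) _ A0(1)]) simp
  qed
  ultimately have three: "\<bar>(1 + t^2) * b - mixed_density R ?w\<bar> \<le> 3" by linarith
  have "\<bar>mixed_density R ?w - mixed_density R \<bar>t\<bar>\<bar> \<le> 2 * \<bar>?w - \<bar>t\<bar>\<bar>"
    using R w0 by (intro mixed_density_lipschitz) auto
  also have "\<dots> \<le> 4" using peak_freq_le[of t] abs_le_peak_freq[of t] by simp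
  finally have four: "\<bar>mixed_density R ?w - mixed_density R \<bar>t\<bar>\<bar> \<le> 4" .
  have "\<bar>x - z\<bar> \<le> \<bar>x - y\<bar> + \<bar>y - z\<bar>" for x y z :: real by linarith
  from order_trans[OF this add_mono[OF three four]] show ?thesis by simp
qed

text \<open>The first summand comes from the space window, the second from the frequency
  window.\<close>

definition trace_density :: "real \<Rightarrow> real \<Rightarrow> real" where
  "trace_density R t = pi / 2 * \<bar>t\<bar> + mixed_density R \<bar>t\<bar>"

text \<open>The constant adds \<open>24 * pi\<close> for replacing the kernel by the peak, at most
  \<open>8 * pi\<close> from the space window and 7 from the frequency window, with
  \<open>pi < 4\<close>.\<close>

lemma kernel_energy_bounds:
  fixes R1 R2 t :: real
  assumes R2: "R2 > 0"
  defines "E \<equiv> fs_energy {-R1..R1} {-R2..R2} (fs_ker t)"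
  shows "E * (1 + t^2) \<le> trace_density R2 t + 140"
    and "\<bar>t\<bar> \<le> R1 - 1 \<Longrightarrow> trace_density R2 t - 140 \<le> E * (1 + t^2)"
proof -
  define a where "a = (LINT x:{-R1..R1}|lborel. (peak t x)^2 * (1 + x^2))"
  define b where "b = (LINT \<xi>:{-R2..R2}|lborel. (1 / (2 + t^2 + \<xi>^2))^2 * (1 + \<xi>^2))"
  define E' where "E' = fs_energy {-R1..R1} {-R2..R2} (fs_peak t)"
  have "cmod (fourier (fun_of (fs_peak t)) \<xi>) = 1 / (2 + t^2 + \<xi>^2)" for \<xi>
    unfolding fun_of_peak fourier_peak norm_divide norm_of_real by (simp add: add_nonneg_nonneg)
  then have E': "E' = a + b"
    unfolding E'_def fs_energy_def a_def b_def by (simp add: fun_of_peak)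
  have "(1 + t^2) * \<bar>E - E'\<bar> \<le> 24 * pi"
    unfolding E_def E'_def by (rule fs_energy_ker_peak) auto
  then have "\<bar>(1 + t^2) * (E - E')\<bar> \<le> 24 * pi" by (simp add: abs_mult)
  then have EE: "\<bar>E * (1 + t^2) - ((1 + t^2) * a + (1 + t^2) * b)\<bar> \<le> 24 * pi"
    unfolding E' by (simp add: algebra_simps)
  note bb = peak_frequency_mass[OF R2, of t, folded b_def]
  show "E * (1 + t^2) \<le> trace_density R2 t + 140"
    using EE bb peak_mass_bounds(1)[of t R1, folded a_def] pi_less_4 unfolding trace_density_def by linarith
  show "trace_density R2 t - 140 \<le> E * (1 + t^2)" if "\<bar>t\<bar> \<le> R1 - 1"
    using EE bb peak_mass_bounds(2)[of t R1, folded a_def, OF that] pi_less_4 unfolding trace_density_def by linarith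
qed

section \<open>Integration of the density and the boundary strip\<close>

definition trace_primitive :: "real \<Rightarrow> real \<Rightarrow> real" where
  "trace_primitive R s = pi / 4 * s^2 + mixed_primitive R s"

lemma trace_primitive_derivative:
  assumes "R > 0"
  shows "(trace_primitive R has_real_derivative pi / 2 * s + mixed_density R s) (at s within A)"
proof -
  have "(trace_primitive R has_real_derivative pi / 4 * (2 * s) + mixed_density R s) (at s within A)"
    unfolding trace_primitive_def
    by (rule DERIV_add[OF _ mixed_primitive_derivative[OF assms]]) (auto intro!: derivative_eq_intros)
  then show ?thesis by simp
qed

lemma trace_density_set_integrable:
  assumes "R > 0"
  shows "set_integrable lborel {-S..S} (trace_density R)"
proof -
  have nz: "\<bar>t\<bar>^2 + R^2 \<noteq> 0" for t :: real using assms by (simp add: sum_power2_eq_zero_iff)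
  have "continuous_on {-S..S} (trace_density R)"
    unfolding trace_density_def mixed_density_def using assms nz
    by (intro continuous_intros) auto
  then show ?thesis by (intro set_integrable_continuous_compact) auto
qed

lemma trace_density_integral:
  assumes R: "R > 0" and S: "S \<ge> 0"
  shows "(LINT t:{-S..S}|lborel. trace_density R t) = 2 * trace_primitive R S"
proof -
  have zero: "trace_primitive R 0 = 0" by (simp add: trace_primitive_def mixed_primitive_def)
  have "(trace_density R has_integral trace_primitive R S - trace_primitive R 0) {0..S}"
  proof (rule fundamental_theorem_of_calculus[OF S])
    fix s assume "s \<in> {0..S}"
    then show "(trace_primitive R has_vector_derivative trace_density R s) (at s within {0..S})"
      using trace_primitive_derivative[OF R, of s "{0..S}"]
      by (simp add: trace_density_def has_real_derivative_iff_has_vector_derivative)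
  qed
  \<comment> \<open>The density is even, so on the negative half line its primitive is the odd
    reflection of \<open>trace_primitive R\<close>.\<close>
  moreover have "(trace_density R has_integral - trace_primitive R (- 0) - - trace_primitive R (- (- S))) {-S..0}"
  proof (rule fundamental_theorem_of_calculus)
    fix s assume s: "s \<in> {-S..0}"
    have "((\<lambda>s. - trace_primitive R (- s)) has_real_derivative - ((pi / 2 * (- s) + mixed_density R (- s)) * (- 1))) (at s within {-S..0})"
      by (rule DERIV_minus, rule DERIV_chain'[OF _ trace_primitive_derivative[OF R]])
        (auto intro!: derivative_eq_intros)
    then show "((\<lambda>s. - trace_primitive R (- s)) has_vector_derivative trace_density R s) (at s within {-S..0})"
      using s by (simp add: trace_density_def has_real_derivative_iff_has_vector_derivative)
  qed (use S in simp)
  ultimately have "(trace_density R has_integral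
      (- trace_primitive R (- 0) - - trace_primitive R (- (- S))) + (trace_primitive R S - trace_primitive R 0)) {-S..S}"
    using S by (intro has_integral_combine[of "-S" 0 S]) auto
  then have "(trace_density R has_integral 2 * trace_primitive R S) {-S..S}" by (simp add: zero)
  then show ?thesis
    using set_borel_integral_eq_integral(2)[OF trace_density_set_integrable[OF R]] by (simp add: integral_unique)
qed

text \<open>The lower bound is integrated only up to \<open>R1 - 1\<close>, discarding a nonnegative
  contribution. By the mean value theorem the primitive changes by at most \<open>4 * R1\<close>
  over that strip, so the total error is at most \<open>280 * R1 + 8 * R1\<close>.\<close>

lemma kernel_energy_integral:
  fixes R1 R2 :: real
  assumes R1: "R1 \<ge> 1" and R2: "R2 > 0"
  defines "G \<equiv> (LINT t:{-R1..R1}|lborel. fs_energy {-R1..R1} {-R2..R2} (fs_ker t) * (1 + t^2))"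
  shows "\<bar>G - 2 * trace_primitive R2 R1\<bar> \<le> 300 * R1"
proof -
  let ?E = "\<lambda>t. fs_energy {-R1..R1} {-R2..R2} (fs_ker t) * (1 + t^2)"
  have iE: "set_integrable lborel {-S..S} ?E" for S
    by (intro set_integrable_continuous_compact continuous_intros continuous_on_fs_energy continuous_on_fs_ker) auto
  have const: "set_integrable lborel {-S..S} (\<lambda>t. c)" for S c :: real
    by (intro set_integrable_continuous_compact continuous_intros) auto
  have const_int: "(LINT t:{-S..S}|lborel. c) = c * (2 * S)" if "S \<ge> 0" for S c :: real
    using that by (simp add: set_integral_const emeasure_lborel_Icc measure_def)
  have "G \<le> (LINT t:{-R1..R1}|lborel. trace_density R2 t + 140)"
    unfolding G_def
    by (intro set_integral_mono iE set_integral_add trace_density_set_integrable R2 const kernel_energy_bounds)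
  also have "\<dots> = 2 * trace_primitive R2 R1 + 280 * R1"
    using R1 by (subst set_integral_add(2)[OF trace_density_set_integrable[OF R2] const])
      (simp add: trace_density_integral[OF R2] const_int)
  finally have up: "G \<le> 2 * trace_primitive R2 R1 + 280 * R1" .
  define S where "S = R1 - 1"
  have S: "S \<ge> 0" "S \<le> R1" using R1 by (simp_all add: S_def)
  have "2 * trace_primitive R2 S - 140 * (2 * S) = (LINT t:{-S..S}|lborel. trace_density R2 t - 140)"
    using S by (subst set_integral_diff(2)[OF trace_density_set_integrable[OF R2] const])
      (simp add: trace_density_integral[OF R2] const_int)
  also have "\<dots> \<le> (LINT t:{-S..S}|lborel. ?E t)"
    by (intro set_integral_mono iE set_integral_diff trace_density_set_integrable R2 const kernel_energy_bounds)
      (auto simp: S_def)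
  also have "\<dots> \<le> G"
    unfolding G_def set_lebesgue_integral_def
    using iE[of S] iE[of R1] S fs_energy_nonneg
    by (intro integral_mono) (auto simp: set_integrable_def indicator_def)
  finally have low: "2 * trace_primitive R2 S - 140 * (2 * S) \<le> G" .
  have "\<exists>z>S. z < R1 \<and> trace_primitive R2 R1 - trace_primitive R2 S = (R1 - S) * (pi / 2 * z + mixed_density R2 z)"
  proof (rule MVT2)
    show "(trace_primitive R2 has_real_derivative pi / 2 * x + mixed_density R2 x) (at x)" for x
      by (rule trace_primitive_derivative[OF R2])
  qed (simp add: S_def)
  then obtain z where z: "z > S" "z < R1" "trace_primitive R2 R1 - trace_primitive R2 S = pi / 2 * z + mixed_density R2 z"
    by (auto simp: S_def)
  have "pi / 2 * z + mixed_density R2 z \<le> pi / 2 * z + pi / 2 * z"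
    using z S R2 by (intro add_left_mono mixed_density_le) auto
  also have "\<dots> = pi * z" by simp
  also have "\<dots> \<le> 4 * R1" using z S pi_less_4 by (intro mult_mono) auto
  finally show ?thesis using up low z(3) S by (intro abs_leI) linarith+
qed

text \<open>Fourier symmetry of the kernels lets the same estimate serve both windows, with the
  radii exchanged.\<close>

lemma window_trace_asymptotics:
  fixes R1 R2 :: real
  assumes R: "R1 \<ge> 1" "R2 \<ge> 1"
  shows "\<bar>fs_window.window_trace {-R1..R1} {-R2..R2} - (2 * trace_primitive R2 R1 + 2 * trace_primitive R1 R2)\<bar>
    \<le> 300 * R1 + 300 * R2"
proof -
  interpret fs_window "{-R1..R1}" "{-R2..R2}" by unfold_locales auto
  have "fs_energy {-R1..R1} {-R2..R2} (fs_fourier_ker \<xi>) = fs_energy {-R2..R2} {-R1..R1} (fs_ker \<xi>)" for \<xi>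
    by (rule fs_energy_fourier_ker) auto
  then show ?thesis
    unfolding window_trace_def
    using kernel_energy_integral[of R1 R2] kernel_energy_integral[of R2 R1] R by simp
qed

section \<open>The explicit main term and the limit of the quotient\<close>

lemma trace_primitive_symmetric_sum:
  fixes R1 R2 :: real
  assumes R: "R1 > 0" "R2 > 0"
  shows "2 * trace_primitive R2 R1 + 2 * trace_primitive R1 R2
    = pi / 2 * R1^2 + pi / 2 * R2^2 + 2 * (R1^2 * arctan (R2 / R1) + R2^2 * arctan (R1 / R2) - R1 * R2)"
  unfolding trace_primitive_def mixed_primitive_def arctan_divide_swap[OF R(2,1)]
  by (simp add: field_simps)

text \<open>Keeps the main term from degenerating for any ratio of the radii. The bound of
  \<open>arctan_ge\<close>, applied to both arctangents, gives terms whose sum is exactly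
  \<open>R1 * R2\<close>.\<close>

lemma trace_primitive_sum_ge:
  fixes R1 R2 :: real
  assumes R: "R1 > 0" "R2 > 0"
  shows "R1^2 * arctan (R2 / R1) + R2^2 * arctan (R1 / R2) \<ge> R1 * R2"
proof -
  have *: "y^2 * arctan (x / y) \<ge> y^2 * (x * y / (x^2 + y^2))" if "x > 0" "y > 0" for x y :: real
  proof (intro mult_left_mono)
    have "x / y / (1 + (x / y)^2) = x * y / (x^2 + y^2)"
      using that by (simp add: power2_eq_square field_simps)
    then show "x * y / (x^2 + y^2) \<le> arctan (x / y)"
      using arctan_ge[of "x / y"] that by simp
  qed simp
  have nz: "R1^2 + R2^2 \<noteq> 0" using R by (simp add: sum_power2_eq_zero_iff)
  have "R1 * R2 = (R1^2 + R2^2) * (R1 * R2 / (R1^2 + R2^2))" using nz by simp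
  also have "\<dots> = R1^2 * (R2 * R1 / (R2^2 + R1^2)) + R2^2 * (R1 * R2 / (R1^2 + R2^2))"
    by (simp only: distrib_right add.commute mult.commute)
  also have "\<dots> \<le> R1^2 * arctan (R2 / R1) + R2^2 * arctan (R1 / R2)"
    by (intro add_mono * R)
  finally show ?thesis .
qed

definition trace_asymptotics :: "real \<Rightarrow> real \<Rightarrow> real" where
  "trace_asymptotics R1 R2 = pi / 2 * R1^2 + pi / 2 * R2^2 +
     2 * ((R1^2 + R2^2) * arctan (R1 / R2) - R1 * R2 - R1^2 * arctan R1 + 2 * R1^2 * arctan (R2 / R1))"

text \<open>The symmetric expression and the stated one differ by \<open>2 R\<^sub>1\<^sup>2 arctan (1 / R\<^sub>1)\<close>, which is of
  lower order.\<close>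
lemma trace_asymptotics_bounds:
  fixes R1 R2 :: real
  assumes R: "R1 \<ge> 1" "R2 \<ge> 1"
  shows "\<bar>fs_window.window_trace {-R1..R1} {-R2..R2} - trace_asymptotics R1 R2\<bar> \<le> 302 * R1 + 302 * R2"
    and "trace_asymptotics R1 R2 \<ge> R1^2 + R2^2"
proof -
  have pos: "R1 > 0" "R2 > 0" using R by auto
  define M where "M = 2 * trace_primitive R2 R1 + 2 * trace_primitive R1 R2"
  have "trace_asymptotics R1 R2 - M = 2 * R1^2 * (arctan (R1 / R2) + arctan (R2 / R1) - arctan R1)"
    unfolding trace_asymptotics_def M_def trace_primitive_symmetric_sum[OF pos] by (simp add: algebra_simps)
  also have "\<dots> = 2 * R1^2 * arctan (1 / R1)"
    unfolding arctan_divide_swap[OF pos] using arctan_divide_swap[of 1 R1] pos by simp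
  finally have diff: "trace_asymptotics R1 R2 - M = 2 * R1^2 * arctan (1 / R1)" .
  have "0 \<le> 2 * R1^2 * arctan (1 / R1)" using pos by simp
  moreover have "2 * R1^2 * arctan (1 / R1) \<le> 2 * R1^2 * (1 / R1)"
    using pos by (intro mult_left_mono arctan_le_self) auto
  moreover have "2 * R1^2 * (1 / R1) = 2 * R1" using pos by (simp add: power2_eq_square)
  ultimately have d: "0 \<le> trace_asymptotics R1 R2 - M" "trace_asymptotics R1 R2 - M \<le> 2 * R1"
    unfolding diff by linarith+
  show "\<bar>fs_window.window_trace {-R1..R1} {-R2..R2} - trace_asymptotics R1 R2\<bar> \<le> 302 * R1 + 302 * R2"
    using window_trace_asymptotics[OF R] d R unfolding M_def by linarith
  have "1 * R1^2 \<le> pi / 2 * R1^2" "1 * R2^2 \<le> pi / 2 * R2^2"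
    using pi_gt3 by (intro mult_right_mono; simp)+
  then have "R1^2 + R2^2 \<le> pi / 2 * R1^2 + pi / 2 * R2^2" by linarith
  then have "R1^2 + R2^2 \<le> M"
    unfolding M_def trace_primitive_symmetric_sum[OF pos]
    by (rule add_increasing2[rotated]) (use trace_primitive_sum_ge[OF pos] in simp)
  with d show "trace_asymptotics R1 R2 \<ge> R1^2 + R2^2" by linarith
qed

text \<open>No relation between the radii is available, so the two parts of the error are divided
  separately: the part linear in \<open>R1\<close> by \<open>R1^2\<close> and the part linear in
  \<open>R2\<close> by \<open>R2^2\<close>, both lower bounds for the main term.\<close>

lemma window_trace_quotient_tendsto:
  "((\<lambda>(R1, R2). fs_window.window_trace {-R1..R1} {-R2..R2} / trace_asymptotics R1 R2) \<longlongrightarrow> 1)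
     (at_top \<times>\<^sub>F at_top)"
proof -
  let ?F = "at_top \<times>\<^sub>F at_top :: (real \<times> real) filter"
  let ?q = "\<lambda>x. fs_window.window_trace {- fst x..fst x} {- snd x..snd x} / trace_asymptotics (fst x) (snd x)"
  have inv: "((\<lambda>R::real. 302 / R) \<longlongrightarrow> 0) at_top" by real_asymp
  have lim: "((\<lambda>x. 302 / fst x + 302 / snd x) \<longlongrightarrow> 0 + 0) ?F"
    by (intro tendsto_add filterlim_compose[OF inv] filterlim_fst filterlim_snd)
  have "eventually (\<lambda>x. fst x \<ge> 1 \<and> snd x \<ge> (1::real)) ?F"
    by (intro eventually_conj filterlim_at_top[THEN iffD1, rule_format] filterlim_fst filterlim_snd)
  then have "eventually (\<lambda>x. norm (?q x - 1) \<le> 302 / fst x + 302 / snd x) ?F"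
  proof eventually_elim
    case (elim x)
    obtain R1 R2 where x: "x = (R1, R2)" by (cases x)
    have R: "R1 \<ge> 1" "R2 \<ge> 1" using elim by (auto simp: x)
    define D where "D = trace_asymptotics R1 R2"
    define Tr where "Tr = fs_window.window_trace {-R1..R1} {-R2..R2}"
    have D: "D \<ge> R1^2 + R2^2" and Tr: "\<bar>Tr - D\<bar> \<le> 302 * R1 + 302 * R2"
      using trace_asymptotics_bounds[OF R] by (auto simp: D_def Tr_def)
    have R1D: "R1^2 \<le> D" and R2D: "R2^2 \<le> D" using D by (smt (verit) zero_le_power2)+
    have D0: "D > 0" using R1D R by (smt (verit) zero_less_power)
    have "Tr / D - 1 = (Tr - D) / D" using D0 by (simp add: diff_divide_distrib)
    then have "norm (Tr / D - 1) = \<bar>Tr - D\<bar> / D" using D0 by simp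
    also have "\<dots> \<le> (302 * R1 + 302 * R2) / D" using Tr D0 by (intro divide_right_mono) auto
    also have "\<dots> = 302 * R1 / D + 302 * R2 / D" by (rule add_divide_distrib)
    also have "\<dots> \<le> 302 * R1 / R1^2 + 302 * R2 / R2^2"
      using R R1D R2D D0 by (intro add_mono divide_left_mono mult_pos_pos) auto
    also have "\<dots> = 302 / R1 + 302 / R2" using R by (simp add: power2_eq_square)
    finally show ?case by (simp add: x Tr_def D_def)
  qed
  then have "((\<lambda>x. ?q x - 1) \<longlongrightarrow> 0) ?F"
    by (rule Lim_null_comparison) (use lim in simp)
  then have "(?q \<longlongrightarrow> 1) ?F" by (rule LIM_zero_cancel)
  then show ?thesis by (simp add: case_prod_unfold)
qed

theorem theorem9:
  fixes T :: "real \<Rightarrow> real \<Rightarrow> (real \<Rightarrow> complex) \<Rightarrow> real \<Rightarrow> complex"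
  defines "T \<equiv> \<lambda>R1 R2. fs_localization {- R1..R1} {- R2..R2}"
  shows "(\<forall>R1>0. \<forall>R2>0.
            (\<forall>\<mu>\<in>fs_eigenvalues (T R1 R2). \<mu> \<noteq> 0 \<longrightarrow> fs_finite_multiplicity (T R1 R2) \<mu>) \<and>
            (\<lambda>\<mu>. of_nat (fs_multiplicity (T R1 R2) \<mu>) * \<mu>\<^sup>2)
              summable_on fs_eigenvalues (T R1 R2)) \<and>
         (\<lambda>(R1, R2). \<Sum>\<^sub>\<infinity>\<mu>\<in>fs_eigenvalues (T R1 R2).
            of_nat (fs_multiplicity (T R1 R2) \<mu>) * \<mu>\<^sup>2)
         \<sim>[at_top \<times>\<^sub>F at_top]
         (\<lambda>(R1, R2). of_real
            (pi / 2 * R1\<^sup>2 + pi / 2 * R2\<^sup>2 +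
             2 * ((R1\<^sup>2 + R2\<^sup>2) * arctan (R1 / R2) - R1 * R2 - R1\<^sup>2 * arctan R1
                  + 2 * R1\<^sup>2 * arctan (R2 / R1))))"
proof -
  have window: "fs_window {- R1..R1} {- R2..R2}" for R1 R2 :: real
    by unfold_locales auto
  have sum_eq: "(\<Sum>\<^sub>\<infinity>\<mu>\<in>fs_eigenvalues (T R1 R2). of_nat (fs_multiplicity (T R1 R2) \<mu>) * \<mu>^2)
      = complex_of_real (fs_window.window_trace {-R1..R1} {-R2..R2})" for R1 R2
    unfolding T_def by (rule infsumI[OF fs_window.eigenvalue_squares_has_sum[OF window]])
  have "((\<lambda>x. complex_of_real (case x of (R1, R2) \<Rightarrow> fs_window.window_trace {-R1..R1} {-R2..R2} / trace_asymptotics R1 R2))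
      \<longlongrightarrow> of_real 1) (at_top \<times>\<^sub>F at_top)"
    by (intro tendsto_of_real window_trace_quotient_tendsto)
  then have "(\<lambda>(R1, R2). \<Sum>\<^sub>\<infinity>\<mu>\<in>fs_eigenvalues (T R1 R2). of_nat (fs_multiplicity (T R1 R2) \<mu>) * \<mu>^2)
      \<sim>[at_top \<times>\<^sub>F at_top] (\<lambda>(R1, R2). of_real (trace_asymptotics R1 R2))"
    unfolding sum_eq by (intro asymp_equivI') (simp add: case_prod_unfold)
  moreover have "fs_finite_multiplicity (T R1 R2) \<mu>"
    if "\<mu> \<in> fs_eigenvalues (T R1 R2)" "\<mu> \<noteq> 0" for R1 R2 \<mu>
    using fs_window.eigenvalue_finite_multiplicity[OF window] that unfolding T_def by blast
  moreover have "(\<lambda>\<mu>. of_nat (fs_multiplicity (T R1 R2) \<mu>) * \<mu>^2) summable_on fs_eigenvalues (T R1 R2)" for R1 R2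
    unfolding T_def by (rule has_sum_imp_summable[OF fs_window.eigenvalue_squares_has_sum[OF window]])
  ultimately show ?thesis unfolding trace_asymptotics_def by blast
qed

end
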